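(* The following results hold: 1. for every $j\in\{\mathtt{ad},\mathtt{st},\mathtt{co},\mathtt{gr}\}\times\{true,false\}$, the decision problem $j$-STRONG-RELEVANCE is in $P$; 2. $\mathtt{pr}$-$true$-STRONG-RELEVANCE is in $\Pi_2^p$; and 3. $\mathtt{pr}$-$false$-STRONG-RELEVANCE is in $coNP$.
   Context: An argumentation framework (AF) is a pair $F=\langle \mathcal{A}_F,\mathcal{R}_F\rangle$ with $\mathcal{R}_F\subseteq\mathcal{A}_F\times\mathcal{A}_F$; $a$ attacks $b$ if $(a,b)\in\mathcal{R}_F$. For $S\subseteq\mathcal{A}_F$: $S_F^+$ is the set of arguments attacked by some element of $S$; $S$ is conflict-free iff $S\cap S_F^+=\emptyset$; $S$ defends $a$ if every attacker of $a$ is attacked by some element of $S$; $\Gamma_F(S)$ is the set of arguments of $F$ defended by $S$. Semantics, for $S\subseteq\mathcal{A}_F$: $S\in\mathtt{ad}(F)$ (admissible) iff $S$ is conflict-free and $S\subseteq\Gamma_F(S)$; $S\in\mathtt{st}(F)$ (stable) iff $S$ is conflict-free and $S_F^+=\mathcal{A}_F\setminus S$; $S\in\mathtt{co}(F)$ (complete) iff $S\in\mathtt{ad}(F)$ and $\Gamma_F(S)\subseteq S$; $S\in\mathtt{gr}(F)$ (grounded) iff $S$ is $\subseteq$-minimal in $\mathtt{co}(F)$; $S\in\mathtt{pr}(F)$ (preferred) iff $S$ is $\subseteq$-maximal in $\mathtt{ad}(F)$. A set $S$ is $\sigma$-$true$ in $F$ iff $S\in\sigma(F)$, and $\sigma$-$false$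 in $F$ iff $S\notin\sigma(F)$ (in particular if $S\not\subseteq\mathcal{A}_F$). An incomplete argumentation framework (IAF) is $I=\langle\mathcal{A},\mathcal{A}^?,\mathcal{R},\mathcal{R}^?\rangle$ with $\mathcal{A},\mathcal{A}^?$ disjoint sets of (certain, uncertain) arguments and $\mathcal{R},\mathcal{R}^?$ disjoint subsets of $(\mathcal{A}\cup\mathcal{A}^?)\times(\mathcal{A}\cup\mathcal{A}^?)$ (certain, uncertain attacks). A partial completion of $I$ is an IAF $I'=\langle\mathcal{A}',\mathcal{A}^{?'},\mathcal{R}',\mathcal{R}^{?'}\rangle$ with $\mathcal{A}\subseteq\mathcal{A}'\subseteq\mathcal{A}\cup\mathcal{A}^?$, $\mathcal{R}\cap((\mathcal{A}'\cup\mathcal{A}^{?'})\times(\mathcal{A}'\cup\mathcal{A}^{?'}))\subseteq\mathcal{R}'\subseteq\mathcal{R}\cup\mathcal{R}^?$, $\mathcal{A}^{?'}\subseteq\mathcal{A}^?$, $\mathcal{R}^{?'}\subseteq\mathcal{R}^?$; $part(I)$ is the set of partial completions. $cert(I)=\langle\mathcal{A},\mathcal{R}\cap(\mathcal{A}\times\mathcal{A})\rangle$. A completion of $I$ is an AF of the form $cert(I')$ with $I'\in part(I)$. $S$ is stable-$j$ w.r.t. $I$ iff $S$ is $j$ in every completion of $I$. For $\mathcal{R}_0\subseteq\mathcal{R}^?$: $I+\mathcal{R}_0=\langle\mathcal{A},\mathcal{A}^?,\mathcal{R}\cup\mathcal{R}_0,\mathcal{R}^?\setminus\mathcal{R}_0\rangle$,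 $I-\mathcal{R}_0=\langle\mathcal{A},\mathcal{A}^?,\mathcal{R},\mathcal{R}^?\setminus\mathcal{R}_0\rangle$. For $\mathcal{A}_0\subseteq\mathcal{A}^?$: $I+\mathcal{A}_0=\langle\mathcal{A}\cup\mathcal{A}_0,\mathcal{A}^?\setminus\mathcal{A}_0,\mathcal{R},\mathcal{R}^?\rangle$, and $I-\mathcal{A}_0=\langle\mathcal{A},\mathcal{A}^?\setminus\mathcal{A}_0,\mathcal{R}\setminus\mathcal{R}'',\mathcal{R}^?\setminus\mathcal{R}''\rangle$ where $\mathcal{R}''$ is the set of attacks in $\mathcal{R}\cup\mathcal{R}^?$ having an endpoint in $\mathcal{A}_0$. Strong relevance: let $S\subseteq\mathcal{A}\cup\mathcal{A}^?$ and let $j$ be a verification status such that $S$ is stable-$j$ w.r.t. at least one $I_p\in part(I)$. For $e\in\mathcal{A}^?\cup\mathcal{R}^?$, addition (resp. removal) of $e$ is strongly $j$-relevant for $S$ w.r.t. $I$ iff for each $I'\in part(I-\{e\})$ (resp. $I'\in part(I+\{e\})$), $S$ is not stable-$j$ w.r.t. $I'$. Problem $j$-STRONG-RELEVANCE. Given: an IAF $I=\langle\mathcal{A},\mathcal{A}^?,\mathcal{R},\mathcal{R}^?\rangle$ and a set $S\subseteq\mathcal{A}\cup\mathcal{A}^?$ such that there is at least one $I'\in part(I)$ with $S$ stable-$j$ w.r.t. $I'$, an action in $\{\text{addition},\text{removal}\}$ and an uncertain element $e\in\mathcal{A}^?\cup\mathcal{R}^?$. Question: is the action on $e$ strongly $j$-relevant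 for $S$ w.r.t. $I$? *)

theory Defs
  imports Main "HOL-Computational_Algebra.Polynomial"
begin

section \<open>Argumentation frameworks\<close>

record 'a af =
  arguments :: "'a set"
  attacks :: "('a \<times> 'a) set"

definition wf_af :: "'a af \<Rightarrow> bool" where
  "wf_af F \<longleftrightarrow> attacks F \<subseteq> arguments F \<times> arguments F"

definition attacked :: "'a af \<Rightarrow> 'a set \<Rightarrow> 'a set" where
  "attacked F S = {b \<in> arguments F. \<exists>a\<in>S. (a, b) \<in> attacks F}"

definition conflict_free :: "'a af \<Rightarrow> 'a set \<Rightarrow> bool" where
  "conflict_free F S \<longleftrightarrow> S \<inter> attacked F S = {}"

definition defends :: "'a af \<Rightarrow> 'a set \<Rightarrow> 'a \<Rightarrow> bool" where
  "defends F S a \<longleftrightarrow> (\<forall>b. (b, a) \<in> attacks F \<longrightarrow> (\<exists>c\<in>S. (c, b) \<in> attacks F))"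

definition defended :: "'a af \<Rightarrow> 'a set \<Rightarrow> 'a set" where
  "defended F S = {a \<in> arguments F. defends F S a}"

type_synonym 'a semantics = "'a af \<Rightarrow> 'a set set"

definition ad :: "'a semantics" where
  "ad F = {S. S \<subseteq> arguments F \<and> conflict_free F S \<and> S \<subseteq> defended F S}"

definition st :: "'a semantics" where
  "st F = {S. S \<subseteq> arguments F \<and> conflict_free F S \<and> attacked F S = arguments F - S}"

definition co :: "'a semantics" where
  "co F = {S \<in> ad F. defended F S \<subseteq> S}"

definition gr :: "'a semantics" where
  "gr F = {S \<in> co F. \<forall>T \<in> co F. T \<subseteq> S \<longrightarrow> T = S}"

definition pr :: "'a semantics" where
  "pr F = {S \<in> ad F. \<forall>T \<in> ad F. S \<subseteq> T \<longrightarrow> T = S}"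

text \<open>
  A verification status is a pair of a semantics and a truth value. A set that is not a set of
  arguments of \<open>F\<close> is in no \<open>\<sigma> F\<close>, hence it is \<open>\<sigma>\<close>-false in \<open>F\<close>.
\<close>

type_synonym 'a status = "'a semantics \<times> bool"

definition has_status :: "'a status \<Rightarrow> 'a af \<Rightarrow> 'a set \<Rightarrow> bool" where
  "has_status j F S \<longleftrightarrow> (if snd j then S \<in> fst j F else S \<notin> fst j F)"


section \<open>Incomplete argumentation frameworks\<close>

record 'a iaf =
  cargs :: "'a set"
  uargs :: "'a set"
  catts :: "('a \<times> 'a) set"
  uatts :: "('a \<times> 'a) set"

definition wf_iaf :: "'a iaf \<Rightarrow> bool" where
  "wf_iaf I \<longleftrightarrow> cargs I \<inter> uargs I = {} \<and> catts I \<inter> uatts I = {} \<and>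
     catts I \<union> uatts I \<subseteq> (cargs I \<union> uargs I) \<times> (cargs I \<union> uargs I)"

definition part :: "'a iaf \<Rightarrow> 'a iaf set" where
  "part I = {I'. wf_iaf I' \<and>
     cargs I \<subseteq> cargs I' \<and> cargs I' \<subseteq> cargs I \<union> uargs I \<and>
     catts I \<inter> ((cargs I' \<union> uargs I') \<times> (cargs I' \<union> uargs I')) \<subseteq> catts I' \<and>
     catts I' \<subseteq> catts I \<union> uatts I \<and>
     uargs I' \<subseteq> uargs I \<and> uatts I' \<subseteq> uatts I}"

definition cert :: "'a iaf \<Rightarrow> 'a af" where
  "cert I = \<lparr>arguments = cargs I, attacks = catts I \<inter> (cargs I \<times> cargs I)\<rparr>"

lemma wf_af_cert: "wf_af (cert I)"
  by (simp add: wf_af_def cert_def)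

definition completions :: "'a iaf \<Rightarrow> 'a af set" where
  "completions I = cert ` part I"

definition stable_status :: "'a status \<Rightarrow> 'a iaf \<Rightarrow> 'a set \<Rightarrow> bool" where
  "stable_status j I S \<longleftrightarrow> (\<forall>F \<in> completions I. has_status j F S)"

definition add_atts :: "'a iaf \<Rightarrow> ('a \<times> 'a) set \<Rightarrow> 'a iaf" where
  "add_atts I R0 = I\<lparr>catts := catts I \<union> R0, uatts := uatts I - R0\<rparr>"

definition rem_atts :: "'a iaf \<Rightarrow> ('a \<times> 'a) set \<Rightarrow> 'a iaf" where
  "rem_atts I R0 = I\<lparr>uatts := uatts I - R0\<rparr>"

definition add_args :: "'a iaf \<Rightarrow> 'a set \<Rightarrow> 'a iaf" where
  "add_args I A0 = I\<lparr>cargs := cargs I \<union> A0, uargs := uargs I - A0\<rparr>"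

definition rem_args :: "'a iaf \<Rightarrow> 'a set \<Rightarrow> 'a iaf" where
  "rem_args I A0 =
     (let R2 = {(a, b) \<in> catts I \<union> uatts I. a \<in> A0 \<or> b \<in> A0}
      in I\<lparr>uargs := uargs I - A0, catts := catts I - R2, uatts := uatts I - R2\<rparr>)"

datatype 'a element = Arg 'a | Att "'a \<times> 'a"

definition uncertain_elements :: "'a iaf \<Rightarrow> 'a element set" where
  "uncertain_elements I = Arg ` uargs I \<union> Att ` uatts I"

fun add_element :: "'a iaf \<Rightarrow> 'a element \<Rightarrow> 'a iaf" where
  "add_element I (Arg a) = add_args I {a}"
| "add_element I (Att r) = add_atts I {r}"

fun rem_element :: "'a iaf \<Rightarrow> 'a element \<Rightarrow> 'a iaf" where
  "rem_element I (Arg a) = rem_args I {a}"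
| "rem_element I (Att r) = rem_atts I {r}"

datatype action = Addition | Removal

fun strongly_relevant ::
    "'a status \<Rightarrow> 'a iaf \<Rightarrow> 'a set \<Rightarrow> action \<Rightarrow> 'a element \<Rightarrow> bool" where
  "strongly_relevant j I S Addition e \<longleftrightarrow>
     (\<forall>I' \<in> part (rem_element I e). \<not> stable_status j I' S)"
| "strongly_relevant j I S Removal e \<longleftrightarrow>
     (\<forall>I' \<in> part (add_element I e). \<not> stable_status j I' S)"


section \<open>Deterministic multitape Turing machines\<close>

text \<open>
  Tapes are two-way infinite. States and symbols are the numbers below \<open>tm_states\<close> and \<open>tm_syms\<close>;
  symbol 0 is the blank, and 1 and 2 represent the input bits \<open>False\<close> and \<open>True\<close>. The transition
  function maps a state and the list of scanned symbols (one per tape) to the next state and,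
  for each tape, the symbol to be written and the head movement.
\<close>

datatype dir = Left | Stay | Right

record tm =
  tm_tapes :: nat
  tm_syms :: nat
  tm_states :: nat
  tm_start :: nat
  tm_accept :: nat
  tm_reject :: nat
  tm_delta :: "nat \<Rightarrow> nat list \<Rightarrow> nat \<times> (nat \<times> dir) list"

definition wf_tm :: "tm \<Rightarrow> bool" where
  "wf_tm M \<longleftrightarrow> 1 \<le> tm_tapes M \<and> 3 \<le> tm_syms M \<and>
     tm_start M < tm_states M \<and> tm_accept M < tm_states M \<and> tm_reject M < tm_states M \<and>
     tm_accept M \<noteq> tm_reject M \<and>
     (\<forall>q rs. q < tm_states M \<longrightarrow> length rs = tm_tapes M \<longrightarrow> set rs \<subseteq> {..<tm_syms M} \<longrightarrow>
        fst (tm_delta M q rs) < tm_states M \<and>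
        length (snd (tm_delta M q rs)) = tm_tapes M \<and>
        fst ` set (snd (tm_delta M q rs)) \<subseteq> {..<tm_syms M})"

type_synonym tape = "(int \<Rightarrow> nat) \<times> int"
type_synonym config = "nat \<times> tape list"

fun tape_read :: "tape \<Rightarrow> nat" where
  "tape_read (c, h) = c h"

fun move :: "dir \<Rightarrow> int \<Rightarrow> int" where
  "move Left h = h - 1"
| "move Stay h = h"
| "move Right h = h + 1"

fun tape_act :: "nat \<times> dir \<Rightarrow> tape \<Rightarrow> tape" where
  "tape_act (s, d) (c, h) = (c(h := s), move d h)"

fun tm_step :: "tm \<Rightarrow> config \<Rightarrow> config" where
  "tm_step M (q, ts) =
     (if q = tm_accept M \<or> q = tm_reject M then (q, ts)
      else let (q', as) = tm_delta M q (map tape_read ts) in (q', map2 tape_act as ts))"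

definition input_tape :: "bool list \<Rightarrow> tape" where
  "input_tape x =
     (\<lambda>i. if 0 \<le> i \<and> i < int (length x) then (if x ! nat i then 2 else 1) else 0, 0)"

definition blank_tape :: tape where
  "blank_tape = (\<lambda>i. 0, 0)"

definition tm_init :: "tm \<Rightarrow> bool list \<Rightarrow> config" where
  "tm_init M x = (tm_start M, input_tape x # replicate (tm_tapes M - 1) blank_tape)"

text \<open>Halting configurations are fixed points of \<open>tm_step\<close>.\<close>

definition decides_in_time :: "tm \<Rightarrow> bool list set \<Rightarrow> (nat \<Rightarrow> nat) \<Rightarrow> bool" where
  "decides_in_time M X T \<longleftrightarrow> wf_tm M \<and>
     (\<forall>x. fst ((tm_step M ^^ T (length x)) (tm_init M x)) =
            (if x \<in> X then tm_accept M else tm_reject M))"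


section \<open>Complexity classes\<close>

text \<open>A self-delimiting, hence injective, pairing of strings.\<close>

definition pair :: "bool list \<Rightarrow> bool list \<Rightarrow> bool list" where
  "pair x u = concat (map (\<lambda>b. [True, b]) x) @ [False] @ u"

definition ex_poly :: "bool list set set \<Rightarrow> bool list set set" where
  "ex_poly C = {X. \<exists>Y \<in> C. \<exists>p :: nat poly. \<forall>x.
     x \<in> X \<longleftrightarrow> (\<exists>u. length u \<le> poly p (length x) \<and> pair x u \<in> Y)}"

definition class_P :: "bool list set set" where
  "class_P = {X. \<exists>M. \<exists>p :: nat poly. decides_in_time M X (poly p)}"

definition class_NP :: "bool list set set" where
  "class_NP = ex_poly class_P"

definition class_coNP :: "bool list set set" where
  "class_coNP = {X. - X \<in> class_NP}"

definition class_Sigma2 :: "bool list set set" where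
  "class_Sigma2 = ex_poly class_coNP"

definition class_Pi2 :: "bool list set set" where
  "class_Pi2 = {X. - X \<in> class_Sigma2}"

text \<open>
  A promise problem is given by its yes-instances and its no-instances; nothing is required on
  strings that are neither (here, strings that encode no input, or an input for which \<open>S\<close> is
  stable-\<open>j\<close> in no partial completion).
\<close>

type_synonym promise_problem = "bool list set \<times> bool list set"

definition promise :: "bool list set set \<Rightarrow> promise_problem set" where
  "promise C = {(Y, N). \<exists>X \<in> C. Y \<subseteq> X \<and> N \<inter> X = {}}"


section \<open>The decision problem\<close>

text \<open>
  Encoding of an input relative to an enumeration \<open>xs\<close> of all its arguments: the number of
  arguments in unary, the action, an array with three bits per argument, and an adjacency matrix
  with three bits per pair of arguments. The third bits mark the element in question.
\<close>

definition encode ::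
    "'a list \<Rightarrow> 'a iaf \<Rightarrow> 'a set \<Rightarrow> action \<Rightarrow> 'a element \<Rightarrow> bool list" where
  "encode xs I S act e =
     replicate (length xs) True @ [False] @ [act = Addition] @
     concat (map (\<lambda>a. [a \<in> uargs I, a \<in> S, e = Arg a]) xs) @
     concat (map (\<lambda>r. [r \<in> catts I, r \<in> uatts I, e = Att r]) (List.product xs xs))"

definition valid_input ::
    "'a status \<Rightarrow> 'a list \<Rightarrow> 'a iaf \<Rightarrow> 'a set \<Rightarrow> 'a element \<Rightarrow> bool" where
  "valid_input j xs I S e \<longleftrightarrow>
     wf_iaf I \<and> distinct xs \<and> set xs = cargs I \<union> uargs I \<and>
     S \<subseteq> cargs I \<union> uargs I \<and> e \<in> uncertain_elements I \<and>
     (\<exists>I' \<in> part I. stable_status j I' S)"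

definition STRONG_RELEVANCE :: "'a status \<Rightarrow> promise_problem" where
  "STRONG_RELEVANCE j =
     ({encode xs I S act e | xs I S act e.
         valid_input j xs I S e \<and> strongly_relevant j I S act e},
      {encode xs I S act e | xs I S act e.
         valid_input j xs I S e \<and> \<not> strongly_relevant j I S act e})"

end

theory Submission
  imports Defs
begin

text \<open>
  \<open>S\<close> is stable-\<open>j\<close> in some partial completion iff it is \<open>j\<close> in some completion, since a completion is
  itself a partial completion. So strong relevance of an action on \<open>e\<close> says that no completion of the IAF
  resulting from the opposite action makes \<open>S\<close> have status \<open>j\<close>.
  For \<open>ad\<close>, \<open>st\<close>, \<open>co\<close> and \<open>gr\<close> the existence of such a completion can be read off the IAF:
  it is a first-order property of the attack relations and of at most two least fixed points, namely the
  arguments that cannot be left undecided when \<open>S\<close> is complete, and the part of \<open>S\<close> that is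
  constructed from the unattacked arguments. For \<open>pr\<close>, a completion and a larger admissible set are guessed.
  Such properties are decided in polynomial time by programs whose loops are bounded by polynomials in
  the input length. Turing machines keep the variables of these programs in unary, as head positions.
\<close>

section \<open>Command stacks as the finite control of a deterministic machine\<close>

section \<open>Structured programs for Turing machines\<close>

text \<open>Membership in P speaks of concrete machines, so much of the work is a compiler. Its
  source language has a single set of numbers that only grows, and bounded quantifiers and loops:
  growth lets fixed points be reached by a fixed number of rounds without a test for stability, and
  boundedness lets a polynomial cost be read off the syntax. The combinatorial obstacle is that
  completeness is not monotone in the completion. An argument neither in \<open>S\<close> nor
  attacked by \<open>S\<close> must have an attacker in the same position, which must have one as
  well. The largest set that can sustain this circular demand is the complement of a least fixed
  point, \<open>doomed\<close>. With it, the single construction \<open>favour\<close> serves all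
  four positive statuses, whereas each negative status has a worst completion of its own. For
  \<open>pr\<close> the certificates may be malformed; therefore every string decodes to some
  completion. Formulas take the access to a bit of the instance as a parameter, so that one
  correctness proof covers plain, paired and doubly paired inputs.\<close>

datatype cmd =
    Mov nat dir
  | Write nat nat
  | Seq cmd cmd
  | Branch nat "nat \<Rightarrow> bool" cmd cmd
  | While nat "nat \<Rightarrow> bool" cmd

fun cmd_acts :: "cmd \<Rightarrow> nat list \<Rightarrow> (nat \<times> dir) list" where
  "cmd_acts (Mov k d) rs = (map (\<lambda>s. (s, Stay)) rs)[k := (rs ! k, d)]"
| "cmd_acts (Write k s) rs = (map (\<lambda>s. (s, Stay)) rs)[k := (s, Stay)]"
| "cmd_acts _ rs = map (\<lambda>s. (s, Stay)) rs"

fun cmd_next :: "cmd \<Rightarrow> cmd list \<Rightarrow> nat list \<Rightarrow> cmd list" where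
  "cmd_next (Mov k d) K rs = K"
| "cmd_next (Write k s) K rs = K"
| "cmd_next (Seq c d) K rs = c # d # K"
| "cmd_next (Branch k Q c d) K rs = (if Q (rs ! k) then c # K else d # K)"
| "cmd_next (While k Q c) K rs = (if Q (rs ! k) then c # While k Q c # K else K)"

text \<open>The list is a stack of pending commands. Control commands only rearrange it, so each
  command step is one machine step.\<close>

fun cmd_step :: "cmd list \<times> tape list \<Rightarrow> cmd list \<times> tape list" where
  "cmd_step ([], ts) = ([], ts)"
| "cmd_step (c # K, ts) =
     (cmd_next c K (map tape_read ts), map2 tape_act (cmd_acts c (map tape_read ts)) ts)"

text \<open>The states of the machine are the continuations that can occur while \<open>c\<close> runs before \<open>K\<close>.\<close>

fun conts :: "cmd \<Rightarrow> cmd list \<Rightarrow> cmd list set" where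
  "conts (Mov k d) K = {Mov k d # K}"
| "conts (Write k s) K = {Write k s # K}"
| "conts (Seq c d) K = insert (Seq c d # K) (conts c (d # K) \<union> conts d K)"
| "conts (Branch k Q c d) K = insert (Branch k Q c d # K) (conts c K \<union> conts d K)"
| "conts (While k Q c) K = insert (While k Q c # K) (conts c (While k Q c # K))"

fun writes_below :: "nat \<Rightarrow> cmd \<Rightarrow> bool" where
  "writes_below b (Mov k d) \<longleftrightarrow> True"
| "writes_below b (Write k s) \<longleftrightarrow> s < b"
| "writes_below b (Seq c d) \<longleftrightarrow> writes_below b c \<and> writes_below b d"
| "writes_below b (Branch k Q c d) \<longleftrightarrow> writes_below b c \<and> writes_below b d"
| "writes_below b (While k Q c) \<longleftrightarrow> writes_below b c"

lemma finite_conts: "finite (conts c K)"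
  by (induction c arbitrary: K) auto

lemma conts_start: "c # K \<in> conts c K"
  by (cases c) auto

text \<open>Unfolding a loop returns to the stack \<open>While k Q c # K\<close> itself, so stacks
  do not grow with the number of rounds, and finitely many states suffice.\<close>

lemma conts_closed:
  assumes "d # L \<in> conts c K"
  shows "cmd_next d L rs \<in> insert K (conts c K)"
  using assms
proof (induction c arbitrary: K)
  case (Seq c1 c2)
  then show ?case using conts_start[of c1] conts_start[of c2] by fastforce
next
  case (Branch k Q c1 c2)
  then show ?case by (auto simp: conts_start dest: Branch.IH[of K])
next
  case (While k Q c)
  then show ?case using conts_start[of c] by fastforce
qed auto

lemma conts_writes_below:
  assumes "L \<in> conts c K" "writes_below b c" "\<forall>d\<in>set K. writes_below b d"
  shows "\<forall>d\<in>set L. writes_below b d"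
  using assms
proof (induction c arbitrary: K)
  case (Seq c1 c2)
  then show ?case by (metis Un_iff conts.simps(3) insertE set_ConsD writes_below.simps(3))
next
  case (Branch k Q c1 c2)
  then show ?case by (metis Un_iff conts.simps(4) insertE set_ConsD writes_below.simps(4))
next
  case (While k Q c)
  then show ?case by (metis conts.simps(5) insertE set_ConsD writes_below.simps(5))
qed auto

lemma tape_act_id: "tape_act (tape_read t, Stay) t = t"
  by (cases t) simp

lemma map2_tape_act_id: "map2 tape_act (map (\<lambda>s. (s, Stay)) (map tape_read ts)) ts = ts"
  by (induction ts) (simp_all add: tape_act_id)

lemma map2_tape_act_update:
  assumes "k < length ts"
  shows "map2 tape_act ((map (\<lambda>s. (s, Stay)) (map tape_read ts))[k := a]) ts
    = ts[k := tape_act a (ts ! k)]"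
  using assms by (intro nth_equalityI) (auto simp: nth_list_update tape_act_id)

lemma length_cmd_acts: "length (cmd_acts c rs) = length rs"
  by (cases c) auto

text \<open>Quantifying over the continuation \<open>K\<close> makes runs composable: what is
  pending affects neither the time nor the tapes.\<close>

definition runs :: "cmd \<Rightarrow> tape list \<Rightarrow> nat \<Rightarrow> tape list \<Rightarrow> bool" where
  "runs c ts t ts' \<longleftrightarrow> (\<forall>K. (cmd_step ^^ t) (c # K, ts) = (K, ts'))"

lemma runs_Mov: "k < length ts \<Longrightarrow>
  runs (Mov k d) ts 1 (ts[k := tape_act (tape_read (ts ! k), d) (ts ! k)])"
  by (simp add: runs_def map2_tape_act_update flip: map_map)

lemma runs_Write: "k < length ts \<Longrightarrow>
  runs (Write k s) ts 1 (ts[k := tape_act (s, Stay) (ts ! k)])"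
  by (simp add: runs_def map2_tape_act_update flip: map_map)

lemma runs_trans:
  assumes "cmd_step (c # K, ts) = (K', ts)" "(cmd_step ^^ t) (K', ts) = y"
  shows "(cmd_step ^^ Suc t) (c # K, ts) = y"
  using assms by (simp add: funpow_swap1)

lemma runs_Seq:
  assumes "runs c ts t1 ts1" "runs d ts1 t2 ts2"
  shows "runs (Seq c d) ts (Suc (t1 + t2)) ts2"
  unfolding runs_def
proof
  fix K
  have "(cmd_step ^^ (t2 + t1)) (c # d # K, ts) = (K, ts2)"
    using assms unfolding runs_def by (simp add: funpow_add)
  then show "(cmd_step ^^ Suc (t1 + t2)) (Seq c d # K, ts) = (K, ts2)"
    by (intro runs_trans[where K' = "c # d # K"])
      (simp_all add: add.commute map2_tape_act_id del: map_map)
qed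

lemma runs_Branch:
  assumes "k < length ts" "runs (if Q (tape_read (ts ! k)) then c else d) ts t ts'"
  shows "runs (Branch k Q c d) ts (Suc t) ts'"
  unfolding runs_def
proof
  fix K
  show "(cmd_step ^^ Suc t) (Branch k Q c d # K, ts) = (K, ts')"
    by (rule runs_trans[where K' = "(if Q (tape_read (ts ! k)) then c else d) # K"])
      (use assms in \<open>simp_all add: map2_tape_act_id runs_def del: map_map\<close>)
qed

lemma runs_While_False:
  assumes "k < length ts" "\<not> Q (tape_read (ts ! k))"
  shows "runs (While k Q c) ts 1 ts"
  using assms by (simp add: runs_def map2_tape_act_id del: map_map)

lemma runs_While_True:
  assumes "k < length ts" "Q (tape_read (ts ! k))" "runs c ts t1 ts1" "runs (While k Q c) ts1 t2 ts2"
  shows "runs (While k Q c) ts (Suc (t1 + t2)) ts2"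
  unfolding runs_def
proof
  fix K
  have "(cmd_step ^^ (t2 + t1)) (c # While k Q c # K, ts) = (K, ts2)"
    using assms(3,4) unfolding runs_def by (simp add: funpow_add)
  then show "(cmd_step ^^ Suc (t1 + t2)) (While k Q c # K, ts) = (K, ts2)"
    by (intro runs_trans[where K' = "c # While k Q c # K"])
      (use assms(1,2) in \<open>simp_all add: add.commute map2_tape_act_id del: map_map\<close>)
qed

lemma funpow_fixed: "f y = y \<Longrightarrow> (f ^^ t) y = y"
  by (induction t) auto

text \<open>The stacks, numbered by \<open>g\<close>, are the states below \<open>n\<close>. The
  empty stack makes one more transition, to the verdict \<open>n\<close> or \<open>Suc n\<close>
  according to the symbol under head \<open>k\<close>; this is the extra unit of time.\<close>

lemma cmd_decides:
  fixes Q :: "nat \<Rightarrow> bool"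
  assumes wb: "writes_below b c" and b: "3 \<le> b" and m: "k < m"
    and run: "\<And>x. \<exists>t ts'. t \<le> T (length x) \<and> length ts' = m \<and>
        runs c (input_tape x # replicate (m - 1) blank_tape) t ts' \<and>
        (x \<in> X \<longleftrightarrow> Q (tape_read (ts' ! k)))"
  shows "\<exists>M. decides_in_time M X (\<lambda>n. Suc (T n))"
proof -
  define St where "St = insert [] (conts c [])"
  have finSt: "finite St" by (simp add: St_def finite_conts)
  define n where "n = card St"
  from finSt obtain g where g: "bij_betw g St {0..<n}"
    unfolding n_def by (metis ex_bij_betw_finite_nat)
  define h where "h = inv_into St g"
  have hg: "h (g L) = L" if "L \<in> St" for L
    using g that by (simp add: h_def bij_betw_def)
  have gn: "g L < n" if "L \<in> St" for L
    using g that by (auto simp: bij_betw_def)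
  have hSt: "h q \<in> St" if "q < n" for q
    using g that unfolding h_def by (metis atLeastLessThan_iff bij_betw_def inv_into_into zero_le)
  \<comment> \<open>The branch \<open>n \<le> q\<close> keeps \<open>wf_tm\<close> true at the two
    halting states.\<close>
  define \<delta> where "\<delta> q rs = (if n \<le> q then (q, map (\<lambda>s. (s, Stay)) rs)
     else case h q of
       [] \<Rightarrow> (if Q (rs ! k) then n else Suc n, map (\<lambda>s. (s, Stay)) rs)
     | d # L \<Rightarrow> (g (cmd_next d L rs), cmd_acts d rs))" for q and rs :: "nat list"
  define M where "M = \<lparr>tm_tapes = m, tm_syms = b, tm_states = n + 2, tm_start = g [c],
    tm_accept = n, tm_reject = Suc n, tm_delta = \<delta>\<rparr>"
  have next_St: "cmd_next d L rs \<in> St" if "d # L \<in> St" for d L rs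
    using conts_closed[of d L c "[]" rs] that by (auto simp: St_def)
  have start_St: "[c] \<in> St" by (simp add: St_def conts_start)
  have wbSt: "writes_below b d" if "d # L \<in> St" for d L
    using conts_writes_below[OF _ wb, of "d # L" "[]"] that by (auto simp: St_def)
  have wf: "wf_tm M"
  proof -
    have "fst (\<delta> q rs) < n + 2 \<and> length (snd (\<delta> q rs)) = m \<and>
        fst ` set (snd (\<delta> q rs)) \<subseteq> {..<b}"
      if q: "q < n + 2" and len: "length rs = m" and rs: "set rs \<subseteq> {..<b}" for q rs
    proof (cases "n \<le> q")
      case True
      then show ?thesis using that by (auto simp: \<delta>_def)
    next
      case False
      show ?thesis
      proof (cases "h q")
        case Nil
        then show ?thesis using False that by (auto simp: \<delta>_def)
      next
        case (Cons d L)
        then have dL: "d # L \<in> St" using hSt[of q] False by simp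
        have "set (cmd_acts d rs) \<subseteq> {..<b} \<times> UNIV"
        proof -
          have upd: "set ((map (\<lambda>s. (s, Stay)) rs)[i := (s, e)]) \<subseteq> {..<b} \<times> UNIV"
            if "i < length rs \<longrightarrow> s < b" for i s e
          proof (cases "i < length rs")
            case True
            then have "set ((map (\<lambda>s. (s, Stay)) rs)[i := (s, e)])
                \<subseteq> insert (s, e) (set (map (\<lambda>s. (s, Stay)) rs))"
              by (metis set_update_subset_insert)
            then show ?thesis using rs that True by auto
          next
            case False
            then show ?thesis using rs by (auto simp: list_update_beyond)
          qed
          show ?thesis
          proof (cases d)
            case (Mov i e)
            then show ?thesis using upd[of i "rs ! i" e] rs by (auto simp: subset_iff)
          next
            case (Write i s)
            then show ?thesis using upd[of i s Stay] wbSt[OF dL] by simp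
          qed (use rs in auto)
        qed
        then show ?thesis using False Cons gn[OF next_St[OF dL, of rs]] len
          by (auto simp: \<delta>_def length_cmd_acts)
      qed
    qed
    then show ?thesis using b m gn[OF start_St] by (simp add: wf_tm_def M_def)
  qed
  have sim: "tm_step M (apfst g y) = apfst g (cmd_step y)" if "fst y \<in> St" "fst y \<noteq> []" for y
  proof -
    from that(2) obtain d K ts where y: "y = (d # K, ts)"
      by (metis fst_conv neq_Nil_conv old.prod.exhaust)
    have "g (d # K) < n" using gn that y by auto
    then show ?thesis using hg[OF that(1)] unfolding y by (simp add: M_def \<delta>_def)
  qed
  have cSt: "fst ((cmd_step ^^ t) ([c], ts)) \<in> St" for t ts
  proof (induction t)
    case (Suc t)
    then show ?case
      by (cases "(cmd_step ^^ t) ([c], ts)"; cases "fst ((cmd_step ^^ t) ([c], ts))")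
        (auto simp: next_St)
  qed (simp add: start_St)
  have simt: "(tm_step M ^^ t) (g [c], ts) = apfst g ((cmd_step ^^ t) ([c], ts))"
    if "\<forall>i<t. fst ((cmd_step ^^ i) ([c], ts)) \<noteq> []" for t ts
    using that by (induction t) (simp_all add: sim cSt del: tm_step.simps)
  have "fst ((tm_step M ^^ Suc (T (length x))) (tm_init M x)) =
      (if x \<in> X then tm_accept M else tm_reject M)" for x
  proof -
    let ?ts = "input_tape x # replicate (m - 1) blank_tape"
    from run[of x] obtain t ts' where t: "t \<le> T (length x)" "length ts' = m" "runs c ?ts t ts'"
      "x \<in> X \<longleftrightarrow> Q (tape_read (ts' ! k))" by blast
    have fin: "(cmd_step ^^ t) ([c], ?ts) = ([], ts')" using t(3) by (simp add: runs_def)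
    \<comment> \<open>At the empty stack \<open>cmd_step\<close> stands still while the machine
      issues its verdict, so the simulation is followed only up to the first empty stack.\<close>
    define t0 where "t0 = (LEAST t. fst ((cmd_step ^^ t) ([c], ?ts)) = [])"
    have e: "fst ((cmd_step ^^ t) ([c], ?ts)) = []" using fin by simp
    have t0: "fst ((cmd_step ^^ t0) ([c], ?ts)) = []"
      unfolding t0_def using e by (rule LeastI)
    have t0_le: "t0 \<le> t"
      unfolding t0_def using e by (rule Least_le)
    have least: "\<forall>i<t0. fst ((cmd_step ^^ i) ([c], ?ts)) \<noteq> []"
      unfolding t0_def using not_less_Least by blast
    obtain ts0 where ts0: "(cmd_step ^^ t0) ([c], ?ts) = ([], ts0)" using t0 by (metis prod.collapse)
    have "(cmd_step ^^ ((t - t0) + t0)) ([c], ?ts) = ([], ts0)"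
      unfolding funpow_add using ts0 by (simp add: funpow_fixed)
    then have "ts0 = ts'" using fin t0_le by simp
    then have r: "(tm_step M ^^ t0) (tm_init M x) = (g [], ts')"
      using simt[OF least] ts0 by (simp add: tm_init_def M_def)
    have "[] \<in> St" by (simp add: St_def)
    then have "fst (tm_step M (g [], ts')) = (if x \<in> X then n else Suc n)"
      using gn[of "[]"] hg[of "[]"] t(2,4) m by (simp add: M_def \<delta>_def)
    moreover have "fst ((tm_step M ^^ i) y) = fst y"
      if "fst y \<in> {n, Suc n}" for y i
    proof -
      have "tm_step M y = y" using that by (cases y) (auto simp: M_def)
      then show ?thesis by (simp add: funpow_fixed)
    qed
    ultimately have "fst ((tm_step M ^^ (T (length x) - t0)) (tm_step M ((tm_step M ^^ t0) (tm_init M x))))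
        = (if x \<in> X then n else Suc n)"
      using r by simp
    moreover have "(tm_step M ^^ (T (length x) - t0)) (tm_step M ((tm_step M ^^ t0) (tm_init M x)))
        = (tm_step M ^^ ((T (length x) - t0) + Suc t0)) (tm_init M x)"
      unfolding funpow_add by simp
    ultimately show ?thesis using t(1) t0_le by (simp add: M_def)
  qed
  with wf show ?thesis unfolding decides_in_time_def by blast
qed


section \<open>Unary counters on marked tapes\<close>

section \<open>A bounded-loop language on registers\<close>

text \<open>
  Tapes 0 and 1 hold the input and a set \<open>X\<close> of numbers, tape 2 holds a truth value, tape 3 the
  input length, and the other tapes hold variables. The head position relative to the end
  marker 3 is the value \<open>\<rho> k\<close> of the register; the data of tapes 0 and 1 start right after the marker.
\<close>

definition reg_tape :: "bool list \<Rightarrow> nat set \<Rightarrow> (nat \<Rightarrow> nat) \<Rightarrow> nat \<Rightarrow> tape" where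
  "reg_tape x X \<rho> k =
     (if k = 0 then ((fst (input_tape x))(-1 := 3), int (\<rho> 0) - 1)
      else if k = 1 then
        (\<lambda>i. if i = 0 then 3 else if 0 < i \<and> nat (i - 1) \<in> X then 2 else 0, int (\<rho> 1))
      else ((\<lambda>i. 0)(0 := 3), int (\<rho> k)))"

definition reg_tapes :: "bool list \<Rightarrow> nat \<Rightarrow> nat set \<Rightarrow> (nat \<Rightarrow> nat) \<Rightarrow> tape list" where
  "reg_tapes x m X \<rho> = map (reg_tape x X \<rho>) [0..<m]"

text \<open>The marker is the only cell with symbol 3, so scanning it is the zero test.\<close>

lemma read_eq_3: "tape_read (reg_tape x X \<rho> k) = 3 \<longleftrightarrow> \<rho> k = 0"
  by (auto simp: reg_tape_def input_tape_def)

lemma read_0: "\<rho> 0 = Suc p \<Longrightarrow>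
    tape_read (reg_tape x X \<rho> 0) = (if p < length x then if x ! p then 2 else 1 else 0)"
  by (auto simp: reg_tape_def input_tape_def)

lemma read_1: "\<rho> (Suc 0) = Suc p \<Longrightarrow> tape_read (reg_tape x X \<rho> (Suc 0)) = 2 \<longleftrightarrow> p \<in> X"
  by (auto simp: reg_tape_def)

text \<open>An upper bound on the time, instead of the exact count in \<open>runs\<close>, lets both
  outcomes of a test share one bound.\<close>

definition does :: "bool list \<Rightarrow> nat \<Rightarrow> cmd \<Rightarrow> (nat \<Rightarrow> nat) \<Rightarrow> nat set \<Rightarrow> nat \<Rightarrow>
    (nat \<Rightarrow> nat) \<Rightarrow> nat set \<Rightarrow> bool" where
  "does x m c \<rho> X T \<rho>' X' \<longleftrightarrow>
     (\<exists>t\<le>T. runs c (reg_tapes x m X \<rho>) t (reg_tapes x m X' \<rho>'))"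

lemma does_mono: "does x m c \<rho> X T \<rho>' X' \<Longrightarrow> T \<le> T' \<Longrightarrow> does x m c \<rho> X T' \<rho>' X'"
  unfolding does_def by (meson le_trans)

lemma does_1I:
  assumes "runs c (reg_tapes x m X \<rho>) 1 ((reg_tapes x m X \<rho>)[k := a])" "k < m"
    "a = reg_tape x X' \<rho>' k" "\<And>j. j \<noteq> k \<Longrightarrow> reg_tape x X \<rho> j = reg_tape x X' \<rho>' j"
  shows "does x m c \<rho> X 1 \<rho>' X'"
proof -
  have "(reg_tapes x m X \<rho>)[k := a] = reg_tapes x m X' \<rho>'"
    using assms(2-4) by (intro nth_equalityI) (auto simp: reg_tapes_def nth_list_update)
  then show ?thesis using assms(1) unfolding does_def by auto
qed

lemma length_reg_tapes [simp]: "length (reg_tapes x m X \<rho>) = m"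
  by (simp add: reg_tapes_def)

lemma nth_reg_tapes [simp]: "k < m \<Longrightarrow> reg_tapes x m X \<rho> ! k = reg_tape x X \<rho> k"
  by (simp add: reg_tapes_def)

lemma does_inc: "k < m \<Longrightarrow> does x m (Mov k Right) \<rho> X 1 (\<rho>(k := Suc (\<rho> k))) X"
  by (rule does_1I[OF runs_Mov, where k = k]) (auto simp: reg_tape_def)

lemma does_dec: "k < m \<Longrightarrow> \<rho> k = Suc j \<Longrightarrow> does x m (Mov k Left) \<rho> X 1 (\<rho>(k := j)) X"
  by (cases "k = 0"; rule does_1I[OF runs_Mov, where k = k]) (auto simp: reg_tape_def)

lemma does_stay: "k < m \<Longrightarrow> does x m (Mov k Stay) \<rho> X 1 \<rho> X"
  by (rule does_1I[OF runs_Mov, where k = k]) (auto simp: reg_tape_def)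

lemma does_write: "1 < m \<Longrightarrow> \<rho> 1 = Suc p \<Longrightarrow> does x m (Write 1 2) \<rho> X 1 \<rho> (insert p X)"
  by (rule does_1I[OF runs_Write, where k = 1]) (auto simp: reg_tape_def fun_eq_iff)

lemma does_Seq:
  assumes "does x m c \<rho> X T1 \<rho>1 X1" "does x m d \<rho>1 X1 T2 \<rho>2 X2"
  shows "does x m (Seq c d) \<rho> X (Suc (T1 + T2)) \<rho>2 X2"
proof -
  from assms obtain t1 t2 where "t1 \<le> T1" "t2 \<le> T2"
    "runs c (reg_tapes x m X \<rho>) t1 (reg_tapes x m X1 \<rho>1)"
    "runs d (reg_tapes x m X1 \<rho>1) t2 (reg_tapes x m X2 \<rho>2)"
    unfolding does_def by blast
  then show ?thesis unfolding does_def using runs_Seq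
    by (metis Suc_le_mono add_mono)
qed

lemma does_Branch:
  assumes "k < m" "does x m (if Q (tape_read (reg_tape x X \<rho> k)) then c else d) \<rho> X T \<rho>' X'"
  shows "does x m (Branch k Q c d) \<rho> X (Suc T) \<rho>' X'"
  using assms runs_Branch[of k "reg_tapes x m X \<rho>" Q c d]
  unfolding does_def by (metis Suc_le_mono length_reg_tapes nth_reg_tapes)

abbreviation branch_pos :: "nat \<Rightarrow> cmd \<Rightarrow> cmd \<Rightarrow> cmd" where
  "branch_pos k \<equiv> Branch k (\<lambda>s. s \<noteq> 3)"

abbreviation loop :: "nat \<Rightarrow> cmd \<Rightarrow> cmd" where
  "loop k c \<equiv> While k (\<lambda>s. s \<noteq> 3) (Seq (Mov k Left) c)"

lemma does_branch_pos:
  assumes "k < m" "does x m (if \<rho> k \<noteq> 0 then c else d) \<rho> X T \<rho>' X'"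
  shows "does x m (branch_pos k c d) \<rho> X (Suc T) \<rho>' X'"
  using assms by (intro does_Branch) (auto simp: read_eq_3)

text \<open>The families \<open>s\<close> and \<open>Y\<close> are the loop invariant, indexed by
  the counter, and are thus traversed from \<open>r\<close> down to 0. The 3 pays for the test, the
  sequencing and the decrement.\<close>

lemma does_loop:
  assumes "k < m" "\<And>i. i \<le> r \<Longrightarrow> s i k = i"
    "\<And>i. i < r \<Longrightarrow> does x m c ((s (Suc i))(k := i)) (Y (Suc i)) T (s i) (Y i)"
  shows "does x m (loop k c) (s r) (Y r) (1 + r * (T + 3)) (s 0) (Y 0)"
  using assms
proof (induction r)
  case 0
  have "runs (loop k c) (reg_tapes x m (Y 0) (s 0)) 1 (reg_tapes x m (Y 0) (s 0))"
    using 0 by (intro runs_While_False) (auto simp: read_eq_3)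
  then show ?case unfolding does_def by auto
next
  case (Suc r)
  have "does x m (loop k c) (s r) (Y r) (1 + r * (T + 3)) (s 0) (Y 0)"
    using Suc by simp
  then obtain t2 where t2: "t2 \<le> 1 + r * (T + 3)"
    "runs (loop k c) (reg_tapes x m (Y r) (s r)) t2 (reg_tapes x m (Y 0) (s 0))"
    unfolding does_def by blast
  have "does x m (Seq (Mov k Left) c) (s (Suc r)) (Y (Suc r)) (Suc (1 + T)) (s r) (Y r)"
    using Suc.prems(1,2) by (intro does_Seq[OF does_dec Suc.prems(3)]) auto
  then obtain t1 where t1: "t1 \<le> Suc (1 + T)"
    "runs (Seq (Mov k Left) c) (reg_tapes x m (Y (Suc r)) (s (Suc r))) t1 (reg_tapes x m (Y r) (s r))"
    unfolding does_def by blast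
  have "runs (loop k c) (reg_tapes x m (Y (Suc r)) (s (Suc r))) (Suc (t1 + t2))
      (reg_tapes x m (Y 0) (s 0))"
    using Suc.prems(1,2) by (intro runs_While_True[OF _ _ t1(2) t2(2)]) (auto simp: read_eq_3)
  moreover have "Suc (t1 + t2) \<le> 1 + Suc r * (T + 3)" using t1(1) t2(1) by simp
  ultimately show ?case unfolding does_def by blast
qed

lemma does_reset:
  assumes "k < m" "\<rho> k \<le> B"
  shows "does x m (loop k (Mov k Stay)) \<rho> X (1 + B * 4) (\<rho>(k := 0)) X"
proof -
  have "does x m (loop k (Mov k Stay)) (\<rho>(k := \<rho> k)) X (1 + \<rho> k * (1 + 3)) (\<rho>(k := 0)) X"
    using does_stay[OF assms(1), of x _ X] assms(1)
    by (intro does_loop[where s = "\<lambda>i. \<rho>(k := i)" and Y = "\<lambda>_. X"]) (simp_all only: fun_upd_same fun_upd_upd)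
  then show ?thesis using assms(2) by (auto elim: does_mono)
qed


subsection \<open>Terms\<close>

datatype trm = Var nat | Cst nat | Add trm trm | Mul trm trm

fun val :: "(nat \<Rightarrow> nat) \<Rightarrow> trm \<Rightarrow> nat" where
  "val \<rho> (Var v) = \<rho> v"
| "val \<rho> (Cst c) = c"
| "val \<rho> (Add a b) = val \<rho> a + val \<rho> b"
| "val \<rho> (Mul a b) = val \<rho> a * val \<rho> b"

fun wf_trm :: "nat \<Rightarrow> trm \<Rightarrow> bool" where
  "wf_trm d (Var v) \<longleftrightarrow> 3 \<le> v \<and> v < d"
| "wf_trm d (Cst c) \<longleftrightarrow> True"
| "wf_trm d (Add a b) \<longleftrightarrow> wf_trm d a \<and> wf_trm d b"
| "wf_trm d (Mul a b) \<longleftrightarrow> wf_trm d a \<and> wf_trm d b"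

text \<open>Number of consecutive scratch registers that \<open>add_trm\<close> touches.\<close>

fun trm_depth :: "trm \<Rightarrow> nat" where
  "trm_depth (Var v) = 1"
| "trm_depth (Cst c) = 0"
| "trm_depth (Add a b) = max (trm_depth a) (trm_depth b)"
| "trm_depth (Mul a b) = Suc (max (trm_depth a) (trm_depth b))"

fun val_bound :: "trm \<Rightarrow> nat \<Rightarrow> nat" where
  "val_bound (Var v) B = B"
| "val_bound (Cst c) B = c"
| "val_bound (Add a b) B = val_bound a B + val_bound b B"
| "val_bound (Mul a b) B = val_bound a B * val_bound b B"

fun trm_cost :: "trm \<Rightarrow> nat \<Rightarrow> nat" where
  "trm_cost (Var v) B = 3 + 10 * B"
| "trm_cost (Cst c) B = 1 + 2 * c"
| "trm_cost (Add a b) B = 1 + trm_cost a B + trm_cost b B"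
| "trm_cost (Mul a b) B = 2 + trm_cost a B + val_bound a B * (trm_cost b B + 3)"

fun incs :: "nat \<Rightarrow> nat \<Rightarrow> cmd" where
  "incs k 0 = Mov k Stay"
| "incs k (Suc c) = Seq (Mov k Right) (incs k c)"

text \<open>\<open>add_trm d k e\<close> adds \<open>e\<close> to register \<open>k\<close>, with registers from \<open>d\<close> on as scratch space.\<close>

fun add_trm :: "nat \<Rightarrow> nat \<Rightarrow> trm \<Rightarrow> cmd" where
  "add_trm d k (Var v) = Seq (loop v (Seq (Mov k Right) (Mov d Right))) (loop d (Mov v Right))"
| "add_trm d k (Cst c) = incs k c"
| "add_trm d k (Add a b) = Seq (add_trm d k a) (add_trm d k b)"
| "add_trm d k (Mul a b) = Seq (add_trm (Suc d) d a) (loop d (add_trm (Suc d) k b))"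

lemma val_le_bound: "wf_trm d e \<Longrightarrow> (\<And>v. 3 \<le> v \<Longrightarrow> v < d \<Longrightarrow> \<rho> v \<le> B) \<Longrightarrow> val \<rho> e \<le> val_bound e B"
  by (induction e) (auto intro!: add_mono mult_mono)

lemma val_cong: "wf_trm d e \<Longrightarrow> (\<And>v. 3 \<le> v \<Longrightarrow> v < d \<Longrightarrow> \<rho> v = \<rho>' v) \<Longrightarrow> val \<rho> e = val \<rho>' e"
  by (induction e) auto

lemma does_incs: "k < m \<Longrightarrow> does x m (incs k c) \<rho> X (1 + 2 * c) (\<rho>(k := \<rho> k + c)) X"
proof (induction c arbitrary: \<rho>)
  case 0
  then show ?case using does_stay[of k m x \<rho> X] by simp
next
  case (Suc c)
  have "does x m (incs k (Suc c)) \<rho> X (Suc (1 + (1 + 2 * c)))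
      ((\<rho>(k := Suc (\<rho> k)))(k := (\<rho>(k := Suc (\<rho> k))) k + c)) X"
    unfolding incs.simps using Suc.prems by (intro does_Seq[OF does_inc] Suc.IH)
  then show ?case by (simp del: fun_upd_apply add: fun_upd_same)
qed

text \<open>The bound \<open>d0\<close> on the variables of \<open>e\<close> is kept apart from the start \<open>d\<close> of the scratch space.\<close>

lemma does_add_trm:
  assumes "wf_trm d0 e" "d0 \<le> d" "\<And>j. d \<le> j \<Longrightarrow> \<rho> j = 0" "d + trm_depth e \<le> m"
    "k < d" "k < 3 \<or> d0 \<le> k" "\<And>v. 3 \<le> v \<Longrightarrow> v < d0 \<Longrightarrow> \<rho> v \<le> B" "k < m"
  shows "does x m (add_trm d k e) \<rho> X (trm_cost e B) (\<rho>(k := \<rho> k + val \<rho> e)) X"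
  using assms
proof (induction e arbitrary: d k \<rho>)
  case (Var v)
  then have v: "3 \<le> v" "v < d0" "v < m" "d < m" "v \<noteq> k" "v \<noteq> d" "k \<noteq> d" "\<rho> d = 0" "\<rho> v \<le> B" by auto
  \<comment> \<open>Reading a unary register destroys it: \<open>v\<close> is drained into both
    \<open>k\<close> and the scratch register \<open>d\<close>, and the second loop pours
    \<open>d\<close> back into \<open>v\<close>.\<close>
  let ?s = "\<lambda>i. \<rho>(v := i, k := \<rho> k + (\<rho> v - i), d := \<rho> v - i)"
  have "does x m (loop v (Seq (Mov k Right) (Mov d Right))) (?s (\<rho> v)) X (1 + \<rho> v * (3 + 3)) (?s 0) X"
  proof (rule does_loop[where Y = "\<lambda>_. X"])
    fix i assume i: "i < \<rho> v"
    let ?\<rho> = "(?s (Suc i))(v := i)"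
    have "does x m (Seq (Mov k Right) (Mov d Right)) ?\<rho> X (Suc (1 + 1))
       (?\<rho>(k := Suc (?\<rho> k), d := Suc ((?\<rho>(k := Suc (?\<rho> k))) d))) X"
      using v \<open>k < m\<close> by (intro does_Seq[OF does_inc does_inc])
    moreover have "?\<rho>(k := Suc (?\<rho> k), d := Suc ((?\<rho>(k := Suc (?\<rho> k))) d)) = ?s i"
      using v i by (auto simp: fun_eq_iff)
    ultimately show "does x m (Seq (Mov k Right) (Mov d Right)) ?\<rho> X 3 (?s i) X"
      by (simp add: numeral_3_eq_3)
  qed (use v in auto)
  moreover let ?s' = "\<lambda>i. \<rho>(k := \<rho> k + \<rho> v, v := \<rho> v - i, d := i)"
  have "does x m (loop d (Mov v Right)) (?s' (\<rho> v)) X (1 + \<rho> v * (1 + 3)) (?s' 0) X"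
  proof (rule does_loop[where Y = "\<lambda>_. X"])
    fix i assume i: "i < \<rho> v"
    let ?\<rho> = "(?s' (Suc i))(d := i)"
    have "does x m (Mov v Right) ?\<rho> X 1 (?\<rho>(v := Suc (?\<rho> v))) X"
      using v by (intro does_inc)
    moreover have "?\<rho>(v := Suc (?\<rho> v)) = ?s' i"
      using v i by (auto simp: fun_eq_iff)
    ultimately show "does x m (Mov v Right) ?\<rho> X 1 (?s' i) X" by simp
  qed (use v in auto)
  moreover have "?s (\<rho> v) = \<rho>" "?s 0 = ?s' (\<rho> v)" "?s' 0 = \<rho>(k := \<rho> k + val \<rho> (Var v))"
    using v by (auto simp: fun_eq_iff)
  ultimately have "does x m (add_trm d k (Var v)) \<rho> X
      (Suc ((1 + \<rho> v * (3 + 3)) + (1 + \<rho> v * (1 + 3)))) (\<rho>(k := \<rho> k + val \<rho> (Var v))) X"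
    unfolding add_trm.simps by (metis (no_types, lifting) does_Seq)
  then show ?case by (rule does_mono) (use v in auto)
next
  case (Cst c)
  then show ?case using does_incs[of k m x c \<rho> X] by (simp del: fun_upd_apply)
next
  case (Add a b)
  let ?\<rho> = "\<rho>(k := \<rho> k + val \<rho> a)"
  have "does x m (add_trm d k a) \<rho> X (trm_cost a B) ?\<rho> X"
    using Add.prems by (intro Add.IH) auto
  moreover have "does x m (add_trm d k b) ?\<rho> X (trm_cost b B) (?\<rho>(k := ?\<rho> k + val ?\<rho> b)) X"
    using Add.prems by (intro Add.IH) auto
  moreover have "val ?\<rho> b = val \<rho> b"
    using Add.prems by (intro val_cong[of d0]) auto
  ultimately show ?case
    using does_Seq[of x m "add_trm d k a" \<rho> X "trm_cost a B" ?\<rho> X]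
    by (simp add: add.assoc fun_upd_same del: fun_upd_apply)
next
  case (Mul a b)
  let ?r = "val \<rho> a"
  \<comment> \<open>With \<open>i\<close> rounds left, \<open>?r - i\<close> copies of
    \<open>b\<close> have been added; \<open>b\<close> is evaluated afresh in each round.\<close>
  let ?s = "\<lambda>i. \<rho>(d := i, k := \<rho> k + (?r - i) * val \<rho> b)"
  have d: "k \<noteq> d" "d < m" "\<rho> d = 0" using Mul.prems by auto
  have "does x m (add_trm (Suc d) d a) \<rho> X (trm_cost a B) (\<rho>(d := \<rho> d + val \<rho> a)) X"
    using Mul.prems by (intro Mul.IH) auto
  then have 1: "does x m (add_trm (Suc d) d a) \<rho> X (trm_cost a B) (?s ?r) X"
    using d by (simp add: fun_upd_twist)
  have 2: "does x m (loop d (add_trm (Suc d) k b)) (?s ?r) X (1 + ?r * (trm_cost b B + 3)) (?s 0) X"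
  proof (rule does_loop[where Y = "\<lambda>_. X"])
    fix i assume i: "i < ?r"
    let ?\<rho> = "(?s (Suc i))(d := i)"
    have "does x m (add_trm (Suc d) k b) ?\<rho> X (trm_cost b B) (?\<rho>(k := ?\<rho> k + val ?\<rho> b)) X"
      using Mul.prems by (intro Mul.IH) auto
    moreover have "val ?\<rho> b = val \<rho> b"
      using Mul.prems by (intro val_cong[of d0]) auto
    moreover have "(?r - Suc i) * val \<rho> b + val \<rho> b = (?r - i) * val \<rho> b"
      using i by (metis Suc_diff_Suc mult_Suc add.commute)
    ultimately show "does x m (add_trm (Suc d) k b) ?\<rho> X (trm_cost b B) (?s i) X"
      using d by (simp add: fun_upd_twist add.assoc)
  qed (use d in auto)
  have 3: "?s 0 = \<rho>(k := \<rho> k + val \<rho> (Mul a b))" using d by auto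
  have "?r \<le> val_bound a B"
    using Mul.prems by (intro val_le_bound[of d0]) auto
  then have "?r * (trm_cost b B + 3) \<le> val_bound a B * (trm_cost b B + 3)" by (rule mult_le_mono1)
  then show ?case using does_Seq[OF 1 2] unfolding 3 add_trm.simps
    by (elim does_mono) simp
qed


subsection \<open>Formulas\<close>

datatype fm = Bit trm | Mem trm | Neg fm | Conj fm fm | Exi nat trm fm

fun sat :: "bool list \<Rightarrow> (nat \<Rightarrow> nat) \<Rightarrow> nat set \<Rightarrow> fm \<Rightarrow> bool" where
  "sat x \<rho> X (Bit e) \<longleftrightarrow> val \<rho> e < length x \<and> x ! val \<rho> e"
| "sat x \<rho> X (Mem e) \<longleftrightarrow> val \<rho> e \<in> X"
| "sat x \<rho> X (Neg f) \<longleftrightarrow> \<not> sat x \<rho> X f"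
| "sat x \<rho> X (Conj f g) \<longleftrightarrow> sat x \<rho> X f \<and> sat x \<rho> X g"
| "sat x \<rho> X (Exi v e f) \<longleftrightarrow> (\<exists>i<val \<rho> e. sat x (\<rho>(v := i)) X f)"

text \<open>A quantifier inside \<open>d - 4\<close> others must bind variable \<open>d\<close>.\<close>

fun wf_fm :: "nat \<Rightarrow> fm \<Rightarrow> bool" where
  "wf_fm d (Bit e) \<longleftrightarrow> wf_trm d e"
| "wf_fm d (Mem e) \<longleftrightarrow> wf_trm d e"
| "wf_fm d (Neg f) \<longleftrightarrow> wf_fm d f"
| "wf_fm d (Conj f g) \<longleftrightarrow> wf_fm d f \<and> wf_fm d g"
| "wf_fm d (Exi v e f) \<longleftrightarrow> v = d \<and> wf_trm d e \<and> wf_fm (Suc d) f"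

fun fm_depth :: "fm \<Rightarrow> nat" where
  "fm_depth (Bit e) = trm_depth e"
| "fm_depth (Mem e) = trm_depth e"
| "fm_depth (Neg f) = fm_depth f"
| "fm_depth (Conj f g) = max (fm_depth f) (fm_depth g)"
| "fm_depth (Exi v e f) = Suc (max (trm_depth e) (fm_depth f))"

text \<open>The body of a quantifier is charged at \<open>B + val_bound e B\<close>, since the bound
  variable may exceed all values bounded by \<open>B\<close>.\<close>

fun fm_cost :: "fm \<Rightarrow> nat \<Rightarrow> nat" where
  "fm_cost (Bit e) B = 11 + trm_cost e B + 4 * val_bound e B"
| "fm_cost (Mem e) B = 11 + trm_cost e B + 4 * val_bound e B"
| "fm_cost (Neg f) B = 3 + fm_cost f B"
| "fm_cost (Conj f g) B = 5 + fm_cost f B + fm_cost g B"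
| "fm_cost (Exi v e f) B = 2 + trm_cost e B + val_bound e B * (5 + fm_cost f (B + val_bound e B))"

text \<open>The entry for a number \<open>p\<close> lies \<open>p + 1\<close> cells after the end
  marker, whence the extra move to the right.\<close>

definition probe :: "nat \<Rightarrow> nat \<Rightarrow> trm \<Rightarrow> cmd" where
  "probe d k e = Seq (add_trm d k e) (Seq (Mov k Right)
     (Seq (Branch k (\<lambda>s. s = 2) (Mov 2 Right) (Mov 2 Stay)) (loop k (Mov k Stay))))"

fun fm_cmd :: "nat \<Rightarrow> fm \<Rightarrow> cmd" where
  "fm_cmd d (Bit e) = probe d 0 e"
| "fm_cmd d (Mem e) = probe d 1 e"
| "fm_cmd d (Neg f) = Seq (fm_cmd d f) (branch_pos 2 (Mov 2 Left) (Mov 2 Right))"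
| "fm_cmd d (Conj f g) =
     Seq (fm_cmd d f) (branch_pos 2 (Seq (Mov 2 Left) (fm_cmd d g)) (Mov 2 Stay))"
| "fm_cmd d (Exi v e f) =
     Seq (add_trm (Suc d) d e) (loop d (branch_pos 2 (Mov 2 Stay) (fm_cmd (Suc d) f)))"

definition idle :: "nat \<Rightarrow> (nat \<Rightarrow> nat) \<Rightarrow> bool" where
  "idle d \<rho> \<longleftrightarrow> (\<forall>j. j < 3 \<or> d \<le> j \<longrightarrow> \<rho> j = 0)"

lemma does_probe:
  assumes "k \<le> 1" "wf_trm d e" "4 \<le> d" "idle d \<rho>" "d + trm_depth e \<le> m" "\<And>j. \<rho> j \<le> B"
    "tape_read (reg_tape x X (\<rho>(k := Suc (val \<rho> e))) k) = 2 \<longleftrightarrow> P"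
  shows "does x m (probe d k e) \<rho> X (11 + trm_cost e B + 4 * val_bound e B) (\<rho>(2 := of_bool P)) X"
proof -
  let ?r = "\<rho>(k := Suc (val \<rho> e))"
  have k: "\<rho> k = 0" "k < m" "2 < m" "k \<noteq> 2" "\<rho> 2 = 0" using assms unfolding idle_def by auto
  have 1: "does x m (add_trm d k e) \<rho> X (trm_cost e B) (\<rho>(k := \<rho> k + val \<rho> e)) X"
    using assms by (intro does_add_trm[of d]) (auto simp: idle_def)
  have 2: "does x m (Mov k Right) (\<rho>(k := \<rho> k + val \<rho> e)) X 1 ?r X"
    using does_inc[of k m x "\<rho>(k := \<rho> k + val \<rho> e)" X] k by simp
  have 3: "does x m (Branch k (\<lambda>s. s = 2) (Mov 2 Right) (Mov 2 Stay)) ?r X (Suc 1) (?r(2 := of_bool P)) X"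
  proof (rule does_Branch)
    have "?r(2 := 0) = ?r" using k by (auto simp: fun_eq_iff)
    then show "does x m (if tape_read (reg_tape x X ?r k) = 2 then Mov 2 Right else Mov 2 Stay) ?r X 1
       (?r(2 := of_bool P)) X"
      using assms(7) k does_inc[of 2 m x ?r X] does_stay[of 2 m x ?r X] by auto
  qed (use k in auto)
  have "does x m (loop k (Mov k Stay)) (?r(2 := of_bool P)) X (1 + Suc (val_bound e B) * 4)
      (?r(2 := of_bool P, k := 0)) X"
    using k assms by (intro does_reset) (auto intro!: val_le_bound)
  moreover have "?r(2 := of_bool P, k := 0) = \<rho>(2 := of_bool P)"
    using k by (auto simp: fun_eq_iff)
  ultimately have 4: "does x m (loop k (Mov k Stay)) (?r(2 := of_bool P)) X
      (1 + Suc (val_bound e B) * 4) (\<rho>(2 := of_bool P)) X" by simp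
  show ?thesis unfolding probe_def
    by (rule does_mono[OF does_Seq[OF 1 does_Seq[OF 2 does_Seq[OF 3 4]]]]) simp
qed

text \<open>The truth value arrives in register 2, which is 0 beforehand. Negation is a decrement or
  an increment, a conjunction clears the register before its second half, and a quantifier leaves it
  at 1 once a witness has been seen.\<close>

lemma does_fm_cmd:
  assumes "wf_fm d f" "4 \<le> d" "idle d \<rho>" "d + fm_depth f \<le> m" "\<And>j. \<rho> j \<le> B"
  shows "does x m (fm_cmd d f) \<rho> X (fm_cost f B) (\<rho>(2 := of_bool (sat x \<rho> X f))) X"
  using assms
proof (induction f arbitrary: d \<rho> B)
  case (Bit e)
  then show ?case unfolding fm_cmd.simps fm_cost.simps
    by (intro does_probe) (auto simp: read_0)
next
  case (Mem e)
  then show ?case unfolding fm_cmd.simps fm_cost.simps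
    by (intro does_probe) (auto simp: read_1)
next
  case (Neg f)
  let ?\<rho> = "\<rho>(2 := of_bool (sat x \<rho> X f))"
  have 1: "does x m (fm_cmd d f) \<rho> X (fm_cost f B) ?\<rho> X"
    using Neg by (simp del: fun_upd_apply)
  have "2 < m" using Neg.prems by simp
  then have 2: "does x m (branch_pos 2 (Mov 2 Left) (Mov 2 Right)) ?\<rho> X (Suc 1)
      (\<rho>(2 := of_bool (sat x \<rho> X (Neg f)))) X"
    using does_dec[of 2 m ?\<rho> 0 x X] does_inc[of 2 m x ?\<rho> X]
    by (intro does_branch_pos) auto
  show ?case unfolding fm_cmd.simps by (rule does_mono[OF does_Seq[OF 1 2]]) simp
next
  case (Conj f g)
  let ?\<rho> = "\<rho>(2 := of_bool (sat x \<rho> X f))"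
  have 1: "does x m (fm_cmd d f) \<rho> X (fm_cost f B) ?\<rho> X"
    using Conj by (simp del: fun_upd_apply)
  have 3: "does x m (fm_cmd d g) \<rho> X (fm_cost g B) (\<rho>(2 := of_bool (sat x \<rho> X g))) X"
    using Conj by (simp del: fun_upd_apply)
  have m: "2 < m" "\<rho> 2 = 0" "\<rho>(2 := 0) = \<rho>" using Conj.prems by (auto simp: fun_eq_iff idle_def)
  have 2: "does x m (branch_pos 2 (Seq (Mov 2 Left) (fm_cmd d g)) (Mov 2 Stay)) ?\<rho> X
      (Suc (Suc (1 + fm_cost g B))) (\<rho>(2 := of_bool (sat x \<rho> X (Conj f g)))) X"
  proof (rule does_branch_pos)
    show "does x m (if ?\<rho> 2 \<noteq> 0 then Seq (Mov 2 Left) (fm_cmd d g) else Mov 2 Stay) ?\<rho> X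
      (Suc (1 + fm_cost g B)) (\<rho>(2 := of_bool (sat x \<rho> X (Conj f g)))) X"
    proof (cases "sat x \<rho> X f")
      case True
      have "does x m (Mov 2 Left) ?\<rho> X 1 \<rho> X"
        using does_dec[of 2 m ?\<rho> 0 x X] m True by simp
      from does_Seq[OF this 3] show ?thesis using True by simp
    next
      case False
      then show ?thesis using does_stay[of 2 m x ?\<rho> X] m by (auto elim: does_mono)
    qed
  qed (use m in simp)
  show ?case unfolding fm_cmd.simps by (rule does_mono[OF does_Seq[OF 1 2]]) simp
next
  case (Exi v e f)
  let ?r = "val \<rho> e"
  let ?B = "B + val_bound e B"
  \<comment> \<open>The counter runs downwards, so at \<open>i\<close> register 2 accounts for the
    candidates \<open>j \<ge> i\<close>.\<close>
  let ?s = "\<lambda>i. \<rho>(d := i, 2 := of_bool (\<exists>j. i \<le> j \<and> j < ?r \<and> sat x (\<rho>(d := j)) X f))"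
  have d: "d < m" "d \<noteq> 2" "2 < m" "\<rho> d = 0" "\<rho> 2 = 0" "v = d" "idle (Suc d) (\<rho>(d := i))" for i
    using Exi.prems by (auto simp: idle_def)
  have r: "?r \<le> val_bound e B" using Exi.prems by (auto intro!: val_le_bound[of d])
  have "does x m (add_trm (Suc d) d e) \<rho> X (trm_cost e B) (\<rho>(d := \<rho> d + ?r)) X"
    using Exi.prems by (intro does_add_trm[of d]) (auto simp: idle_def)
  moreover have "\<rho>(d := \<rho> d + ?r) = ?s ?r" using d by (auto simp: fun_eq_iff)
  ultimately have 1: "does x m (add_trm (Suc d) d e) \<rho> X (trm_cost e B) (?s ?r) X" by simp
  have 2: "does x m (loop d (branch_pos 2 (Mov 2 Stay) (fm_cmd (Suc d) f))) (?s ?r) X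
      (1 + ?r * (Suc (1 + fm_cost f ?B) + 3)) (?s 0) X"
  proof (rule does_loop[where Y = "\<lambda>_. X"])
    fix i assume i: "i < ?r"
    let ?\<rho> = "(?s (Suc i))(d := i)"
    show "does x m (branch_pos 2 (Mov 2 Stay) (fm_cmd (Suc d) f)) ?\<rho> X (Suc (1 + fm_cost f ?B)) (?s i) X"
    proof (rule does_branch_pos)
      show "does x m (if ?\<rho> 2 \<noteq> 0 then Mov 2 Stay else fm_cmd (Suc d) f) ?\<rho> X (1 + fm_cost f ?B) (?s i) X"
      proof (cases "\<exists>j. Suc i \<le> j \<and> j < ?r \<and> sat x (\<rho>(d := j)) X f")
        case True
        then have "\<exists>j. i \<le> j \<and> j < ?r \<and> sat x (\<rho>(d := j)) X f" by (meson Suc_leD)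
        then have eq: "?\<rho> = ?s i" using True d by (auto simp: fun_eq_iff)
        have e: "?\<rho> 2 \<noteq> 0" using True d by simp
        have "does x m (Mov 2 Stay) ?\<rho> X (1 + fm_cost f ?B) ?\<rho> X"
          by (rule does_mono[OF does_stay]) (use d in auto)
        then show ?thesis unfolding if_P[OF e] by (simp only: eq)
      next
        case False
        then have e: "?\<rho> = \<rho>(d := i)" using d by (auto simp: fun_eq_iff)
        have "(\<exists>j. i \<le> j \<and> j < ?r \<and> sat x (\<rho>(d := j)) X f) \<longleftrightarrow> sat x (\<rho>(d := i)) X f"
          using False i by (metis Suc_leI le_neq_implies_less order_refl)
        then have s: "?s i = (\<rho>(d := i))(2 := of_bool (sat x (\<rho>(d := i)) X f))" by simp
        have "does x m (fm_cmd (Suc d) f) (\<rho>(d := i)) X (fm_cost f ?B) (?s i) X"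
          unfolding s using Exi.prems d i r by (intro Exi.IH) (auto simp: idle_def intro: trans_le_add1)
        then have "does x m (fm_cmd (Suc d) f) (\<rho>(d := i)) X (1 + fm_cost f ?B) (?s i) X"
          by (rule does_mono) simp
        moreover have "\<not> ?\<rho> 2 \<noteq> 0" using False d by simp
        ultimately show ?thesis by (simp only: e if_False)
      qed
    qed (use d in simp)
  qed (use d in auto)
  have 3: "?s 0 = \<rho>(2 := of_bool (sat x \<rho> X (Exi v e f)))" using d by (auto simp: fun_eq_iff)
  have "?r * (5 + fm_cost f ?B) \<le> val_bound e B * (5 + fm_cost f ?B)"
    using r by (rule mult_le_mono1)
  then have "Suc (trm_cost e B + (1 + ?r * (Suc (1 + fm_cost f ?B) + 3))) \<le> fm_cost (Exi v e f) B"
    by (simp add: add.commute)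
  with does_Seq[OF 1 2] show ?case unfolding 3 fm_cmd.simps by (rule does_mono)
qed


subsection \<open>Programs\<close>

datatype com = Ins trm | Then com com | When fm com | For nat trm com

text \<open>Loops run downwards because their counter registers do. The set is the only state, and
  no instruction shrinks it.\<close>

fun exec :: "bool list \<Rightarrow> (nat \<Rightarrow> nat) \<Rightarrow> com \<Rightarrow> nat set \<Rightarrow> nat set" where
  "exec x \<rho> (Ins e) X = insert (val \<rho> e) X"
| "exec x \<rho> (Then c d) X = exec x \<rho> d (exec x \<rho> c X)"
| "exec x \<rho> (When f c) X = (if sat x \<rho> X f then exec x \<rho> c X else X)"
| "exec x \<rho> (For v e c) X = fold (\<lambda>i. exec x (\<rho>(v := i)) c) (rev [0..<val \<rho> e]) X"

fun wf_com :: "nat \<Rightarrow> com \<Rightarrow> bool" where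
  "wf_com d (Ins e) \<longleftrightarrow> wf_trm d e"
| "wf_com d (Then c c') \<longleftrightarrow> wf_com d c \<and> wf_com d c'"
| "wf_com d (When f c) \<longleftrightarrow> wf_fm d f \<and> wf_com d c"
| "wf_com d (For v e c) \<longleftrightarrow> v = d \<and> wf_trm d e \<and> wf_com (Suc d) c"

fun com_depth :: "com \<Rightarrow> nat" where
  "com_depth (Ins e) = trm_depth e"
| "com_depth (Then c d) = max (com_depth c) (com_depth d)"
| "com_depth (When f c) = max (fm_depth f) (com_depth c)"
| "com_depth (For v e c) = Suc (max (trm_depth e) (com_depth c))"

fun com_cost :: "com \<Rightarrow> nat \<Rightarrow> nat" where
  "com_cost (Ins e) B = 10 + trm_cost e B + 4 * val_bound e B"
| "com_cost (Then c d) B = 1 + com_cost c B + com_cost d B"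
| "com_cost (When f c) B = 5 + fm_cost f B + com_cost c B"
| "com_cost (For v e c) B = 2 + trm_cost e B + val_bound e B * (3 + com_cost c (B + val_bound e B))"

fun com_cmd :: "nat \<Rightarrow> com \<Rightarrow> cmd" where
  "com_cmd d (Ins e) =
     Seq (add_trm d 1 e) (Seq (Mov 1 Right) (Seq (Write 1 2) (loop 1 (Mov 1 Stay))))"
| "com_cmd d (Then c c') = Seq (com_cmd d c) (com_cmd d c')"
| "com_cmd d (When f c) =
     Seq (fm_cmd d f) (branch_pos 2 (Seq (Mov 2 Left) (com_cmd d c)) (Mov 2 Stay))"
| "com_cmd d (For v e c) = Seq (add_trm (Suc d) d e) (loop d (com_cmd (Suc d) c))"

lemma does_com_cmd:
  assumes "wf_com d c" "4 \<le> d" "idle d \<rho>" "d + com_depth c \<le> m" "\<And>j. \<rho> j \<le> B"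
  shows "does x m (com_cmd d c) \<rho> X (com_cost c B) \<rho> (exec x \<rho> c X)"
  using assms
proof (induction c arbitrary: d \<rho> X B)
  case (Ins e)
  let ?r = "\<rho>(1 := Suc (val \<rho> e))"
  have k: "\<rho> 1 = 0" "1 < m" using Ins.prems unfolding idle_def by auto
  have 1: "does x m (add_trm d 1 e) \<rho> X (trm_cost e B) (\<rho>(1 := \<rho> 1 + val \<rho> e)) X"
    using Ins.prems by (intro does_add_trm[of d]) (auto simp: idle_def)
  have 2: "does x m (Mov 1 Right) (\<rho>(1 := \<rho> 1 + val \<rho> e)) X 1 ?r X"
    using does_inc[of 1 m x "\<rho>(1 := \<rho> 1 + val \<rho> e)" X] k by simp
  have 3: "does x m (Write 1 2) ?r X 1 ?r (insert (val \<rho> e) X)"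
    using k by (intro does_write) auto
  have "does x m (loop 1 (Mov 1 Stay)) ?r (insert (val \<rho> e) X) (1 + Suc (val_bound e B) * 4)
      (?r(1 := 0)) (insert (val \<rho> e) X)"
    using k Ins.prems by (intro does_reset) (auto intro!: val_le_bound)
  moreover have "?r(1 := 0) = \<rho>"
    using k by (auto simp: fun_eq_iff)
  ultimately have 4: "does x m (loop 1 (Mov 1 Stay)) ?r (insert (val \<rho> e) X)
      (1 + Suc (val_bound e B) * 4) \<rho> (insert (val \<rho> e) X)" by simp
  show ?case unfolding com_cmd.simps exec.simps
    by (rule does_mono[OF does_Seq[OF 1 does_Seq[OF 2 does_Seq[OF 3 4]]]]) simp
next
  case (Then c1 c2)
  have 1: "does x m (com_cmd d c1) \<rho> X (com_cost c1 B) \<rho> (exec x \<rho> c1 X)"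
    using Then.prems by (intro Then.IH) auto
  have 2: "does x m (com_cmd d c2) \<rho> (exec x \<rho> c1 X) (com_cost c2 B) \<rho> (exec x \<rho> c2 (exec x \<rho> c1 X))"
    using Then.prems by (intro Then.IH) auto
  show ?case using does_Seq[OF 1 2] by simp
next
  case (When f c)
  let ?\<rho> = "\<rho>(2 := of_bool (sat x \<rho> X f))"
  have 1: "does x m (fm_cmd d f) \<rho> X (fm_cost f B) ?\<rho> X"
    using When.prems by (intro does_fm_cmd) auto
  have 3: "does x m (com_cmd d c) \<rho> X (com_cost c B) \<rho> (exec x \<rho> c X)"
    using When.prems by (intro When.IH) auto
  have m: "2 < m" "\<rho> 2 = 0" "\<rho>(2 := 0) = \<rho>"
    using When.prems by (auto simp: fun_eq_iff idle_def)
  have 2: "does x m (branch_pos 2 (Seq (Mov 2 Left) (com_cmd d c)) (Mov 2 Stay)) ?\<rho> X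
      (Suc (Suc (1 + com_cost c B))) \<rho> (exec x \<rho> (When f c) X)"
  proof (rule does_branch_pos)
    show "does x m (if ?\<rho> 2 \<noteq> 0 then Seq (Mov 2 Left) (com_cmd d c) else Mov 2 Stay) ?\<rho> X
      (Suc (1 + com_cost c B)) \<rho> (exec x \<rho> (When f c) X)"
    proof (cases "sat x \<rho> X f")
      case True
      have "does x m (Mov 2 Left) ?\<rho> X 1 \<rho> X"
        using does_dec[of 2 m ?\<rho> 0 x X] m True by simp
      from does_Seq[OF this 3] show ?thesis using True by simp
    next
      case False
      then show ?thesis using does_stay[of 2 m x ?\<rho> X] m by (auto elim: does_mono)
    qed
  qed (use m in simp)
  show ?case unfolding com_cmd.simps by (rule does_mono[OF does_Seq[OF 1 2]]) simp
next
  case (For v e c)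
  let ?r = "val \<rho> e"
  let ?B = "B + val_bound e B"
  let ?s = "\<lambda>i. \<rho>(d := i)"
  let ?Y = "\<lambda>i. fold (\<lambda>i. exec x (\<rho>(d := i)) c) (rev [i..<?r]) X"
  have d: "d < m" "\<rho> d = 0" "v = d" "idle (Suc d) (\<rho>(d := i))" for i
    using For.prems by (auto simp: idle_def)
  have r: "?r \<le> val_bound e B" using For.prems by (auto intro!: val_le_bound[of d])
  have "does x m (add_trm (Suc d) d e) \<rho> X (trm_cost e B) (\<rho>(d := \<rho> d + ?r)) X"
    using For.prems by (intro does_add_trm[of d]) (auto simp: idle_def)
  then have 1: "does x m (add_trm (Suc d) d e) \<rho> X (trm_cost e B) (?s ?r) (?Y ?r)"
    using d by simp
  have 2: "does x m (loop d (com_cmd (Suc d) c)) (?s ?r) (?Y ?r) (1 + ?r * (com_cost c ?B + 3))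
      (?s 0) (?Y 0)"
  proof (rule does_loop)
    fix i assume i: "i < ?r"
    have "does x m (com_cmd (Suc d) c) (?s i) (?Y (Suc i)) (com_cost c ?B) (?s i)
        (exec x (?s i) c (?Y (Suc i)))"
      using For.prems d i r by (intro For.IH) (auto simp: idle_def intro: trans_le_add1)
    moreover have "?Y i = exec x (?s i) c (?Y (Suc i))" using i by (simp add: upt_conv_Cons)
    moreover have "(?s (Suc i))(d := i) = ?s i" by simp
    ultimately show "does x m (com_cmd (Suc d) c) ((?s (Suc i))(d := i)) (?Y (Suc i))
        (com_cost c ?B) (?s i) (?Y i)"
      by simp
  qed (use d in auto)
  have 3: "?s 0 = \<rho>" using d by (auto simp: fun_eq_iff)
  have "?r * (com_cost c ?B + 3) \<le> val_bound e B * (com_cost c ?B + 3)"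
    using r by (rule mult_le_mono1)
  then have "Suc (trm_cost e B + (1 + ?r * (com_cost c ?B + 3))) \<le> com_cost (For v e c) B"
    by (simp add: add.commute)
  with does_Seq[OF 1 2] show ?case unfolding 3 com_cmd.simps exec.simps d(3)
    by (rule does_mono)
qed


subsection \<open>Initialisation\<close>

text \<open>The input starts at cell 0, so its marker has to go one cell to the left.\<close>

fun mark_tapes :: "nat \<Rightarrow> cmd" where
  "mark_tapes 0 = Seq (Mov 0 Left) (Write 0 3)"
| "mark_tapes (Suc k) = Seq (mark_tapes k) (Write (Suc k) 3)"

lemma runs_mark_tapes:
  assumes "k < m"
  shows "runs (mark_tapes k) (input_tape x # replicate (m - 1) blank_tape) (3 + 2 * k)
    (map (\<lambda>i. if i \<le> k then reg_tape x {} (\<lambda>_. 0) i else blank_tape) [0..<m])"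
  using assms
proof (induction k)
  case 0
  let ?ts = "input_tape x # replicate (m - 1) blank_tape"
  let ?ts1 = "?ts[0 := tape_act (tape_read (?ts ! 0), Left) (?ts ! 0)]"
  have "runs (mark_tapes 0) ?ts (Suc (1 + 1)) (?ts1[0 := tape_act (3, Stay) (?ts1 ! 0)])"
    unfolding mark_tapes.simps by (intro runs_Seq[OF runs_Mov runs_Write]) auto
  moreover have "?ts1[0 := tape_act (3, Stay) (?ts1 ! 0)]
      = map (\<lambda>i. if i \<le> 0 then reg_tape x {} (\<lambda>_. 0) i else blank_tape) [0..<m]"
    using 0 by (intro nth_equalityI) (auto simp: nth_Cons reg_tape_def input_tape_def split: nat.splits)
  ultimately show ?case by (simp add: numeral_3_eq_3)
next
  case (Suc k)
  let ?ts = "map (\<lambda>i. if i \<le> k then reg_tape x {} (\<lambda>_. 0) i else blank_tape) [0..<m]"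
  have "runs (mark_tapes (Suc k)) (input_tape x # replicate (m - 1) blank_tape)
      (Suc ((3 + 2 * k) + 1)) (?ts[Suc k := tape_act (3, Stay) (?ts ! Suc k)])"
    unfolding mark_tapes.simps using Suc by (intro runs_Seq[OF Suc.IH] runs_Write) auto
  moreover have "?ts[Suc k := tape_act (3, Stay) (?ts ! Suc k)]
      = map (\<lambda>i. if i \<le> Suc k then reg_tape x {} (\<lambda>_. 0) i else blank_tape) [0..<m]"
    using Suc.prems by (intro nth_equalityI)
      (auto simp: nth_list_update reg_tape_def blank_tape_def fun_eq_iff)
  ultimately show ?case by simp
qed

text \<open>Input bits are the symbols 1 and 2, hence the first blank ends the count. The first move
  skips the marker, which is not blank and would be counted as well.\<close>

definition count_input :: cmd where
  "count_input = Seq (Mov 0 Right) (Seq (While 0 (\<lambda>s. s \<noteq> 0) (Seq (Mov 0 Right) (Mov 3 Right)))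
     (loop 0 (Mov 0 Stay)))"

lemma does_count_input:
  assumes "3 < m"
  shows "does x m count_input (\<lambda>_. 0) {} (12 + 8 * length x) ((\<lambda>_. 0)(3 := length x)) {}"
proof -
  let ?s = "\<lambda>i. (\<lambda>_ :: nat. 0 :: nat)(0 := Suc i, 3 := i)"
  let ?n = "length x"
  let ?W = "While 0 (\<lambda>s. s \<noteq> 0) (Seq (Mov 0 Right) (Mov 3 Right))"
  have 1: "does x m (Mov 0 Right) (\<lambda>_. 0) {} 1 (?s 0) {}"
    using does_inc[of 0 m x "\<lambda>_. 0" "{}"] assms by (simp add: fun_upd_idem)
  \<comment> \<open>Induction on the number \<open>i\<close> of bits still unread.\<close>
  have 2: "does x m ?W (?s (?n - i)) {} (1 + 4 * i) (?s ?n) {}" if "i \<le> ?n" for i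
    using that
  proof (induction i)
    case 0
    have "runs ?W (reg_tapes x m {} (?s ?n)) 1 (reg_tapes x m {} (?s ?n))"
      using assms by (intro runs_While_False) (auto simp: read_0)
    then show ?case unfolding does_def by auto
  next
    case (Suc i)
    let ?j = "?n - Suc i"
    have j: "Suc ?j = ?n - i" using Suc by simp
    have "does x m (Seq (Mov 0 Right) (Mov 3 Right)) (?s ?j) {} (Suc (1 + 1))
      ((?s ?j)(0 := Suc (?s ?j 0), 3 := Suc (((?s ?j)(0 := Suc (?s ?j 0))) 3))) {}"
      using assms by (intro does_Seq[OF does_inc does_inc]) auto
    moreover have "(?s ?j)(0 := Suc (?s ?j 0), 3 := Suc (((?s ?j)(0 := Suc (?s ?j 0))) 3)) = ?s (?n - i)"
      using j by (auto simp: fun_eq_iff)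
    ultimately have "does x m (Seq (Mov 0 Right) (Mov 3 Right)) (?s ?j) {} (Suc (1 + 1)) (?s (?n - i)) {}"
      by simp
    then obtain t1 where t1: "t1 \<le> 3" "runs (Seq (Mov 0 Right) (Mov 3 Right))
        (reg_tapes x m {} (?s ?j)) t1 (reg_tapes x m {} (?s (?n - i)))"
      unfolding does_def by (auto simp: numeral_3_eq_3)
    obtain t2 where t2: "t2 \<le> 1 + 4 * i" "runs ?W
        (reg_tapes x m {} (?s (?n - i))) t2 (reg_tapes x m {} (?s ?n))"
      using Suc unfolding does_def by auto
    have "runs ?W (reg_tapes x m {} (?s ?j)) (Suc (t1 + t2)) (reg_tapes x m {} (?s ?n))"
      using assms Suc.prems by (intro runs_While_True[OF _ _ t1(2) t2(2)]) (auto simp: read_0)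
    moreover have "Suc (t1 + t2) \<le> 1 + 4 * Suc i" using t1(1) t2(1) by simp
    ultimately show ?case unfolding does_def by blast
  qed
  have 3: "does x m (loop 0 (Mov 0 Stay)) (?s ?n) {} (1 + Suc ?n * 4) ((?s ?n)(0 := 0)) {}"
    using assms by (intro does_reset) auto
  have e: "(?s ?n)(0 := 0) = (\<lambda>_. 0)(3 := length x)" by (auto simp: fun_eq_iff)
  have "does x m ?W (?s 0) {} (1 + 4 * ?n) (?s ?n) {}"
    using 2[of ?n] by simp
  from does_Seq[OF 1 does_Seq[OF this 3]] show ?thesis
    unfolding count_input_def e by (rule does_mono) simp
qed


subsection \<open>Polynomial time\<close>

definition poly_bounded :: "(nat \<Rightarrow> nat) \<Rightarrow> bool" where
  "poly_bounded f \<longleftrightarrow> (\<exists>p :: nat poly. \<forall>n. f n \<le> poly p n)"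

lemma poly_bounded_const: "poly_bounded (\<lambda>n. c)"
  unfolding poly_bounded_def by (rule exI[of _ "[:c:]"]) simp

lemma poly_bounded_id: "poly_bounded (\<lambda>n. n)"
  unfolding poly_bounded_def by (rule exI[of _ "[:0, 1:]"]) simp

lemma poly_bounded_add: "poly_bounded f \<Longrightarrow> poly_bounded g \<Longrightarrow> poly_bounded (\<lambda>n. f n + g n)"
  unfolding poly_bounded_def by (metis add_mono poly_add)

lemma poly_bounded_mult: "poly_bounded f \<Longrightarrow> poly_bounded g \<Longrightarrow> poly_bounded (\<lambda>n. f n * g n)"
  unfolding poly_bounded_def by (metis mult_le_mono poly_mult)

lemma poly_nat_mono: "m \<le> n \<Longrightarrow> poly p m \<le> poly p n" for p :: "nat poly"
  by (induction p) (auto intro!: mult_mono)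

text \<open>Nested quantifiers and loops are charged at an enlarged bound, so costs are composed;
  natural coefficients make the outer polynomial monotone.\<close>

lemma poly_bounded_comp:
  assumes "poly_bounded f" "poly_bounded g"
  shows "poly_bounded (\<lambda>n. f (g n))"
proof -
  from assms obtain p q where p: "\<And>n. f n \<le> poly p n" and q: "\<And>n. g n \<le> poly q n"
    unfolding poly_bounded_def by blast
  have "f (g n) \<le> poly (pcompose p q) n" for n
    using p[of "g n"] poly_nat_mono[OF q[of n], of p] by (simp add: poly_pcompose)
  then show ?thesis unfolding poly_bounded_def by blast
qed

lemma poly_bounded_Suc: "poly_bounded f \<Longrightarrow> poly_bounded (\<lambda>n. Suc (f n))"
  using poly_bounded_add[OF poly_bounded_const[of 1]] by simp

lemmas poly_bounded_intros =
  poly_bounded_const poly_bounded_id poly_bounded_add poly_bounded_mult poly_bounded_Suc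

lemma poly_bounded_val: "poly_bounded (val_bound e)"
  by (induction e) (auto intro!: poly_bounded_intros)

lemma poly_bounded_trm: "poly_bounded (trm_cost e)"
  by (induction e) (auto intro!: poly_bounded_intros poly_bounded_val)

lemma poly_bounded_fm: "poly_bounded (fm_cost f)"
  by (induction f) (auto intro!: poly_bounded_intros poly_bounded_val poly_bounded_trm
      poly_bounded_comp[where f = "fm_cost f" for f])

lemma poly_bounded_com: "poly_bounded (com_cost c)"
  by (induction c) (auto intro!: poly_bounded_intros poly_bounded_val poly_bounded_trm
      poly_bounded_fm poly_bounded_comp[where f = "com_cost c" for c])

lemma writes_below_incs: "writes_below 4 (incs k c)"
  by (induction c) auto

lemma writes_below_add_trm: "writes_below 4 (add_trm d k e)"
  by (induction e arbitrary: d k) (auto simp: writes_below_incs)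

lemma writes_below_fm_cmd: "writes_below 4 (fm_cmd d f)"
  by (induction f arbitrary: d) (auto simp: probe_def writes_below_add_trm)

lemma writes_below_com_cmd: "writes_below 4 (com_cmd d c)"
  by (induction c arbitrary: d) (auto simp: writes_below_fm_cmd writes_below_add_trm)

lemma writes_below_mark_tapes: "writes_below 4 (mark_tapes k)"
  by (induction k) auto

definition accepts :: "com \<Rightarrow> bool list \<Rightarrow> bool" where
  "accepts c x \<longleftrightarrow> 0 \<in> exec x ((\<lambda>_. 0)(3 := length x)) c {}"

text \<open>The final move places head 1 on the cell for number 0, whose symbol is the verdict.
  \<open>decides_in_time\<close> fixes an exact time, but halting configurations are fixed points,
  so \<open>Suc (T n)\<close> may be rounded up to a polynomial.\<close>

theorem accepts_in_P:
  assumes "wf_com 4 c"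
  shows "{x. accepts c x} \<in> class_P"
proof -
  define m where "m = 4 + com_depth c"
  define T where "T n = (3 + 2 * (m - 1)) + (12 + 8 * n) + com_cost c n + 4" for n
  define C where "C = Seq (mark_tapes (m - 1)) (Seq count_input (Seq (com_cmd 4 c) (Mov 1 Right)))"
  have "\<exists>t ts'. t \<le> T (length x) \<and> length ts' = m \<and>
        runs C (input_tape x # replicate (m - 1) blank_tape) t ts' \<and>
        (x \<in> {x. accepts c x} \<longleftrightarrow> tape_read (ts' ! 1) = 2)" for x
  proof -
    let ?\<rho> = "(\<lambda>_ :: nat. 0 :: nat)(3 := length x)" and ?X = "exec x ((\<lambda>_. 0)(3 := length x)) c {}"
    have m: "m - 1 < m" "1 < m" "3 < m" by (auto simp: m_def)
    have "map (\<lambda>i. if i \<le> m - 1 then reg_tape x {} (\<lambda>_. 0) i else blank_tape) [0..<m]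
        = reg_tapes x m {} (\<lambda>_. 0)"
      by (auto simp: reg_tapes_def)
    then have 0: "runs (mark_tapes (m - 1)) (input_tape x # replicate (m - 1) blank_tape)
        (3 + 2 * (m - 1)) (reg_tapes x m {} (\<lambda>_. 0))"
      using runs_mark_tapes[OF m(1), of x] by simp
    have 2: "does x m (com_cmd 4 c) ?\<rho> {} (com_cost c (length x)) ?\<rho> ?X"
      using assms by (intro does_com_cmd) (auto simp: idle_def m_def)
    have 3: "does x m (Mov 1 Right) ?\<rho> ?X 1 (?\<rho>(1 := Suc (?\<rho> 1))) ?X"
      using m by (intro does_inc)
    obtain t where t: "t \<le> Suc (12 + 8 * length x + Suc (com_cost c (length x) + 1))"
      "runs (Seq count_input (Seq (com_cmd 4 c) (Mov 1 Right))) (reg_tapes x m {} (\<lambda>_. 0)) t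
        (reg_tapes x m ?X (?\<rho>(1 := Suc (?\<rho> 1))))"
      using does_Seq[OF does_count_input[OF m(3), of x] does_Seq[OF 2 3]] unfolding does_def by blast
    have "runs C (input_tape x # replicate (m - 1) blank_tape) (Suc (3 + 2 * (m - 1) + t))
        (reg_tapes x m ?X (?\<rho>(1 := Suc (?\<rho> 1))))"
      unfolding C_def by (rule runs_Seq[OF 0 t(2)])
    moreover have "Suc (3 + 2 * (m - 1) + t) \<le> T (length x)" using t(1) by (simp add: T_def)
    moreover have "tape_read (reg_tapes x m ?X (?\<rho>(1 := Suc (?\<rho> 1))) ! 1) = 2 \<longleftrightarrow> accepts c x"
      using m by (simp add: read_1 accepts_def)
    ultimately show ?thesis using length_reg_tapes by blast
  qed
  moreover have "writes_below 4 C"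
    by (simp add: C_def count_input_def writes_below_com_cmd writes_below_mark_tapes)
  ultimately obtain M where M: "decides_in_time M {x. accepts c x} (\<lambda>n. Suc (T n))"
    using cmd_decides[of 4 C 1 m T "{x. accepts c x}" "\<lambda>s. s = 2"] by (auto simp: m_def)
  have "poly_bounded (\<lambda>n. 1 + T n)"
    unfolding T_def by (intro poly_bounded_intros poly_bounded_com)
  then obtain p :: "nat poly" where p: "\<And>n. Suc (T n) \<le> poly p n"
    unfolding poly_bounded_def by auto
  have "fst ((tm_step M ^^ poly p (length x)) (tm_init M x)) =
      fst ((tm_step M ^^ Suc (T (length x))) (tm_init M x))" for x
  proof -
    let ?y = "(tm_step M ^^ Suc (T (length x))) (tm_init M x)"
    have "fst ?y = tm_accept M \<or> fst ?y = tm_reject M"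
      using M unfolding decides_in_time_def by auto
    then have "tm_step M ?y = ?y" by (cases ?y) auto
    moreover have "(tm_step M ^^ poly p (length x)) (tm_init M x)
        = (tm_step M ^^ (poly p (length x) - Suc (T (length x)))) ?y"
      using p[of "length x"] by (metis comp_apply funpow_add le_add_diff_inverse2)
    ultimately show ?thesis by (simp add: funpow_fixed)
  qed
  then have "decides_in_time M {x. accepts c x} (poly p)"
    using M unfolding decides_in_time_def by simp
  then show ?thesis unfolding class_P_def by blast
qed


section \<open>Completions as independent choices, and criteria for a status to be
  attainable\<close>

section \<open>Possible verification\<close>

text \<open>
  In the following, \<open>A \<subseteq> D\<close> are the certain and all arguments, and \<open>C \<subseteq> P\<close> the certain and all attacks.
\<close>

definition afs_between :: "'a set \<Rightarrow> 'a set \<Rightarrow> ('a \<times> 'a) set \<Rightarrow> ('a \<times> 'a) set \<Rightarrow> 'a af set" where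
  "afs_between A D C P = {F. A \<subseteq> arguments F \<and> arguments F \<subseteq> D \<and>
     C \<inter> (arguments F \<times> arguments F) \<subseteq> attacks F \<and> attacks F \<subseteq> P \<inter> (arguments F \<times> arguments F)}"

lemma afs_betweenD:
  assumes "F \<in> afs_between A D C P"
  shows "A \<subseteq> arguments F" "arguments F \<subseteq> D"
    "\<And>a b. a \<in> arguments F \<Longrightarrow> b \<in> arguments F \<Longrightarrow> (a, b) \<in> C \<Longrightarrow> (a, b) \<in> attacks F"
    "\<And>a b. (a, b) \<in> attacks F \<Longrightarrow> (a, b) \<in> P \<and> a \<in> arguments F \<and> b \<in> arguments F"
  using assms unfolding afs_between_def by auto

lemma completions_eq:
  assumes "wf_iaf I"
  shows "completions I = afs_between (cargs I) (cargs I \<union> uargs I) (catts I) (catts I \<union> uatts I)"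
proof (intro equalityI subsetI)
  fix F assume "F \<in> completions I"
  then show "F \<in> afs_between (cargs I) (cargs I \<union> uargs I) (catts I) (catts I \<union> uatts I)"
    unfolding completions_def part_def afs_between_def cert_def by auto
next
  fix F assume F: "F \<in> afs_between (cargs I) (cargs I \<union> uargs I) (catts I) (catts I \<union> uatts I)"
  let ?I = "\<lparr>cargs = arguments F, uargs = {}, catts = attacks F, uatts = {}\<rparr>"
  have "?I \<in> part I" using F unfolding part_def wf_iaf_def afs_between_def by auto
  moreover have "cert ?I = F" using F unfolding cert_def afs_between_def by (auto intro!: af.equality)
  ultimately show "F \<in> completions I" unfolding completions_def by (metis imageI)
qed

text \<open>A completion, regarded as an IAF without uncertainty, is a partial completion.\<close>

lemma ex_part_stable_iff:
  "(\<exists>I'\<in>part I. stable_status j I' S) \<longleftrightarrow> (\<exists>F\<in>completions I. has_status j F S)"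
proof
  assume "\<exists>I'\<in>part I. stable_status j I' S"
  then obtain I' where I': "I' \<in> part I" "stable_status j I' S" by blast
  then have "I' \<in> part I'" unfolding part_def by auto
  then show "\<exists>F\<in>completions I. has_status j F S"
    using I' unfolding stable_status_def completions_def by blast
next
  assume "\<exists>F\<in>completions I. has_status j F S"
  then obtain I' where I': "I' \<in> part I" "has_status j (cert I') S"
    unfolding completions_def by blast
  let ?J = "\<lparr>cargs = cargs I', uargs = {}, catts = catts I' \<inter> (cargs I' \<times> cargs I'), uatts = {}\<rparr>"
  have J: "?J \<in> part I" using I'(1) unfolding part_def wf_iaf_def by auto
  have "cert J' = cert I'" if "J' \<in> part ?J" for J'
  proof -
    from that have "cargs J' = cargs I'" "catts J' = catts I' \<inter> (cargs I' \<times> cargs I')"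
      unfolding part_def by auto
    then show ?thesis unfolding cert_def by auto
  qed
  then have "stable_status j ?J S" using I'(2) unfolding stable_status_def completions_def by auto
  then show "\<exists>I'\<in>part I. stable_status j I' S" using J by blast
qed

lemma ad_iff: "S \<in> ad F \<longleftrightarrow> S \<subseteq> arguments F \<and> (\<forall>a\<in>S. \<forall>b\<in>S. (a, b) \<notin> attacks F) \<and>
    (\<forall>a\<in>S. \<forall>b. (b, a) \<in> attacks F \<longrightarrow> (\<exists>c\<in>S. (c, b) \<in> attacks F))"
  unfolding ad_def conflict_free_def attacked_def defended_def defends_def by blast

lemma co_iff: "S \<in> co F \<longleftrightarrow> S \<in> ad F \<and> (\<forall>a\<in>arguments F - S.
    \<exists>b. (b, a) \<in> attacks F \<and> (\<forall>c\<in>S. (c, b) \<notin> attacks F))"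
  unfolding co_def defended_def defends_def by blast

lemma st_iff: "S \<in> st F \<longleftrightarrow> S \<subseteq> arguments F \<and> (\<forall>a\<in>S. \<forall>b\<in>S. (a, b) \<notin> attacks F) \<and>
    (\<forall>b\<in>arguments F - S. \<exists>a\<in>S. (a, b) \<in> attacks F)"
  unfolding st_def conflict_free_def attacked_def by blast

text \<open>Comparing with all pre-fixed points of the defence operator suits inductive arguments.
  The least fixed point lies inside the complete set \<open>S\<close> and inherits its
  conflict-freeness; it is therefore complete, and minimality makes it equal to
  \<open>S\<close>.\<close>

lemma gr_iff: "S \<in> gr F \<longleftrightarrow> S \<in> co F \<and> (\<forall>T. defended F T \<subseteq> T \<longrightarrow> S \<subseteq> T)"
proof
  assume S: "S \<in> gr F"
  let ?G = "lfp (defended F)"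
  have mono: "mono (defended F)" unfolding mono_def defended_def defends_def by blast
  have G: "defended F ?G = ?G" using lfp_unfold[OF mono] by simp
  have "S \<in> co F" using S unfolding gr_def by blast
  then have "?G \<subseteq> S" unfolding co_def by (intro lfp_lowerbound) blast
  moreover from this have "?G \<in> co F"
    using \<open>S \<in> co F\<close> G unfolding co_def ad_def conflict_free_def attacked_def defended_def by blast
  ultimately have "?G = S" using S unfolding gr_def by blast
  then show "S \<in> co F \<and> (\<forall>T. defended F T \<subseteq> T \<longrightarrow> S \<subseteq> T)"
    using \<open>S \<in> co F\<close> lfp_lowerbound by blast
next
  assume "S \<in> co F \<and> (\<forall>T. defended F T \<subseteq> T \<longrightarrow> S \<subseteq> T)"
  then show "S \<in> gr F" unfolding gr_def co_def by blast
qed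

lemma pr_iff: "S \<in> pr F \<longleftrightarrow> S \<in> ad F \<and> \<not> (\<exists>T\<in>ad F. S \<subset> T)"
  unfolding pr_def by blast

text \<open>
  If \<open>S\<close> is complete in some completion, the arguments outside of \<open>S\<close> that are not doomed can be
  left undecided (neither in \<open>S\<close> nor attacked by \<open>S\<close>), and the doomed ones must be absent or attacked by \<open>S\<close>.
\<close>

inductive_set doomed :: "'a set \<Rightarrow> ('a \<times> 'a) set \<Rightarrow> ('a \<times> 'a) set \<Rightarrow> 'a set \<Rightarrow> 'a set"
  for D C P S where
  "k \<in> D - S \<Longrightarrow> (\<exists>s\<in>S. (s, k) \<in> C \<or> (k, s) \<in> C) \<or> (\<forall>b\<in>D - S. (b, k) \<in> P \<longrightarrow> b \<in> doomed D C P S)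
    \<Longrightarrow> k \<in> doomed D C P S"

text \<open>The least fixed point of defence inside \<open>S\<close>, where only attacks in
  \<open>R\<close> from \<open>B\<close> have to be countered, by attacks in \<open>Q\<close>. The
  optimistic reading takes \<open>R = C\<close>, \<open>Q = P\<close> and the attackers that cannot
  be left out; the pessimistic one takes \<open>R = P\<close>, \<open>Q = C\<close>,
  \<open>B = D\<close>.\<close>

inductive_set well_founded_part ::
    "'a set \<Rightarrow> ('a \<times> 'a) set \<Rightarrow> ('a \<times> 'a) set \<Rightarrow> 'a set \<Rightarrow> 'a set"
  for B R Q S where
  "a \<in> S \<Longrightarrow> \<forall>b\<in>B. (b, a) \<in> R \<longrightarrow> (\<exists>c. (c, b) \<in> Q \<and> c \<in> well_founded_part B R Q S)
    \<Longrightarrow> a \<in> well_founded_part B R Q S"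

lemma well_founded_part_subset: "well_founded_part B R Q S \<subseteq> S"
  by (auto elim: well_founded_part.cases)

lemma well_founded_part_least:
  assumes "\<And>a. a \<in> S \<Longrightarrow> (\<And>b. b \<in> B \<Longrightarrow> (b, a) \<in> R \<Longrightarrow> \<exists>c\<in>S \<inter> T. (c, b) \<in> Q) \<Longrightarrow> a \<in> T"
  shows "well_founded_part B R Q S \<subseteq> T"
proof
  fix a assume "a \<in> well_founded_part B R Q S"
  then show "a \<in> T"
  proof induction
    case (1 a)
    then show ?case using well_founded_part_subset[of B R Q S] by (intro assms) blast+
  qed
qed

definition possibly :: "'a set \<Rightarrow> 'a set \<Rightarrow> ('a \<times> 'a) set \<Rightarrow> ('a \<times> 'a) set \<Rightarrow> 'a status \<Rightarrow> 'a set \<Rightarrow> bool"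
  where "possibly A D C P j S \<longleftrightarrow> (\<exists>F\<in>afs_between A D C P. has_status j F S)"

text \<open>Uncertain attackers and uncertain attacks on \<open>S\<close> can be left out, so
  defence is owed only against certain attacks by certain arguments, and every possible attack may
  serve for it.\<close>

definition can_be_admissible where
  "can_be_admissible A D C P S \<longleftrightarrow> S \<subseteq> D \<and> (\<forall>a\<in>S. \<forall>b\<in>S. (a, b) \<notin> C) \<and>
     (\<forall>a\<in>S. \<forall>b\<in>A - S. (b, a) \<in> C \<longrightarrow> (\<exists>c\<in>S. (c, b) \<in> P))"

definition can_be_stable where
  "can_be_stable A D C P S \<longleftrightarrow> S \<subseteq> D \<and> (\<forall>a\<in>S. \<forall>b\<in>S. (a, b) \<notin> C) \<and>
     (\<forall>b\<in>A - S. \<exists>c\<in>S. (c, b) \<in> P)"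

text \<open>Defence is contained in the last clause: an argument outside \<open>S\<close> with a
  certain attack on \<open>S\<close> is doomed.\<close>

definition can_be_complete where
  "can_be_complete A D C P S \<longleftrightarrow> S \<subseteq> D \<and> (\<forall>a\<in>S. \<forall>b\<in>S. (a, b) \<notin> C) \<and>
     (\<forall>k\<in>A \<inter> doomed D C P S. \<exists>s\<in>S. (s, k) \<in> P)"

definition can_be_grounded where
  "can_be_grounded A D C P S \<longleftrightarrow> can_be_complete A D C P S \<and>
     S \<subseteq> well_founded_part (A \<inter> doomed D C P S) C P S"

definition can_be_inadmissible where
  "can_be_inadmissible A D C P S \<longleftrightarrow> \<not> S \<subseteq> A \<or> (\<exists>a\<in>S. \<exists>b\<in>S. (a, b) \<in> P) \<or>
     (\<exists>a\<in>S. \<exists>b\<in>D. (b, a) \<in> P \<and> (\<forall>c\<in>S. (c, b) \<notin> C))"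

definition can_be_unstable where
  "can_be_unstable A D C P S \<longleftrightarrow> \<not> S \<subseteq> A \<or> (\<exists>a\<in>S. \<exists>b\<in>S. (a, b) \<in> P) \<or>
     (\<exists>b\<in>D - S. \<forall>c\<in>S. (c, b) \<notin> C)"

text \<open>The second disjunct seeks an argument that \<open>S\<close> can defend without
  containing it. A certain self-attack excludes this: \<open>S\<close> would have to attack
  \<open>a\<close> and then, to defend \<open>a\<close>, also its own attacking member.\<close>

definition can_be_incomplete where
  "can_be_incomplete A D C P S \<longleftrightarrow> can_be_inadmissible A D C P S \<or>
     (\<exists>a\<in>D - S. (a, a) \<notin> C \<and> (\<forall>b\<in>A. (b, a) \<in> C \<longrightarrow> (\<exists>c\<in>S. (c, b) \<in> P)))"

definition can_be_ungrounded where
  "can_be_ungrounded A D C P S \<longleftrightarrow> can_be_incomplete A D C P S \<or>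
     \<not> S \<subseteq> well_founded_part D P C S"

section \<open>Optimistic completions, in which a set is accepted\<close>

context
  fixes A D :: "'a set" and C P :: "('a \<times> 'a) set"
  assumes AD: "A \<subseteq> D" and CP: "C \<subseteq> P" and PD: "P \<subseteq> D \<times> D"
begin

text \<open>Of the uncertain attacks, those into \<open>S\<close> are left out; \<open>S\<close>
  attacks every outsider it can except in \<open>U\<close>, which has to stay undecided; and
  outsiders attack each other as much as possible, so that members of \<open>U\<close> keep
  undecided attackers.\<close>

definition favour :: "'a set \<Rightarrow> 'a set \<Rightarrow> 'a af" where
  "favour S U = \<lparr>arguments = A \<union> S \<union> U,
     attacks = {(a, b) \<in> P. a \<in> A \<union> S \<union> U \<and> b \<in> A \<union> S \<union> U \<and>
       ((a, b) \<in> C \<or> a \<in> S \<and> b \<notin> S \<and> b \<notin> U \<or> a \<notin> S \<and> b \<notin> S)}\<rparr>"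

lemma arguments_favour: "arguments (favour S U) = A \<union> S \<union> U"
  by (simp add: favour_def)

lemma attacks_favour: "(a, b) \<in> attacks (favour S U) \<longleftrightarrow>
    (a, b) \<in> P \<and> a \<in> A \<union> S \<union> U \<and> b \<in> A \<union> S \<union> U \<and>
    ((a, b) \<in> C \<or> a \<in> S \<and> b \<notin> S \<and> b \<notin> U \<or> a \<notin> S \<and> b \<notin> S)"
  by (simp add: favour_def)

lemma favour_between: "S \<subseteq> D \<Longrightarrow> U \<subseteq> D \<Longrightarrow> favour S U \<in> afs_between A D C P"
  using AD CP unfolding afs_between_def by (auto simp: attacks_favour arguments_favour)

lemma possibly_ad: "possibly A D C P (ad, True) S \<longleftrightarrow> can_be_admissible A D C P S"
proof
  assume "possibly A D C P (ad, True) S"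
  then obtain F where "F \<in> afs_between A D C P" and S: "S \<in> ad F"
    unfolding possibly_def has_status_def by auto
  note F = afs_betweenD[OF this(1)]
  have sub: "S \<subseteq> arguments F" and noatt: "\<And>a b. a \<in> S \<Longrightarrow> b \<in> S \<Longrightarrow> (a, b) \<notin> attacks F"
    and def: "\<And>a b. a \<in> S \<Longrightarrow> (b, a) \<in> attacks F \<Longrightarrow> \<exists>c\<in>S. (c, b) \<in> attacks F"
    using S unfolding ad_iff by blast+
  have "(a, b) \<notin> C" if "a \<in> S" "b \<in> S" for a b
    using F(3)[of a b] sub noatt that by blast
  moreover have "\<exists>c\<in>S. (c, b) \<in> P" if "a \<in> S" "b \<in> A - S" "(b, a) \<in> C" for a b
    using F(3)[of b a] F(1) F(4)[of _ b] sub def[of a b] that by blast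
  ultimately show "can_be_admissible A D C P S"
    unfolding can_be_admissible_def using sub F(2) by blast
next
  assume S: "can_be_admissible A D C P S"
  have "(a, b) \<notin> attacks (favour S {})" if "a \<in> S" "b \<in> S" for a b
    using S that unfolding can_be_admissible_def attacks_favour by blast
  moreover have "\<exists>c\<in>S. (c, b) \<in> attacks (favour S {})"
    if a: "a \<in> S" "(b, a) \<in> attacks (favour S {})" for a b
  proof -
    have "b \<notin> S" using S a unfolding can_be_admissible_def attacks_favour by blast
    with a have b: "b \<in> A - S" "(b, a) \<in> C" unfolding attacks_favour by auto
    then obtain c where "c \<in> S" "(c, b) \<in> P"
      using S a(1) unfolding can_be_admissible_def by blast
    then show ?thesis using b(1) unfolding attacks_favour by auto
  qed
  ultimately have "S \<in> ad (favour S {})" unfolding ad_iff arguments_favour by blast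
  then show "possibly A D C P (ad, True) S"
    using favour_between[of S "{}"] S
    unfolding possibly_def has_status_def can_be_admissible_def by auto
qed

lemma possibly_st: "possibly A D C P (st, True) S \<longleftrightarrow> can_be_stable A D C P S"
proof
  assume "possibly A D C P (st, True) S"
  then obtain F where "F \<in> afs_between A D C P" and S: "S \<in> st F"
    unfolding possibly_def has_status_def by auto
  note F = afs_betweenD[OF this(1)]
  have sub: "S \<subseteq> arguments F" and noatt: "\<And>a b. a \<in> S \<Longrightarrow> b \<in> S \<Longrightarrow> (a, b) \<notin> attacks F"
    and cov: "\<And>b. b \<in> arguments F - S \<Longrightarrow> \<exists>a\<in>S. (a, b) \<in> attacks F"
    using S unfolding st_iff by blast+
  have "(a, b) \<notin> C" if "a \<in> S" "b \<in> S" for a b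
    using F(3)[of a b] sub noatt that by blast
  moreover have "\<exists>c\<in>S. (c, b) \<in> P" if "b \<in> A - S" for b
    using F(1) F(4)[of _ b] cov[of b] that by blast
  ultimately show "can_be_stable A D C P S"
    unfolding can_be_stable_def using sub F(2) by blast
next
  assume S: "can_be_stable A D C P S"
  then have "S \<in> st (favour S {})"
    unfolding can_be_stable_def st_iff arguments_favour attacks_favour by auto
  then show "possibly A D C P (st, True) S"
    using favour_between[of S "{}"] S
    unfolding possibly_def has_status_def can_be_stable_def by auto
qed

text \<open>If \<open>k\<close> is linked to \<open>S\<close> by a certain attack, then
  \<open>S\<close> attacks it directly or by defending itself. Otherwise all possible attackers of
  \<open>k\<close> outside \<open>S\<close> are doomed, so by induction \<open>S\<close> attacks
  those that are present; were \<open>k\<close> not attacked by \<open>S\<close>, it would be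
  defended and belong to \<open>S\<close>.\<close>

lemma doomed_attacked:
  assumes F: "F \<in> afs_between A D C P" and S: "S \<in> co F" and k: "k \<in> doomed D C P S"
    and "k \<in> arguments F"
  shows "\<exists>s\<in>S. (s, k) \<in> attacks F"
  using k \<open>k \<in> arguments F\<close>
proof induction
  case (1 k)
  have sub: "S \<subseteq> arguments F" and def: "\<And>a b. a \<in> S \<Longrightarrow> (b, a) \<in> attacks F \<Longrightarrow> \<exists>c\<in>S. (c, b) \<in> attacks F"
    and undef: "\<And>a. a \<in> arguments F - S \<Longrightarrow> \<exists>b. (b, a) \<in> attacks F \<and> (\<forall>c\<in>S. (c, b) \<notin> attacks F)"
    using S unfolding co_iff ad_iff by blast+
  note att = afs_betweenD(3)[OF F]
  show ?case
  proof (rule ccontr)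
    assume not: "\<not> ?thesis"
    have "(s, k) \<notin> C \<and> (k, s) \<notin> C" if "s \<in> S" for s
      using not att[of s k] att[of k s] def[of s k] 1(3) sub that by blast
    then have undec: "\<And>b. b \<in> D - S \<Longrightarrow> (b, k) \<in> P \<Longrightarrow>
        b \<in> arguments F \<Longrightarrow> \<exists>s\<in>S. (s, b) \<in> attacks F"
      using 1(2) by blast
    obtain b where b: "(b, k) \<in> attacks F" "\<forall>c\<in>S. (c, b) \<notin> attacks F"
      using undef[of k] 1 by blast
    have "b \<in> arguments F" "b \<in> D" "(b, k) \<in> P"
      using afs_betweenD(2)[OF F] afs_betweenD(4)[OF F b(1)] by blast+
    moreover have "b \<notin> S" using b(1) not by blast
    ultimately show False using undec b(2) by blast
  qed
qed

text \<open>A member of \<open>?U\<close> has a possible attacker that is neither in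
  \<open>S\<close> nor doomed, hence again in \<open>?U\<close> and spared by \<open>S\<close>; so
  it is not defended. Every other outsider present is certain and doomed. The criterion gives it an
  attacker in \<open>S\<close>, which \<open>S\<close> cannot attack in turn.\<close>

lemma favour_complete:
  assumes S: "can_be_complete A D C P S"
  shows "S \<in> co (favour S (D - S - doomed D C P S))"
proof -
  let ?K = "doomed D C P S"
  let ?U = "D - S - ?K"
  let ?F = "favour S ?U"
  note K = doomed.intros[of _ D S C P]
  have noC: "(a, b) \<notin> C" if "a \<in> S" "b \<in> S \<union> ?U" for a b
    using S that K unfolding can_be_complete_def by blast
  have noC': "(b, a) \<notin> C" if "a \<in> S" "b \<in> S \<union> ?U" for a b
    using S that K unfolding can_be_complete_def by blast
  have out: "\<exists>s\<in>S. (s, k) \<in> attacks ?F" if "k \<in> arguments ?F" "k \<notin> S \<union> ?U" for k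
  proof -
    have "k \<in> A \<inter> ?K" using that AD unfolding arguments_favour by auto
    then obtain s where "s \<in> S" "(s, k) \<in> P" using S unfolding can_be_complete_def by blast
    then show ?thesis using that unfolding arguments_favour attacks_favour by auto
  qed
  have "S \<in> ad ?F"
  proof -
    have "(a, b) \<notin> attacks ?F" if "a \<in> S" "b \<in> S" for a b
      using that noC unfolding attacks_favour by blast
    moreover have "\<exists>c\<in>S. (c, b) \<in> attacks ?F" if "a \<in> S" "(b, a) \<in> attacks ?F" for a b
    proof (rule out)
      show "b \<in> arguments ?F" using that unfolding attacks_favour arguments_favour by blast
      show "b \<notin> S \<union> ?U" using that noC' unfolding attacks_favour by blast
    qed
    moreover have "S \<subseteq> arguments ?F" unfolding arguments_favour by blast
    ultimately show ?thesis unfolding ad_iff by blast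
  qed
  moreover have "\<exists>b. (b, a) \<in> attacks ?F \<and> (\<forall>c\<in>S. (c, b) \<notin> attacks ?F)"
    if a: "a \<in> arguments ?F - S" for a
  proof (cases "a \<in> ?U")
    case True
    then obtain b where b: "b \<in> ?U" "(b, a) \<in> P" using K[of a] by blast
    then have "(b, a) \<in> attacks ?F" using True unfolding attacks_favour by blast
    moreover have "(c, b) \<notin> attacks ?F" if "c \<in> S" for c
      using b noC[OF that, of b] that unfolding attacks_favour by blast
    ultimately show ?thesis by blast
  next
    case False
    then obtain s where "s \<in> S" "(s, a) \<in> attacks ?F" using out[of a] a by blast
    then show ?thesis using \<open>S \<in> ad ?F\<close> unfolding ad_iff by blast
  qed
  ultimately show ?thesis unfolding co_iff by blast
qed

lemma complete_can_be_complete: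
  assumes "F \<in> afs_between A D C P" "S \<in> co F"
  shows "can_be_complete A D C P S"
proof -
  note F = afs_betweenD[OF assms(1)]
  have S: "S \<subseteq> arguments F" "\<And>a b. a \<in> S \<Longrightarrow> b \<in> S \<Longrightarrow> (a, b) \<notin> attacks F"
    using assms(2) unfolding co_iff ad_iff by auto
  have "\<exists>s\<in>S. (s, k) \<in> P" if "k \<in> A \<inter> doomed D C P S" for k
    using doomed_attacked[OF assms, of k] F(1) F(4) that by blast
  moreover have "(a, b) \<notin> C" if "a \<in> S" "b \<in> S" for a b
    using F(3) S that by blast
  ultimately show ?thesis using F(2) S(1) unfolding can_be_complete_def by blast
qed

lemma favour_doomed_between:
  "can_be_complete A D C P S \<Longrightarrow> favour S (D - S - doomed D C P S) \<in> afs_between A D C P"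
  by (intro favour_between) (auto simp: can_be_complete_def)

lemma possibly_co: "possibly A D C P (co, True) S \<longleftrightarrow> can_be_complete A D C P S"
  using complete_can_be_complete[of _ S] favour_complete[of S] favour_doomed_between[of S]
  unfolding possibly_def has_status_def by (auto intro: bexI)

text \<open>In any completion with \<open>S\<close> grounded, \<open>?L\<close> is a pre-fixed point
  of defence, since what it defends lies in \<open>S\<close> and attacks by \<open>?B\<close> are
  countered along \<open>P\<close>. Conversely, all attackers of \<open>S\<close> in
  \<open>favour\<close> are certain and doomed and attack along \<open>C\<close>, and every possible
  attack of \<open>S\<close> on them is present; so there defence follows the rule of
  \<open>well_founded_part\<close>.\<close>

lemma possibly_gr: "possibly A D C P (gr, True) S \<longleftrightarrow> can_be_grounded A D C P S"
proof
  let ?B = "A \<inter> doomed D C P S"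
  let ?L = "well_founded_part ?B C P S"
  assume "possibly A D C P (gr, True) S"
  then obtain F where F: "F \<in> afs_between A D C P" "S \<in> gr F"
    unfolding possibly_def has_status_def by auto
  note least = F(2)[unfolded gr_iff, THEN conjunct2, rule_format]
  have co: "S \<in> co F" using F(2) unfolding gr_iff by blast
  have "defended F ?L \<subseteq> ?L"
  proof
    fix a assume a: "a \<in> defended F ?L"
    then have "a \<in> defended F S"
      using well_founded_part_subset[of ?B C P S] unfolding defended_def defends_def by blast
    then have "a \<in> S" using co unfolding co_def by blast
    then show "a \<in> ?L"
    proof (rule well_founded_part.intros, intro ballI impI)
      fix b assume "b \<in> ?B" "(b, a) \<in> C"
      then have "(b, a) \<in> attacks F" using a F(1) unfolding afs_between_def defended_def by blast
      then obtain c where "c \<in> ?L" "(c, b) \<in> attacks F"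
        using a unfolding defended_def defends_def by blast
      then show "\<exists>c. (c, b) \<in> P \<and> c \<in> ?L" using F(1) unfolding afs_between_def by blast
    qed
  qed
  then show "can_be_grounded A D C P S"
    unfolding can_be_grounded_def using least complete_can_be_complete[OF F(1) co] by blast
next
  let ?K = "doomed D C P S"
  let ?U = "D - S - ?K"
  let ?F = "favour S ?U"
  assume S: "can_be_grounded A D C P S"
  then have cS: "can_be_complete A D C P S" unfolding can_be_grounded_def by blast
  note co = favour_complete[OF cS]
  have "S \<subseteq> T" if T: "defended ?F T \<subseteq> T" for T
  proof -
    have "well_founded_part (A \<inter> ?K) C P S \<subseteq> T"
    proof (rule well_founded_part_least)
      fix a assume a: "a \<in> S"
        and att: "\<And>b. b \<in> A \<inter> ?K \<Longrightarrow> (b, a) \<in> C \<Longrightarrow> \<exists>c\<in>S \<inter> T. (c, b) \<in> P"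
      have "\<exists>c\<in>T. (c, b) \<in> attacks ?F" if ba: "(b, a) \<in> attacks ?F" for b
      proof -
        have b: "(b, a) \<in> C" "b \<in> A \<union> S \<union> ?U" using ba a unfolding attacks_favour by auto
        have "b \<notin> S" using cS a b unfolding can_be_complete_def by blast
        moreover have "b \<notin> ?U" using doomed.intros[of b D S C P] a b by blast
        ultimately have "b \<in> A \<inter> ?K" using b AD by blast
        moreover from att[OF this b(1)] obtain c where "c \<in> S \<inter> T" "(c, b) \<in> P" by blast
        ultimately show ?thesis using \<open>b \<notin> S\<close> \<open>b \<notin> ?U\<close> unfolding attacks_favour by auto
      qed
      then have "a \<in> defended ?F T" using a unfolding defended_def defends_def arguments_favour by auto
      then show "a \<in> T" using T by blast
    qed
    then show ?thesis using S unfolding can_be_grounded_def by blast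
  qed
  then have "S \<in> gr ?F" using co unfolding gr_iff by blast
  then show "possibly A D C P (gr, True) S"
    using favour_doomed_between[OF cS] unfolding possibly_def has_status_def by auto
qed

section \<open>Pessimistic completions, in which a set is rejected\<close>

lemma whole_between: "R \<subseteq> P \<Longrightarrow> C \<subseteq> R \<Longrightarrow> \<lparr>arguments = D, attacks = R\<rparr> \<in> afs_between A D C P"
  using AD PD unfolding afs_between_def by auto

lemma certain_between: "\<lparr>arguments = A, attacks = C \<inter> (A \<times> A)\<rparr> \<in> afs_between A D C P"
  using AD CP unfolding afs_between_def by auto

lemma possibly_not_ad: "possibly A D C P (ad, False) S \<longleftrightarrow> can_be_inadmissible A D C P S"
proof
  assume "possibly A D C P (ad, False) S"
  then obtain F where F: "F \<in> afs_between A D C P" "S \<notin> ad F"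
    unfolding possibly_def has_status_def by auto
  show "can_be_inadmissible A D C P S"
  proof (rule ccontr)
    assume not: "\<not> ?thesis"
    then have "S \<subseteq> A" "\<forall>a\<in>S. \<forall>b\<in>S. (a, b) \<notin> P" unfolding can_be_inadmissible_def by auto
    then have sub: "S \<subseteq> arguments F" "\<forall>a\<in>S. \<forall>b\<in>S. (a, b) \<notin> attacks F"
      using F unfolding afs_between_def by auto
    have "\<exists>c\<in>S. (c, b) \<in> attacks F" if "a \<in> S" "(b, a) \<in> attacks F" for a b
    proof -
      have b: "b \<in> arguments F" "b \<in> D" "(b, a) \<in> P"
        using afs_betweenD(2)[OF F(1)] afs_betweenD(4)[OF F(1) that(2)] by blast+
      then obtain c where "c \<in> S" "(c, b) \<in> C" using not \<open>a \<in> S\<close> unfolding can_be_inadmissible_def by blast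
      then show ?thesis using b sub afs_betweenD(3)[OF F(1)] by blast
    qed
    then show False using F(2) sub unfolding ad_iff by blast
  qed
next
  assume "can_be_inadmissible A D C P S"
  then consider "\<not> S \<subseteq> A" | "\<exists>a\<in>S. \<exists>b\<in>S. (a, b) \<in> P"
    | "\<exists>a\<in>S. \<exists>b\<in>D. (b, a) \<in> P \<and> (\<forall>c\<in>S. (c, b) \<notin> C)" "\<not> (\<exists>a\<in>S. \<exists>b\<in>S. (a, b) \<in> P)"
    unfolding can_be_inadmissible_def by blast
  then show "possibly A D C P (ad, False) S"
  proof cases
    case 1
    then have "S \<notin> ad \<lparr>arguments = A, attacks = C \<inter> (A \<times> A)\<rparr>" unfolding ad_iff by auto
    then show ?thesis using certain_between unfolding possibly_def has_status_def by auto
  next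
    case 2
    then have "S \<notin> ad \<lparr>arguments = D, attacks = P\<rparr>" unfolding ad_iff by auto
    then show ?thesis using whole_between[of P] CP unfolding possibly_def has_status_def by auto
  next
    case 3
    then obtain a b where ab: "a \<in> S" "(b, a) \<in> P" "\<forall>c\<in>S. (c, b) \<notin> C" by blast
    \<comment> \<open>The added attack cannot be its own counterattack: \<open>b\<close> is outside
      \<open>S\<close>, because \<open>S\<close> has no possible inner attack in this case.\<close>
    let ?R = "C \<union> {(b, a)}"
    have "(c, b) \<notin> ?R" if "c \<in> S" for c using ab 3(2) that by auto
    then have "S \<notin> ad \<lparr>arguments = D, attacks = ?R\<rparr>" using ab(1) unfolding ad_iff by fastforce
    then show ?thesis using whole_between[of ?R] CP ab(2)
      unfolding possibly_def has_status_def by (intro bexI[of _ "\<lparr>arguments = D, attacks = ?R\<rparr>"]) auto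
  qed
qed

lemma possibly_not_st: "possibly A D C P (st, False) S \<longleftrightarrow> can_be_unstable A D C P S"
proof
  assume "possibly A D C P (st, False) S"
  then obtain F where F: "F \<in> afs_between A D C P" "S \<notin> st F"
    unfolding possibly_def has_status_def by auto
  show "can_be_unstable A D C P S"
  proof (rule ccontr)
    assume not: "\<not> ?thesis"
    then have "S \<subseteq> A" "\<forall>a\<in>S. \<forall>b\<in>S. (a, b) \<notin> P" unfolding can_be_unstable_def by auto
    then have sub: "S \<subseteq> arguments F" "\<forall>a\<in>S. \<forall>b\<in>S. (a, b) \<notin> attacks F"
      using F unfolding afs_between_def by auto
    have "\<exists>c\<in>S. (c, b) \<in> attacks F" if "b \<in> arguments F - S" for b
    proof -
      have b: "b \<in> D - S" "b \<in> arguments F" using that afs_betweenD(2)[OF F(1)] by auto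
      then obtain c where "c \<in> S" "(c, b) \<in> C"
        using not unfolding can_be_unstable_def by blast
      then show ?thesis using b sub afs_betweenD(3)[OF F(1)] by blast
    qed
    then show False using F(2) sub unfolding st_iff by blast
  qed
next
  assume "can_be_unstable A D C P S"
  then consider "\<not> S \<subseteq> A" | "\<exists>a\<in>S. \<exists>b\<in>S. (a, b) \<in> P" | "\<exists>b\<in>D - S. \<forall>c\<in>S. (c, b) \<notin> C"
    unfolding can_be_unstable_def by blast
  then show "possibly A D C P (st, False) S"
  proof cases
    case 1
    then have "S \<notin> st \<lparr>arguments = A, attacks = C \<inter> (A \<times> A)\<rparr>" unfolding st_iff by auto
    then show ?thesis using certain_between unfolding possibly_def has_status_def by auto
  next
    case 2
    then have "S \<notin> st \<lparr>arguments = D, attacks = P\<rparr>" unfolding st_iff by auto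
    then show ?thesis using whole_between[of P] CP unfolding possibly_def has_status_def by auto
  next
    case 3
    then have "S \<notin> st \<lparr>arguments = D, attacks = C\<rparr>" unfolding st_iff by auto
    then show ?thesis using whole_between[of C] CP unfolding possibly_def has_status_def by auto
  qed
qed

lemma possibly_not_co: "possibly A D C P (co, False) S \<longleftrightarrow> can_be_incomplete A D C P S"
proof
  assume "possibly A D C P (co, False) S"
  then obtain F where F: "F \<in> afs_between A D C P" "S \<notin> co F"
    unfolding possibly_def has_status_def by auto
  show "can_be_incomplete A D C P S"
  proof (cases "can_be_inadmissible A D C P S")
    case False
    then have ad: "S \<in> ad F"
      using F(1) unfolding possibly_not_ad[symmetric] by (auto simp: possibly_def has_status_def)
    then obtain a where a: "a \<in> arguments F - S"
      and def: "\<And>b. (b, a) \<in> attacks F \<Longrightarrow> \<exists>c\<in>S. (c, b) \<in> attacks F"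
      using F(2) unfolding co_iff by blast
    have "(a, a) \<notin> C"
    proof
      assume "(a, a) \<in> C"
      then obtain c where c: "c \<in> S" "(c, a) \<in> attacks F"
        using def[of a] a afs_betweenD(3)[OF F(1)] by blast
      then show False using def[OF c(2)] ad unfolding ad_iff by blast
    qed
    moreover have "\<exists>c\<in>S. (c, b) \<in> P" if "b \<in> A" "(b, a) \<in> C" for b
      using def[of b] that a afs_betweenD[OF F(1)] by blast
    moreover have "a \<in> D - S" using a afs_betweenD(2)[OF F(1)] by blast
    ultimately show ?thesis unfolding can_be_incomplete_def by blast
  qed (simp add: can_be_incomplete_def)
next
  assume S: "can_be_incomplete A D C P S"
  show "possibly A D C P (co, False) S"
  proof (cases "can_be_inadmissible A D C P S")
    case True
    then show ?thesis unfolding possibly_not_ad[symmetric]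
      by (auto simp: possibly_def has_status_def co_def)
  next
    case False
    then obtain a where a: "a \<in> D - S" "(a, a) \<notin> C"
      and def: "\<And>b. b \<in> A \<Longrightarrow> (b, a) \<in> C \<Longrightarrow> \<exists>c\<in>S. (c, b) \<in> P"
      using S unfolding can_be_incomplete_def by blast
    have SA: "S \<subseteq> A" using False unfolding can_be_inadmissible_def by blast
    \<comment> \<open>Here \<open>S\<close> uses all its possible attacks except the uncertain ones
      on \<open>a\<close>, which would be new attacks that \<open>S\<close> has to counter. Thus
      \<open>a\<close> is defended but missing from \<open>S\<close>.\<close>
    let ?A = "insert a A"
    let ?F = "\<lparr>arguments = ?A, attacks = {(p, q) \<in> P. p \<in> ?A \<and> q \<in> ?A \<and> ((p, q) \<in> C \<or> p \<in> S \<and> q \<noteq> a)}\<rparr>"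
    have "?F \<in> afs_between A D C P" using a AD CP unfolding afs_between_def by auto
    moreover have "S \<notin> co ?F"
    proof -
      have "\<exists>c\<in>S. (c, b) \<in> attacks ?F" if "(b, a) \<in> attacks ?F" for b
      proof -
        have b: "(b, a) \<in> C" "b \<in> A" "b \<noteq> a" using that a by auto
        then show ?thesis using def[of b] SA by auto
      qed
      then show ?thesis using a unfolding co_iff by auto
    qed
    ultimately show ?thesis unfolding possibly_def has_status_def by auto
  qed
qed

lemma possibly_not_gr: "possibly A D C P (gr, False) S \<longleftrightarrow> can_be_ungrounded A D C P S"
proof
  assume "possibly A D C P (gr, False) S"
  then obtain F where F: "F \<in> afs_between A D C P" "S \<notin> gr F"
    unfolding possibly_def has_status_def by auto
  show "can_be_ungrounded A D C P S"
  proof (cases "can_be_incomplete A D C P S")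
    case False
    then have co: "S \<in> co F"
      using F(1) unfolding possibly_not_co[symmetric] by (auto simp: possibly_def has_status_def)
    then obtain T where T: "defended F T \<subseteq> T" "\<not> S \<subseteq> T"
      using F(2) unfolding gr_iff by blast
    have SF: "S \<subseteq> arguments F" using co unfolding co_iff ad_iff by blast
    have "well_founded_part D P C S \<subseteq> T"
    proof (rule well_founded_part_least)
      fix a assume a: "a \<in> S"
        and att: "\<And>b. b \<in> D \<Longrightarrow> (b, a) \<in> P \<Longrightarrow> \<exists>c\<in>S \<inter> T. (c, b) \<in> C"
      have "\<exists>c\<in>T. (c, b) \<in> attacks F" if "(b, a) \<in> attacks F" for b
        using att[of b] that SF afs_betweenD[OF F(1)] by blast
      then have "a \<in> defended F T" using a SF unfolding defended_def defends_def by blast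
      then show "a \<in> T" using T(1) by blast
    qed
    then show ?thesis using T(2) unfolding can_be_ungrounded_def by blast
  qed (simp add: can_be_ungrounded_def)
next
  assume S: "can_be_ungrounded A D C P S"
  show "possibly A D C P (gr, False) S"
  proof (cases "can_be_incomplete A D C P S")
    case True
    then show ?thesis unfolding possibly_not_co[symmetric]
      by (auto simp: possibly_def has_status_def gr_def)
  next
    case False
    let ?L = "well_founded_part D P C S"
    \<comment> \<open>The worst case for leastness: all arguments, all possible attacks on
      \<open>S\<close>, and only certain attacks elsewhere. An attacker of \<open>S\<close> lies
      outside \<open>S\<close>, so counterattacks are certain ones.\<close>
    let ?R = "C \<union> {(b, a) \<in> P. a \<in> S}"
    let ?F = "\<lparr>arguments = D, attacks = ?R\<rparr>"
    have F: "?F \<in> afs_between A D C P" using CP by (intro whole_between) auto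
    then have co: "S \<in> co ?F"
      using False unfolding possibly_not_co[symmetric] by (auto simp: possibly_def has_status_def)
    have LS: "?L \<subseteq> S" by (rule well_founded_part_subset)
    have inner: "(a, b) \<notin> P" if "a \<in> S" "b \<in> S" for a b
      using False that unfolding can_be_incomplete_def can_be_inadmissible_def by blast
    have "defended ?F ?L \<subseteq> ?L"
    proof
      fix a assume a: "a \<in> defended ?F ?L"
      then have "a \<in> defended ?F S" using LS unfolding defended_def defends_def by blast
      then have "a \<in> S" using co unfolding co_def by blast
      then show "a \<in> ?L"
      proof (rule well_founded_part.intros, intro ballI impI)
        fix b assume b: "b \<in> D" "(b, a) \<in> P"
        then obtain c where c: "c \<in> ?L" "(c, b) \<in> ?R"
          using a \<open>a \<in> S\<close> unfolding defended_def defends_def by auto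
        moreover have "b \<notin> S" using b \<open>a \<in> S\<close> inner by blast
        ultimately show "\<exists>c. (c, b) \<in> C \<and> c \<in> ?L" by blast
      qed
    qed
    moreover have "\<not> S \<subseteq> ?L" using S False unfolding can_be_ungrounded_def by blast
    ultimately have "S \<notin> gr ?F" unfolding gr_iff by blast
    then show ?thesis using F unfolding possibly_def has_status_def by auto
  qed
qed

end


section \<open>Iteration of inflationary operators\<close>

section \<open>Programs for fixed points\<close>

text \<open>All intermediate sets lie between the first and the last, so a pass without effect
  contains no step with an effect.\<close>

lemma fold_inflationary:
  assumes "\<And>v Y. (Y :: nat set) \<subseteq> s v Y"
  shows "Y \<subseteq> fold s vs Y" and "fold s vs Y = Y \<Longrightarrow> v \<in> set vs \<Longrightarrow> s v Y = Y"
proof -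
  show sub: "Y \<subseteq> fold s vs Y" for vs Y
  proof (induction vs arbitrary: Y)
    case (Cons v vs)
    then show ?case using assms[of Y v] by (simp, blast)
  qed simp
  show "s v Y = Y" if "fold s vs Y = Y" "v \<in> set vs"
    using that
  proof (induction vs)
    case (Cons u vs)
    have "s u Y \<subseteq> Y" using sub[of "s u Y" vs] Cons.prems by simp
    then have "s u Y = Y" using assms[of Y u] by blast
    then show ?case using Cons by auto
  qed simp
qed

lemma fold_invariant:
  assumes "Q Y" "\<And>v Y. v \<in> set vs \<Longrightarrow> Q Y \<Longrightarrow> Q (s v Y)"
  shows "Q (fold s vs Y)"
  using assms by (induction vs arbitrary: Y) auto

text \<open>Each round before stability adds an element of \<open>G\<close>, so at most
  \<open>card G\<close> rounds are productive.\<close>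

lemma funpow_fixpoint:
  assumes infl: "\<And>Y. X \<subseteq> Y \<Longrightarrow> Y \<subseteq> X \<union> G \<Longrightarrow> Y \<subseteq> f Y \<and> f Y \<subseteq> X \<union> G"
    and fin: "finite G" "card G \<le> n"
  shows "f ((f ^^ n) X) = (f ^^ n) X"
proof -
  have bounds: "X \<subseteq> (f ^^ k) X \<and> (f ^^ k) X \<subseteq> X \<union> G" for k
    by (induction k) (use infl in auto)
  have "f ((f ^^ k) X) = (f ^^ k) X \<or> k \<le> card ((f ^^ k) X - X)" for k
  proof (induction k)
    case (Suc k)
    show ?case
    proof (cases "f ((f ^^ k) X) = (f ^^ k) X")
      case False
      then have "(f ^^ k) X - X \<subset> (f ^^ Suc k) X - X" using infl[of "(f ^^ k) X"] bounds[of k] by auto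
      moreover have "finite ((f ^^ Suc k) X - X)"
        using bounds[of "Suc k"] fin(1) by (auto intro: finite_subset[of _ G])
      ultimately have "card ((f ^^ k) X - X) < card ((f ^^ Suc k) X - X)" by (simp add: psubset_card_mono)
      then show ?thesis using Suc False by simp
    qed simp
  qed simp
  from this[of n] show ?thesis
  proof
    assume "n \<le> card ((f ^^ n) X - X)"
    moreover have "(f ^^ n) X - X \<subseteq> G - X" "card (G - X) \<le> card G"
      using bounds[of n] fin(1) by (auto intro: card_mono)
    ultimately have "(f ^^ n) X - X = G - X"
      using fin by (intro card_seteq) auto
    then have "(f ^^ n) X = X \<union> G" using bounds[of n] by blast
    then show ?thesis using infl[of "X \<union> G"] by auto
  qed
qed

lemma fold_const_funpow: "fold (\<lambda>_. f) vs X = (f ^^ length vs) X"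
  by (induction vs arbitrary: X) (simp_all add: funpow_swap1)

text \<open>\<open>N\<close> rounds over all \<open>v < N\<close> reach a fixed point.\<close>

definition saturate :: "fm \<Rightarrow> trm \<Rightarrow> com" where
  "saturate f e = For 5 (Var 4) (For 6 (Var 4) (When f (Ins e)))"

text \<open>Extension, closure and the induction principle of an inductive definition with premise
  \<open>\<Phi> v Y\<close> and coded conclusion \<open>g v\<close>. There are at most
  \<open>N\<close> conclusions, hence \<open>N\<close> rounds suffice; within a round, later steps
  already see earlier insertions.\<close>

lemma exec_saturate:
  assumes N: "\<rho> 4 = N"
    and sat: "\<And>i v Y. v < N \<Longrightarrow> sat z (\<rho>(5 := i, 6 := v)) Y f \<longleftrightarrow> \<Phi> v Y"
    and val: "\<And>i v. v < N \<Longrightarrow> val (\<rho>(5 := i, 6 := v)) e = g v"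
  shows "X \<subseteq> exec z \<rho> (saturate f e) X"
    and "v < N \<Longrightarrow> \<Phi> v (exec z \<rho> (saturate f e) X) \<Longrightarrow> g v \<in> exec z \<rho> (saturate f e) X"
    and "X \<subseteq> Z \<Longrightarrow> (\<And>v Y. v < N \<Longrightarrow> X \<subseteq> Y \<Longrightarrow> Y \<subseteq> Z \<Longrightarrow> \<Phi> v Y \<Longrightarrow> g v \<in> Z)
      \<Longrightarrow> exec z \<rho> (saturate f e) X \<subseteq> Z"
proof -
  define s where "s v Y = (if \<Phi> v Y then insert (g v) Y else Y)" for v Y
  define h where "h = fold s (rev [0..<N])"
  have body: "exec z (\<rho>(5 := i, 6 := v)) (When f (Ins e)) = s v" if "v < N" for i v
    using sat[OF that] val[OF that] by (simp add: s_def fun_eq_iff)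
  have "exec z (\<rho>(5 := i)) (For 6 (Var 4) (When f (Ins e))) Y = h Y" for i Y
    unfolding exec.simps(4) h_def using N by (intro fold_cong body) auto
  then have "exec z (\<rho>(5 := i)) (For 6 (Var 4) (When f (Ins e))) = h" for i
    by blast
  then have ex: "exec z \<rho> (saturate f e) X = (h ^^ N) X"
    using N by (simp add: saturate_def fold_const_funpow)
  have infl: "Y \<subseteq> s v Y" for v Y by (auto simp: s_def)
  have h_infl: "Y \<subseteq> h Y" for Y unfolding h_def by (rule fold_inflationary[OF infl])
  have h_sub: "h Y \<subseteq> X \<union> g ` {..<N}" if "Y \<subseteq> X \<union> g ` {..<N}" for Y
    unfolding h_def by (rule fold_invariant[where Q = "\<lambda>Y. Y \<subseteq> X \<union> g ` {..<N}"])
      (use that in \<open>auto simp: s_def\<close>)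
  have "card (g ` {..<N}) \<le> N" using card_image_le[of "{..<N}" g] by simp
  then have fixp: "h ((h ^^ N) X) = (h ^^ N) X"
    using h_infl h_sub by (intro funpow_fixpoint) auto
  show "X \<subseteq> exec z \<rho> (saturate f e) X"
    unfolding ex using h_infl by (induction N) (simp, fastforce)
  show "g v \<in> exec z \<rho> (saturate f e) X" if "v < N" "\<Phi> v (exec z \<rho> (saturate f e) X)"
  proof -
    have "s v ((h ^^ N) X) = (h ^^ N) X"
      using fixp that unfolding h_def by (intro fold_inflationary(2)[OF infl]) auto
    then show ?thesis using that unfolding ex s_def by auto
  qed
  show "exec z \<rho> (saturate f e) X \<subseteq> Z"
    if Z: "X \<subseteq> Z" "\<And>v Y. v < N \<Longrightarrow> X \<subseteq> Y \<Longrightarrow> Y \<subseteq> Z \<Longrightarrow> \<Phi> v Y \<Longrightarrow> g v \<in> Z"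
  proof -
    have step: "X \<subseteq> h Y \<and> h Y \<subseteq> Z" if "X \<subseteq> Y \<and> Y \<subseteq> Z" for Y
      unfolding h_def by (rule fold_invariant[where Q = "\<lambda>Y. X \<subseteq> Y \<and> Y \<subseteq> Z"])
        (use that Z in \<open>auto simp: s_def\<close>)
    have "X \<subseteq> (h ^^ n) X \<and> (h ^^ n) X \<subseteq> Z" for n
      by (induction n) (use Z(1) step in auto)
    then show ?thesis unfolding ex by blast
  qed
qed


section \<open>Decoding the modified IAF from the bits of its code\<close>

section \<open>Reading an instance\<close>

abbreviation Disj :: "fm \<Rightarrow> fm \<Rightarrow> fm" where "Disj f g \<equiv> Neg (Conj (Neg f) (Neg g))"
abbreviation Imp :: "fm \<Rightarrow> fm \<Rightarrow> fm" where "Imp f g \<equiv> Neg (Conj f (Neg g))"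
abbreviation Ex :: "nat \<Rightarrow> fm \<Rightarrow> fm" where "Ex v \<equiv> Exi v (Var 4)"
abbreviation All :: "nat \<Rightarrow> fm \<Rightarrow> fm" where "All v f \<equiv> Neg (Exi v (Var 4) (Neg f))"

text \<open>
  Variable 4 is the number \<open>N\<close> of arguments. The parameter \<open>acc\<close> of the formulas below maps a position
  in the code of the instance to a formula for the bit at this position.
\<close>

definition act_bit :: "(trm \<Rightarrow> fm) \<Rightarrow> fm" where
  "act_bit acc = acc (Add (Var 4) (Cst 1))"

definition arg_bit :: "(trm \<Rightarrow> fm) \<Rightarrow> nat \<Rightarrow> trm \<Rightarrow> fm" where
  "arg_bit acc k i = acc (Add (Add (Var 4) (Cst (2 + k))) (Mul (Cst 3) i))"

definition pair_index :: "trm \<Rightarrow> trm \<Rightarrow> trm" where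
  "pair_index i j = Add (Mul i (Var 4)) j"

text \<open>The offsets follow \<open>encode\<close>: \<open>N\<close> ones, a separator, the action
  bit, three bits per argument, three bits per pair. The \<open>Var 4\<close> beside
  \<open>pair_index\<close> skips the argument triples.\<close>

definition att_bit :: "(trm \<Rightarrow> fm) \<Rightarrow> nat \<Rightarrow> trm \<Rightarrow> trm \<Rightarrow> fm" where
  "att_bit acc k i j =
     acc (Add (Add (Var 4) (Cst (2 + k))) (Mul (Cst 3) (Add (Var 4) (pair_index i j))))"

text \<open>To test an addition, the element is removed; so an argument disappears exactly when it
  is marked and the action is an addition.\<close>

definition D_fm :: "(trm \<Rightarrow> fm) \<Rightarrow> trm \<Rightarrow> fm" where
  "D_fm acc i = Neg (Conj (act_bit acc) (arg_bit acc 2 i))"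

definition A_fm :: "(trm \<Rightarrow> fm) \<Rightarrow> trm \<Rightarrow> fm" where
  "A_fm acc i = Disj (Neg (arg_bit acc 0 i)) (Conj (Neg (act_bit acc)) (arg_bit acc 2 i))"

definition S_fm :: "(trm \<Rightarrow> fm) \<Rightarrow> trm \<Rightarrow> fm" where
  "S_fm acc i = arg_bit acc 1 i"

definition C_fm :: "(trm \<Rightarrow> fm) \<Rightarrow> trm \<Rightarrow> trm \<Rightarrow> fm" where
  "C_fm acc i j = Conj (Disj (att_bit acc 0 i j) (Conj (Neg (act_bit acc)) (att_bit acc 2 i j)))
     (Conj (D_fm acc i) (D_fm acc j))"

definition P_fm :: "(trm \<Rightarrow> fm) \<Rightarrow> trm \<Rightarrow> trm \<Rightarrow> fm" where
  "P_fm acc i j = Conj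
     (Conj (Disj (att_bit acc 0 i j) (att_bit acc 1 i j)) (Neg (Conj (act_bit acc) (att_bit acc 2 i j))))
     (Conj (D_fm acc i) (D_fm acc j))"

definition changed :: "'a iaf \<Rightarrow> action \<Rightarrow> 'a element \<Rightarrow> 'a iaf" where
  "changed I act e = (if act = Addition then rem_element I e else add_element I e)"

lemma wf_changed: "wf_iaf I \<Longrightarrow> e \<in> uncertain_elements I \<Longrightarrow> wf_iaf (changed I act e)"
  by (cases e) (auto simp: changed_def wf_iaf_def uncertain_elements_def add_args_def add_atts_def
      rem_args_def rem_atts_def Let_def)

lemma strongly_relevant_iff:
  assumes "wf_iaf I" "e \<in> uncertain_elements I" "J = changed I act e"
  shows "strongly_relevant j I S act e \<longleftrightarrow>
    \<not> possibly (cargs J) (cargs J \<union> uargs J) (catts J) (catts J \<union> uatts J) j S"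
proof -
  have "strongly_relevant j I S act e \<longleftrightarrow> \<not> (\<exists>I'\<in>part J. stable_status j I' S)"
    by (cases act) (auto simp: assms(3) changed_def)
  then show ?thesis
    using wf_changed[OF assms(1,2), of act]
    by (simp add: ex_part_stable_iff completions_eq possibly_def assms(3))
qed

lemma length_concat_triples: "length (concat (map (\<lambda>a. [f a, g a, h a]) ys)) = 3 * length ys"
  by (induction ys) auto

lemma nth_concat_triples:
  assumes "i < length ys"
  shows "concat (map (\<lambda>a. [f a, g a, h a]) ys) ! (3 * i) = f (ys ! i)"
    and "concat (map (\<lambda>a. [f a, g a, h a]) ys) ! Suc (3 * i) = g (ys ! i)"
    and "concat (map (\<lambda>a. [f a, g a, h a]) ys) ! Suc (Suc (3 * i)) = h (ys ! i)"
  using assms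
proof (induction ys arbitrary: i)
  case (Cons y ys)
  { case 1 then show ?case using Cons by (cases i) auto }
  { case 2 then show ?case using Cons by (cases i) auto }
  { case 3 then show ?case using Cons by (cases i) auto }
qed auto

lemma index_less: "i < n \<Longrightarrow> j < n \<Longrightarrow> i * n + j < n * n" for n :: nat
proof -
  assume ij: "i < n" "j < n"
  have "i * n + j < Suc i * n" using ij by simp
  also have "Suc i * n \<le> n * n" using ij by (intro mult_le_mono1) simp
  finally show ?thesis .
qed

lemma nth_product_self:
  assumes "i < length xs" "j < length xs"
  shows "List.product xs xs ! (i * length xs + j) = (xs ! i, xs ! j)"
proof -
  have "xs \<noteq> []" using assms by auto
  then show ?thesis using assms index_less[OF assms] by (subst product_nth) auto
qed

text \<open>\<open>x\<close> is the code and \<open>z\<close> the string on the tape, which may also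
  contain certificates; \<open>acc\<close> is trusted only at positions inside
  \<open>x\<close>.\<close>

locale coded_instance =
  fixes xs :: "'a list" and I :: "'a iaf" and S :: "'a set" and act :: action and e :: "'a element"
    and x z :: "bool list" and acc :: "trm \<Rightarrow> fm"
  assumes wf: "wf_iaf I" and dist: "distinct xs" and set_xs: "set xs = cargs I \<union> uargs I"
    and S_sub: "S \<subseteq> cargs I \<union> uargs I" and e: "e \<in> uncertain_elements I"
    and x: "x = encode xs I S act e"
    and acc: "\<And>\<rho> X t. val \<rho> t < length x \<Longrightarrow> sat z \<rho> X (acc t) \<longleftrightarrow> x ! val \<rho> t"
begin

abbreviation "N \<equiv> length xs"
abbreviation "J \<equiv> changed I act e"
abbreviation "A \<equiv> cargs J"
abbreviation "D \<equiv> cargs J \<union> uargs J"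
abbreviation "C \<equiv> catts J"
abbreviation "P \<equiv> catts J \<union> uatts J"

lemma length_x: "length x = N + 2 + 3 * (N + N * N)"
  by (simp add: x encode_def length_concat_triples)

lemma x_unary: "i < N \<Longrightarrow> x ! i" "\<not> x ! N"
  by (auto simp: x encode_def nth_append)

lemma x_act: "x ! Suc N \<longleftrightarrow> act = Addition"
  by (simp add: x encode_def nth_append)

lemma x_args:
  assumes "i < N"
  shows "x ! (N + 2 + 3 * i) \<longleftrightarrow> xs ! i \<in> uargs I"
    and "x ! (N + 3 + 3 * i) \<longleftrightarrow> xs ! i \<in> S"
    and "x ! (N + 4 + 3 * i) \<longleftrightarrow> e = Arg (xs ! i)"
  using assms nth_concat_triples[OF assms, of "\<lambda>a. a \<in> uargs I" "\<lambda>a. a \<in> S" "\<lambda>a. e = Arg a"]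
  by (auto simp: x encode_def nth_append length_concat_triples)

lemma x_atts:
  assumes "i < N" "j < N"
  shows "x ! (N + 2 + 3 * (N + (i * N + j))) \<longleftrightarrow> (xs ! i, xs ! j) \<in> catts I"
    and "x ! (N + 3 + 3 * (N + (i * N + j))) \<longleftrightarrow> (xs ! i, xs ! j) \<in> uatts I"
    and "x ! (N + 4 + 3 * (N + (i * N + j))) \<longleftrightarrow> e = Att (xs ! i, xs ! j)"
proof -
  have l: "i * N + j < length (List.product xs xs)" using index_less[OF assms] by simp
  note n = nth_product_self[OF assms]
  note t = nth_concat_triples[OF l, of "\<lambda>r. r \<in> catts I" "\<lambda>r. r \<in> uatts I" "\<lambda>r. e = Att r", unfolded n]
  show "x ! (N + 2 + 3 * (N + (i * N + j))) \<longleftrightarrow> (xs ! i, xs ! j) \<in> catts I"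
    "x ! (N + 3 + 3 * (N + (i * N + j))) \<longleftrightarrow> (xs ! i, xs ! j) \<in> uatts I"
    "x ! (N + 4 + 3 * (N + (i * N + j))) \<longleftrightarrow> e = Att (xs ! i, xs ! j)"
    using t by (auto simp: x encode_def nth_append length_concat_triples)
qed

lemma AD: "A \<subseteq> D" and CP: "C \<subseteq> P" and PD: "P \<subseteq> D \<times> D"
  using wf_changed[OF wf e, of act] unfolding wf_iaf_def by auto

lemmas changed_defs = changed_def add_args_def add_atts_def rem_args_def rem_atts_def Let_def

lemma D_iff: "a \<in> D \<longleftrightarrow> a \<in> set xs \<and> \<not> (act = Addition \<and> e = Arg a)"
  using e wf unfolding set_xs
  by (cases e; cases act) (auto simp: changed_defs uncertain_elements_def wf_iaf_def)

lemma D_sub: "D \<subseteq> set xs"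
  using D_iff by blast

lemma C_iff: "(a, b) \<in> C \<longleftrightarrow> ((a, b) \<in> catts I \<or> act \<noteq> Addition \<and> e = Att (a, b)) \<and>
    \<not> (act = Addition \<and> (e = Arg a \<or> e = Arg b))"
  using e by (cases e; cases act) (auto simp: changed_defs uncertain_elements_def)

lemma P_iff: "(a, b) \<in> P \<longleftrightarrow> ((a, b) \<in> catts I \<or> (a, b) \<in> uatts I) \<and>
    \<not> (act = Addition \<and> e = Att (a, b)) \<and> \<not> (act = Addition \<and> (e = Arg a \<or> e = Arg b))"
proof -
  have "(a, b) \<notin> catts I" if "e = Att (a, b)"
    using that e wf by (auto simp: uncertain_elements_def wf_iaf_def)
  then show ?thesis
    using e by (cases e; cases act) (auto simp: changed_defs uncertain_elements_def)
qed

context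
  fixes \<rho> :: "nat \<Rightarrow> nat" and i :: trm and X :: "nat set"
  assumes \<rho>4: "\<rho> 4 = N" and i: "val \<rho> i < N"
begin

lemma sat_act: "sat z \<rho> X (act_bit acc) \<longleftrightarrow> act = Addition"
  using acc[of \<rho> "Add (Var 4) (Cst 1)"] \<rho>4 x_act by (simp add: act_bit_def length_x)

lemma sat_arg_bit:
  "sat z \<rho> X (arg_bit acc 0 i) \<longleftrightarrow> xs ! val \<rho> i \<in> uargs I"
  "sat z \<rho> X (arg_bit acc 1 i) \<longleftrightarrow> xs ! val \<rho> i \<in> S"
  "sat z \<rho> X (arg_bit acc 2 i) \<longleftrightarrow> e = Arg (xs ! val \<rho> i)"
  using x_args[OF i] i \<rho>4 by (auto simp: arg_bit_def acc length_x)

lemma sat_D: "sat z \<rho> X (D_fm acc i) \<longleftrightarrow> xs ! val \<rho> i \<in> D"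
  unfolding D_fm_def sat.simps sat_act sat_arg_bit D_iff using nth_mem[OF i] by simp

lemma sat_A: "sat z \<rho> X (A_fm acc i) \<longleftrightarrow> xs ! val \<rho> i \<in> A"
  unfolding A_fm_def sat.simps sat_act sat_arg_bit
  using nth_mem[OF i] e wf unfolding set_xs
  by (cases e; cases act) (auto simp: changed_defs uncertain_elements_def wf_iaf_def)

lemma sat_S: "sat z \<rho> X (S_fm acc i) \<longleftrightarrow> xs ! val \<rho> i \<in> S"
  unfolding S_fm_def sat_arg_bit ..

context
  fixes j :: trm
  assumes j: "val \<rho> j < N"
begin

lemma sat_att_bit:
  "sat z \<rho> X (att_bit acc 0 i j) \<longleftrightarrow> (xs ! val \<rho> i, xs ! val \<rho> j) \<in> catts I"
  "sat z \<rho> X (att_bit acc 1 i j) \<longleftrightarrow> (xs ! val \<rho> i, xs ! val \<rho> j) \<in> uatts I"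
  "sat z \<rho> X (att_bit acc 2 i j) \<longleftrightarrow> e = Att (xs ! val \<rho> i, xs ! val \<rho> j)"
  using x_atts[OF i j] index_less[OF i j] \<rho>4
  by (auto simp: att_bit_def pair_index_def acc length_x)

end

end

lemma sat_C: "\<rho> 4 = N \<Longrightarrow> val \<rho> i < N \<Longrightarrow> val \<rho> j < N \<Longrightarrow>
    sat z \<rho> X (C_fm acc i j) \<longleftrightarrow> (xs ! val \<rho> i, xs ! val \<rho> j) \<in> C"
  unfolding C_fm_def sat.simps C_iff by (simp only: sat_act sat_D sat_att_bit D_iff nth_mem) blast

lemma sat_P: "\<rho> 4 = N \<Longrightarrow> val \<rho> i < N \<Longrightarrow> val \<rho> j < N \<Longrightarrow>
    sat z \<rho> X (P_fm acc i j) \<longleftrightarrow> (xs ! val \<rho> i, xs ! val \<rho> j) \<in> P"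
  unfolding P_fm_def sat.simps P_iff by (simp only: sat_act sat_D sat_att_bit D_iff nth_mem) blast

end


section \<open>Formulas for possible verification\<close>

definition subset_fm :: "(trm \<Rightarrow> fm) \<Rightarrow> (trm \<Rightarrow> fm) \<Rightarrow> fm" where
  "subset_fm f g = All 5 (Imp (f (Var 5)) (g (Var 5)))"

definition conflict_fm :: "(trm \<Rightarrow> fm) \<Rightarrow> (trm \<Rightarrow> trm \<Rightarrow> fm) \<Rightarrow> fm" where
  "conflict_fm f r = Ex 5 (Ex 6 (Conj (Conj (f (Var 5)) (f (Var 6))) (r (Var 5) (Var 6))))"

definition admissible_fm :: "(trm \<Rightarrow> fm) \<Rightarrow> fm" where
  "admissible_fm acc = Conj (Conj (subset_fm (S_fm acc) (D_fm acc)) (Neg (conflict_fm (S_fm acc) (C_fm acc))))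
     (All 5 (All 6 (Imp
       (Conj (Conj (S_fm acc (Var 5)) (Conj (A_fm acc (Var 6)) (Neg (S_fm acc (Var 6)))))
         (C_fm acc (Var 6) (Var 5)))
       (Ex 7 (Conj (S_fm acc (Var 7)) (P_fm acc (Var 7) (Var 6)))))))"

definition stable_fm :: "(trm \<Rightarrow> fm) \<Rightarrow> fm" where
  "stable_fm acc = Conj (Conj (subset_fm (S_fm acc) (D_fm acc)) (Neg (conflict_fm (S_fm acc) (C_fm acc))))
     (All 5 (Imp (Conj (A_fm acc (Var 5)) (Neg (S_fm acc (Var 5))))
       (Ex 6 (Conj (S_fm acc (Var 6)) (P_fm acc (Var 6) (Var 5))))))"

text \<open>The set held by the machine stores \<open>i < N\<close> as \<open>1 + i\<close> in its first part and as \<open>1 + N + i\<close> in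
  its second part; 0 signals acceptance.\<close>

definition first_fm :: "trm \<Rightarrow> fm" where
  "first_fm i = Mem (Add (Cst 1) i)"

definition second_fm :: "trm \<Rightarrow> fm" where
  "second_fm i = Mem (Add (Cst 1) (Add (Var 4) i))"

definition doomed_com :: "(trm \<Rightarrow> fm) \<Rightarrow> com" where
  "doomed_com acc = saturate
     (Conj (Conj (D_fm acc (Var 6)) (Neg (S_fm acc (Var 6))))
       (Disj
         (Ex 7 (Conj (S_fm acc (Var 7)) (Disj (C_fm acc (Var 7) (Var 6)) (C_fm acc (Var 6) (Var 7)))))
         (All 7 (Imp (Conj (Conj (D_fm acc (Var 7)) (Neg (S_fm acc (Var 7)))) (P_fm acc (Var 7) (Var 6)))
           (first_fm (Var 7))))))
     (Add (Cst 1) (Var 6))"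

definition well_founded_com :: "(trm \<Rightarrow> fm) \<Rightarrow> (trm \<Rightarrow> fm) \<Rightarrow> (trm \<Rightarrow> trm \<Rightarrow> fm) \<Rightarrow>
    (trm \<Rightarrow> trm \<Rightarrow> fm) \<Rightarrow> com" where
  "well_founded_com acc fB fR fQ = saturate
     (Conj (S_fm acc (Var 6))
       (All 7 (Imp (Conj (fB (Var 7)) (fR (Var 7) (Var 6)))
         (Ex 8 (Conj (fQ (Var 8) (Var 7)) (second_fm (Var 8)))))))
     (Add (Cst 1) (Add (Var 4) (Var 6)))"

definition complete_fm :: "(trm \<Rightarrow> fm) \<Rightarrow> fm" where
  "complete_fm acc = Conj (Conj (subset_fm (S_fm acc) (D_fm acc)) (Neg (conflict_fm (S_fm acc) (C_fm acc))))
     (All 5 (Imp (Conj (A_fm acc (Var 5)) (first_fm (Var 5)))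
       (Ex 6 (Conj (S_fm acc (Var 6)) (P_fm acc (Var 6) (Var 5))))))"

definition inadmissible_fm :: "(trm \<Rightarrow> fm) \<Rightarrow> fm" where
  "inadmissible_fm acc = Disj (Disj (Neg (subset_fm (S_fm acc) (A_fm acc))) (conflict_fm (S_fm acc) (P_fm acc)))
     (Ex 5 (Ex 6 (Conj (Conj (Conj (S_fm acc (Var 5)) (D_fm acc (Var 6))) (P_fm acc (Var 6) (Var 5)))
       (All 7 (Imp (S_fm acc (Var 7)) (Neg (C_fm acc (Var 7) (Var 6))))))))"

definition unstable_fm :: "(trm \<Rightarrow> fm) \<Rightarrow> fm" where
  "unstable_fm acc = Disj (Disj (Neg (subset_fm (S_fm acc) (A_fm acc))) (conflict_fm (S_fm acc) (P_fm acc)))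
     (Ex 5 (Conj (Conj (D_fm acc (Var 5)) (Neg (S_fm acc (Var 5))))
       (All 6 (Imp (S_fm acc (Var 6)) (Neg (C_fm acc (Var 6) (Var 5)))))))"

definition incomplete_fm :: "(trm \<Rightarrow> fm) \<Rightarrow> fm" where
  "incomplete_fm acc = Disj (inadmissible_fm acc)
     (Ex 5 (Conj (Conj (Conj (D_fm acc (Var 5)) (Neg (S_fm acc (Var 5)))) (Neg (C_fm acc (Var 5) (Var 5))))
       (All 6 (Imp (Conj (A_fm acc (Var 6)) (C_fm acc (Var 6) (Var 5)))
         (Ex 7 (Conj (S_fm acc (Var 7)) (P_fm acc (Var 7) (Var 6))))))))"

text \<open>Acceptance is refutation, because strong relevance denies that a suitable completion
  exists.\<close>

definition refute_com :: "fm \<Rightarrow> com" where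
  "refute_com f = When (Neg f) (Ins (Cst 0))"

definition co_com :: "(trm \<Rightarrow> fm) \<Rightarrow> com" where
  "co_com acc = Then (doomed_com acc) (refute_com (complete_fm acc))"

definition gr_com :: "(trm \<Rightarrow> fm) \<Rightarrow> com" where
  "gr_com acc = Then (doomed_com acc)
     (Then (well_founded_com acc (\<lambda>i. Conj (A_fm acc i) (first_fm i)) (C_fm acc) (P_fm acc))
       (refute_com (Conj (complete_fm acc) (subset_fm (S_fm acc) second_fm))))"

definition not_gr_com :: "(trm \<Rightarrow> fm) \<Rightarrow> com" where
  "not_gr_com acc = Then (well_founded_com acc (D_fm acc) (P_fm acc) (C_fm acc))
     (refute_com (Disj (incomplete_fm acc) (Neg (subset_fm (S_fm acc) second_fm))))"

text \<open>This hides the encoding: all further formulas are verified from the meaning of five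
  basic ones, uniformly in the environment and in the set held by the machine.\<close>

locale coded_structure =
  fixes xs :: "'a list" and A D S :: "'a set" and C P :: "('a \<times> 'a) set"
    and z :: "bool list" and acc :: "trm \<Rightarrow> fm"
  assumes AD: "A \<subseteq> D" and CP: "C \<subseteq> P" and PD: "P \<subseteq> D \<times> D"
    and D_sub: "D \<subseteq> set xs" and S_sub: "S \<subseteq> set xs" and dist: "distinct xs"
    and sat_D: "\<And>\<rho> X i. \<rho> 4 = length xs \<Longrightarrow> val \<rho> i < length xs \<Longrightarrow>
      sat z \<rho> X (D_fm acc i) \<longleftrightarrow> xs ! val \<rho> i \<in> D"
    and sat_A: "\<And>\<rho> X i. \<rho> 4 = length xs \<Longrightarrow> val \<rho> i < length xs \<Longrightarrow>
      sat z \<rho> X (A_fm acc i) \<longleftrightarrow> xs ! val \<rho> i \<in> A"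
    and sat_S: "\<And>\<rho> X i. \<rho> 4 = length xs \<Longrightarrow> val \<rho> i < length xs \<Longrightarrow>
      sat z \<rho> X (S_fm acc i) \<longleftrightarrow> xs ! val \<rho> i \<in> S"
    and sat_C: "\<And>\<rho> X i j. \<rho> 4 = length xs \<Longrightarrow> val \<rho> i < length xs \<Longrightarrow> val \<rho> j < length xs \<Longrightarrow>
      sat z \<rho> X (C_fm acc i j) \<longleftrightarrow> (xs ! val \<rho> i, xs ! val \<rho> j) \<in> C"
    and sat_P: "\<And>\<rho> X i j. \<rho> 4 = length xs \<Longrightarrow> val \<rho> i < length xs \<Longrightarrow> val \<rho> j < length xs \<Longrightarrow>
      sat z \<rho> X (P_fm acc i j) \<longleftrightarrow> (xs ! val \<rho> i, xs ! val \<rho> j) \<in> P"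
begin

abbreviation "N \<equiv> length xs"

lemmas sat_rules = sat_D sat_A sat_S sat_C sat_P

lemma ball_nth: "B \<subseteq> set xs \<Longrightarrow> (\<forall>a\<in>B. Q a) \<longleftrightarrow> (\<forall>i<N. xs ! i \<in> B \<longrightarrow> Q (xs ! i))"
  by (metis in_set_conv_nth nth_mem subsetD)

lemma bex_nth: "B \<subseteq> set xs \<Longrightarrow> (\<exists>a\<in>B. Q a) \<longleftrightarrow> (\<exists>i<N. xs ! i \<in> B \<and> Q (xs ! i))"
  by (metis in_set_conv_nth nth_mem subsetD)

lemma subs: "A \<subseteq> set xs" "A - S \<subseteq> set xs" "D - S \<subseteq> set xs" "A \<inter> B \<subseteq> set xs"
  using AD D_sub by blast+

lemmas nth_rules = ball_nth[OF S_sub] bex_nth[OF S_sub] ball_nth[OF D_sub] bex_nth[OF D_sub]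
  ball_nth[OF subs(1)] ball_nth[OF subs(2)] ball_nth[OF subs(3)] ball_nth[OF subs(4)] bex_nth[OF subs(3)]

context
  fixes \<rho> :: "nat \<Rightarrow> nat"
  assumes \<rho>: "\<rho> 4 = N"
begin

lemma sat_subset_D: "sat z \<rho> X (subset_fm (S_fm acc) (D_fm acc)) \<longleftrightarrow> S \<subseteq> D"
  and sat_subset_A: "sat z \<rho> X (subset_fm (S_fm acc) (A_fm acc)) \<longleftrightarrow> S \<subseteq> A"
  unfolding subset_eq nth_rules subset_fm_def using \<rho>
  by (auto simp: sat_rules)

lemma sat_conflict_C: "sat z \<rho> X (conflict_fm (S_fm acc) (C_fm acc)) \<longleftrightarrow> (\<exists>a\<in>S. \<exists>b\<in>S. (a, b) \<in> C)"
  and sat_conflict_P: "sat z \<rho> X (conflict_fm (S_fm acc) (P_fm acc)) \<longleftrightarrow> (\<exists>a\<in>S. \<exists>b\<in>S. (a, b) \<in> P)"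
  unfolding nth_rules conflict_fm_def using \<rho>
  by (simp_all add: sat_rules cong: conj_cong) blast+

lemma sat_admissible: "sat z \<rho> X (admissible_fm acc) \<longleftrightarrow> can_be_admissible A D C P S"
proof -
  have "sat z \<rho> X (admissible_fm acc) \<longleftrightarrow> S \<subseteq> D \<and> \<not> (\<exists>a\<in>S. \<exists>b\<in>S. (a, b) \<in> C) \<and>
     (\<forall>i<N. \<forall>j<N. xs ! i \<in> S \<and> (xs ! j \<in> A \<and> xs ! j \<notin> S) \<and> (xs ! j, xs ! i) \<in> C \<longrightarrow>
       (\<exists>k<N. xs ! k \<in> S \<and> (xs ! k, xs ! j) \<in> P))"
    using \<rho> by (simp add: admissible_fm_def sat_rules sat_subset_D sat_conflict_C cong: conj_cong) blast
  then show ?thesis unfolding can_be_admissible_def nth_rules(1,2,6) by auto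
qed

lemma sat_stable: "sat z \<rho> X (stable_fm acc) \<longleftrightarrow> can_be_stable A D C P S"
proof -
  have "sat z \<rho> X (stable_fm acc) \<longleftrightarrow> S \<subseteq> D \<and> \<not> (\<exists>a\<in>S. \<exists>b\<in>S. (a, b) \<in> C) \<and>
     (\<forall>j<N. xs ! j \<in> A \<and> xs ! j \<notin> S \<longrightarrow> (\<exists>k<N. xs ! k \<in> S \<and> (xs ! k, xs ! j) \<in> P))"
    using \<rho> by (simp add: stable_fm_def sat_rules sat_subset_D sat_conflict_C cong: conj_cong) blast
  then show ?thesis unfolding can_be_stable_def nth_rules(1,2,6) by auto
qed

lemma sat_complete:
  assumes "\<And>i. i < N \<Longrightarrow> Suc i \<in> X \<longleftrightarrow> xs ! i \<in> doomed D C P S"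
  shows "sat z \<rho> X (complete_fm acc) \<longleftrightarrow> can_be_complete A D C P S"
proof -
  have "sat z \<rho> X (complete_fm acc) \<longleftrightarrow> S \<subseteq> D \<and> \<not> (\<exists>a\<in>S. \<exists>b\<in>S. (a, b) \<in> C) \<and>
     (\<forall>j<N. xs ! j \<in> A \<and> Suc j \<in> X \<longrightarrow> (\<exists>k<N. xs ! k \<in> S \<and> (xs ! k, xs ! j) \<in> P))"
    using \<rho> by (simp add: complete_fm_def first_fm_def sat_rules sat_subset_D sat_conflict_C cong: conj_cong) blast
  then show ?thesis unfolding can_be_complete_def nth_rules(1,2,8) using assms by auto
qed

lemma sat_inadmissible: "sat z \<rho> X (inadmissible_fm acc) \<longleftrightarrow> can_be_inadmissible A D C P S"
proof -
  have "sat z \<rho> X (inadmissible_fm acc) \<longleftrightarrow> \<not> S \<subseteq> A \<or> (\<exists>a\<in>S. \<exists>b\<in>S. (a, b) \<in> P) \<or>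
     (\<exists>i<N. \<exists>j<N. ((xs ! i \<in> S \<and> xs ! j \<in> D) \<and> (xs ! j, xs ! i) \<in> P) \<and>
       (\<forall>k<N. xs ! k \<in> S \<longrightarrow> (xs ! k, xs ! j) \<notin> C))"
    using \<rho> by (simp add: inadmissible_fm_def sat_rules sat_subset_A sat_conflict_P cong: conj_cong) blast
  then show ?thesis unfolding can_be_inadmissible_def nth_rules(1,2,4) by auto
qed

lemma sat_unstable: "sat z \<rho> X (unstable_fm acc) \<longleftrightarrow> can_be_unstable A D C P S"
proof -
  have "sat z \<rho> X (unstable_fm acc) \<longleftrightarrow> \<not> S \<subseteq> A \<or> (\<exists>a\<in>S. \<exists>b\<in>S. (a, b) \<in> P) \<or>
     (\<exists>j<N. (xs ! j \<in> D \<and> xs ! j \<notin> S) \<and> (\<forall>k<N. xs ! k \<in> S \<longrightarrow> (xs ! k, xs ! j) \<notin> C))"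
    using \<rho> by (simp add: unstable_fm_def sat_rules sat_subset_A sat_conflict_P cong: conj_cong) blast
  then show ?thesis unfolding can_be_unstable_def nth_rules(1,2,9) by auto
qed

lemma sat_incomplete: "sat z \<rho> X (incomplete_fm acc) \<longleftrightarrow> can_be_incomplete A D C P S"
proof -
  have "sat z \<rho> X (incomplete_fm acc) \<longleftrightarrow> can_be_inadmissible A D C P S \<or>
     (\<exists>i<N. ((xs ! i \<in> D \<and> xs ! i \<notin> S) \<and> (xs ! i, xs ! i) \<notin> C) \<and>
       (\<forall>j<N. xs ! j \<in> A \<and> (xs ! j, xs ! i) \<in> C \<longrightarrow> (\<exists>k<N. xs ! k \<in> S \<and> (xs ! k, xs ! j) \<in> P)))"
    using \<rho> by (simp add: incomplete_fm_def sat_rules sat_inadmissible cong: conj_cong) blast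
  then show ?thesis unfolding can_be_incomplete_def nth_rules(2,5,9) by auto
qed

lemma exec_doomed:
  shows "i < N \<Longrightarrow> Suc i \<in> exec z \<rho> (doomed_com acc) {} \<longleftrightarrow> xs ! i \<in> doomed D C P S"
    and "exec z \<rho> (doomed_com acc) {} \<subseteq> {1..N}"
proof -
  define \<Phi> where "\<Phi> v Y \<longleftrightarrow> (xs ! v \<in> D \<and> xs ! v \<notin> S) \<and>
    ((\<exists>i<N. xs ! i \<in> S \<and> ((xs ! i, xs ! v) \<in> C \<or> (xs ! v, xs ! i) \<in> C)) \<or>
     (\<forall>i<N. (xs ! i \<in> D \<and> xs ! i \<notin> S) \<and> (xs ! i, xs ! v) \<in> P \<longrightarrow> Suc i \<in> Y))" for v Y
  let ?K = "doomed D C P S"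
  let ?Y = "exec z \<rho> (doomed_com acc) {}"
  have sat: "sat z (\<rho>(5 := i, 6 := v)) Y
     (Conj (Conj (D_fm acc (Var 6)) (Neg (S_fm acc (Var 6))))
       (Disj
         (Ex 7 (Conj (S_fm acc (Var 7)) (Disj (C_fm acc (Var 7) (Var 6)) (C_fm acc (Var 6) (Var 7)))))
         (All 7 (Imp (Conj (Conj (D_fm acc (Var 7)) (Neg (S_fm acc (Var 7)))) (P_fm acc (Var 7) (Var 6)))
           (first_fm (Var 7)))))) \<longleftrightarrow> \<Phi> v Y" if "v < N" for i v Y
    using \<rho> that by (simp add: \<Phi>_def first_fm_def sat_rules cong: conj_cong) blast
  have val: "val (\<rho>(5 := i, 6 := v)) (Add (Cst 1) (Var 6)) = Suc v" for i v by simp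
  note ex = exec_saturate[OF \<rho> sat val, folded doomed_com_def]
  have sub: "?Y \<subseteq> {Suc i | i. i < N \<and> xs ! i \<in> ?K}"
  proof (rule ex(3))
    fix v Y assume v: "v < N" "Y \<subseteq> {Suc i | i. i < N \<and> xs ! i \<in> ?K}" "\<Phi> v Y"
    have "xs ! i \<in> ?K" if "Suc i \<in> Y" for i using that v(2) by auto
    then have "xs ! v \<in> ?K"
      using v(3) unfolding \<Phi>_def
      by (intro doomed.intros) (auto simp: nth_rules)
    then show "Suc v \<in> {Suc i | i. i < N \<and> xs ! i \<in> ?K}" using v(1) by blast
  qed auto
  then show "?Y \<subseteq> {1..N}" by auto
  have "\<forall>v<N. xs ! v = k \<longrightarrow> Suc v \<in> ?Y" if "k \<in> ?K" for k
    using that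
  proof induction
    case (1 k)
    show ?case
    proof (intro allI impI)
      fix v assume v: "v < N" "xs ! v = k"
      have "\<Phi> v ?Y" using 1 v unfolding \<Phi>_def by (auto simp: nth_rules)
      then show "Suc v \<in> ?Y" using ex(2) v(1) by blast
    qed
  qed
  then show "Suc i \<in> ?Y \<longleftrightarrow> xs ! i \<in> ?K" if "i < N" using that sub by auto
qed

text \<open>The attackers \<open>B\<close> may be read from the machine's own set, as happens for
  \<open>gr\<close>. Insertions go above \<open>N\<close>, so \<open>Y \<inter> {..N} = X\<close>
  persists, and under this condition \<open>Bp\<close> has the intended meaning throughout.\<close>

lemma exec_well_founded:
  assumes fB: "\<And>\<rho> Y i. \<rho> 4 = N \<Longrightarrow> val \<rho> i < N \<Longrightarrow> sat z \<rho> Y (fB i) \<longleftrightarrow> Bp (val \<rho> i) Y"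
    and Bp: "\<And>Y i. i < N \<Longrightarrow> Y \<inter> {..N} = X \<Longrightarrow> Bp i Y \<longleftrightarrow> xs ! i \<in> B"
    and fR: "\<And>\<rho> Y i j. \<rho> 4 = N \<Longrightarrow> val \<rho> i < N \<Longrightarrow> val \<rho> j < N \<Longrightarrow>
      sat z \<rho> Y (fR i j) \<longleftrightarrow> (xs ! val \<rho> i, xs ! val \<rho> j) \<in> R"
    and fQ: "\<And>\<rho> Y i j. \<rho> 4 = N \<Longrightarrow> val \<rho> i < N \<Longrightarrow> val \<rho> j < N \<Longrightarrow>
      sat z \<rho> Y (fQ i j) \<longleftrightarrow> (xs ! val \<rho> i, xs ! val \<rho> j) \<in> Q"
    and X: "X \<subseteq> {1..N}" and B_sub: "B \<subseteq> set xs"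
  shows "exec z \<rho> (well_founded_com acc fB fR fQ) X \<inter> {..N} = X"
    and "i < N \<Longrightarrow> Suc (N + i) \<in> exec z \<rho> (well_founded_com acc fB fR fQ) X
      \<longleftrightarrow> xs ! i \<in> well_founded_part B R Q S"
proof -
  define \<Phi> where "\<Phi> v Y \<longleftrightarrow> xs ! v \<in> S \<and>
    (\<forall>i<N. Bp i Y \<and> (xs ! i, xs ! v) \<in> R \<longrightarrow>
      (\<exists>k<N. (xs ! k, xs ! i) \<in> Q \<and> Suc (N + k) \<in> Y))" for v Y
  let ?L = "well_founded_part B R Q S"
  let ?Y = "exec z \<rho> (well_founded_com acc fB fR fQ) X"
  let ?Z = "X \<union> {Suc (N + i) | i. i < N \<and> xs ! i \<in> ?L}"
  have sat: "sat z (\<rho>(5 := i, 6 := v)) Y (Conj (S_fm acc (Var 6))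
       (All 7 (Imp (Conj (fB (Var 7)) (fR (Var 7) (Var 6)))
         (Ex 8 (Conj (fQ (Var 8) (Var 7)) (second_fm (Var 8))))))) \<longleftrightarrow> \<Phi> v Y" if "v < N" for i v Y
    using \<rho> that by (simp add: \<Phi>_def second_fm_def sat_S fB fR fQ cong: conj_cong) blast
  have val: "val (\<rho>(5 := i, 6 := v)) (Add (Cst 1) (Add (Var 4) (Var 6))) = Suc (N + v)" for i v
    using \<rho> by simp
  note ex = exec_saturate[OF \<rho> sat val, folded well_founded_com_def]
  have low: "Y \<inter> {..N} = X" if "X \<subseteq> Y" "Y \<subseteq> ?Z" for Y
    using that X by auto
  have high: "xs ! i \<in> ?L" if "Y \<subseteq> ?Z" "Suc (N + i) \<in> Y" for i Y
  proof -
    have "Suc (N + i) \<notin> X" using X by auto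
    then show ?thesis using that by auto
  qed
  have sub: "?Y \<subseteq> ?Z"
  proof (rule ex(3))
    fix v Y assume v: "v < N" "X \<subseteq> Y" "Y \<subseteq> ?Z" "\<Phi> v Y"
    note L = high[OF v(3)]
    have "xs ! v \<in> ?L"
    proof (rule well_founded_part.intros)
      show "xs ! v \<in> S" using v(4) unfolding \<Phi>_def by blast
      show "\<forall>b\<in>B. (b, xs ! v) \<in> R \<longrightarrow> (\<exists>c. (c, b) \<in> Q \<and> c \<in> ?L)"
        unfolding ball_nth[OF B_sub] using v(4) L Bp[OF _ low[OF v(2,3)]] unfolding \<Phi>_def by blast
    qed
    then show "Suc (N + v) \<in> ?Z" using v(1) by blast
  qed auto
  then show low': "?Y \<inter> {..N} = X" using low ex(1) by blast
  have "\<forall>v<N. xs ! v = a \<longrightarrow> Suc (N + v) \<in> ?Y" if "a \<in> ?L" for a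
    using that
  proof induction
    case (1 a)
    show ?case
    proof (intro allI impI)
      fix v assume v: "v < N" "xs ! v = a"
      have "\<exists>k<N. (xs ! k, xs ! i) \<in> Q \<and> Suc (N + k) \<in> ?Y"
        if i: "i < N" "Bp i ?Y" "(xs ! i, a) \<in> R" for i
      proof -
        have "xs ! i \<in> B" using Bp[OF i(1) low'] i(2) by blast
        then obtain c where c: "(c, xs ! i) \<in> Q" "c \<in> ?L" "\<forall>v<N. xs ! v = c \<longrightarrow> Suc (N + v) \<in> ?Y"
          using 1(2) i(3) by blast
        then have "c \<in> set xs" using well_founded_part_subset[of B R Q S] S_sub by blast
        then show ?thesis using c by (metis in_set_conv_nth)
      qed
      then have "\<Phi> v ?Y" using 1(1) v unfolding \<Phi>_def by blast
      then show "Suc (N + v) \<in> ?Y" using ex(2) v(1) by blast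
    qed
  qed
  then show "Suc (N + i) \<in> ?Y \<longleftrightarrow> xs ! i \<in> ?L" if "i < N" using that high[OF sub] by blast
qed

lemma accepts_refute: "0 \<notin> X \<Longrightarrow> 0 \<in> exec z \<rho> (refute_com f) X \<longleftrightarrow> \<not> sat z \<rho> X f"
  by (simp add: refute_com_def)

lemma exec_ad: "0 \<in> exec z \<rho> (refute_com (admissible_fm acc)) {} \<longleftrightarrow> \<not> possibly A D C P (ad, True) S"
  by (simp add: accepts_refute sat_admissible possibly_ad[OF AD CP PD])

lemma exec_st: "0 \<in> exec z \<rho> (refute_com (stable_fm acc)) {} \<longleftrightarrow> \<not> possibly A D C P (st, True) S"
  by (simp add: accepts_refute sat_stable possibly_st[OF AD CP PD])

lemma exec_not_ad:
  "0 \<in> exec z \<rho> (refute_com (inadmissible_fm acc)) {} \<longleftrightarrow> \<not> possibly A D C P (ad, False) S"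
  by (simp add: accepts_refute sat_inadmissible possibly_not_ad[OF AD CP PD])

lemma exec_not_st:
  "0 \<in> exec z \<rho> (refute_com (unstable_fm acc)) {} \<longleftrightarrow> \<not> possibly A D C P (st, False) S"
  by (simp add: accepts_refute sat_unstable possibly_not_st[OF AD CP PD])

lemma exec_not_co:
  "0 \<in> exec z \<rho> (refute_com (incomplete_fm acc)) {} \<longleftrightarrow> \<not> possibly A D C P (co, False) S"
  by (simp add: accepts_refute sat_incomplete possibly_not_co[OF AD CP PD])

lemma exec_co: "0 \<in> exec z \<rho> (co_com acc) {} \<longleftrightarrow> \<not> possibly A D C P (co, True) S"
proof -
  have "0 \<notin> exec z \<rho> (doomed_com acc) {}" using exec_doomed(2) by auto
  then show ?thesis
    by (simp add: co_com_def accepts_refute sat_complete exec_doomed(1)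
        possibly_co[OF AD CP PD])
qed

lemma sat_subset_second:
  assumes "\<And>i. i < N \<Longrightarrow> Suc (N + i) \<in> X \<longleftrightarrow> xs ! i \<in> L"
  shows "sat z \<rho> X (subset_fm (S_fm acc) second_fm) \<longleftrightarrow> S \<subseteq> L"
  unfolding subset_eq nth_rules subset_fm_def second_fm_def using \<rho> assms
  by (auto simp: sat_rules)

lemma exec_gr: "0 \<in> exec z \<rho> (gr_com acc) {} \<longleftrightarrow> \<not> possibly A D C P (gr, True) S"
proof -
  let ?K = "doomed D C P S"
  let ?X = "exec z \<rho> (doomed_com acc) {}"
  let ?Y = "exec z \<rho> (well_founded_com acc (\<lambda>i. Conj (A_fm acc i) (first_fm i)) (C_fm acc) (P_fm acc)) ?X"
  note X = exec_doomed
  note wfc = exec_well_founded[where Bp = "\<lambda>i Y. xs ! i \<in> A \<and> Suc i \<in> Y" and B = "A \<inter> ?K"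
    and X = ?X and R = C and Q = P]
  have Bp: "xs ! i \<in> A \<and> Suc i \<in> Y \<longleftrightarrow> xs ! i \<in> A \<inter> ?K" if "i < N" "Y \<inter> {..N} = ?X" for i Y
  proof -
    have "Suc i \<in> Y \<longleftrightarrow> Suc i \<in> Y \<inter> {..N}" using that(1) by simp
    then show ?thesis unfolding that(2) X(1)[OF that(1)] by simp
  qed
  have fB: "sat z r Y (Conj (A_fm acc i) (first_fm i)) \<longleftrightarrow> xs ! val r i \<in> A \<and> Suc (val r i) \<in> Y"
    if "r 4 = N" "val r i < N" for r Y i
    using that by (simp add: sat_A first_fm_def)
  have low: "?Y \<inter> {..N} = ?X"
    by (rule wfc(1)) (rule fB Bp sat_C sat_P X(2) subs(4); assumption)+
  have high: "Suc (N + i) \<in> ?Y \<longleftrightarrow> xs ! i \<in> well_founded_part (A \<inter> ?K) C P S" if "i < N" for i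
    by (rule wfc(2)) (rule fB Bp sat_C sat_P X(2) subs(4) that; assumption)+
  have "Suc i \<in> ?Y \<longleftrightarrow> xs ! i \<in> ?K" if "i < N" for i
  proof -
    have "Suc i \<in> ?Y \<longleftrightarrow> Suc i \<in> ?Y \<inter> {..N}" using that by simp
    then show ?thesis unfolding low X(1)[OF that] .
  qed
  moreover have "0 \<notin> ?Y"
  proof -
    have "0 \<in> ?Y \<longleftrightarrow> 0 \<in> ?Y \<inter> {..N}" by simp
    then show ?thesis unfolding low using X(2) by auto
  qed
  ultimately show ?thesis
    using high by (simp add: gr_com_def accepts_refute sat_complete sat_subset_second
        possibly_gr[OF AD CP PD] can_be_grounded_def)
qed

lemma exec_not_gr: "0 \<in> exec z \<rho> (not_gr_com acc) {} \<longleftrightarrow> \<not> possibly A D C P (gr, False) S"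
proof -
  let ?Y = "exec z \<rho> (well_founded_com acc (D_fm acc) (P_fm acc) (C_fm acc)) {}"
  note wfc = exec_well_founded[where Bp = "\<lambda>i Y. xs ! i \<in> D" and B = D
    and X = "{}" and R = P and Q = C]
  have low: "?Y \<inter> {..N} = {}"
    by (rule wfc(1)) (use D_sub in \<open>auto simp: sat_rules\<close>)
  have "Suc (N + i) \<in> ?Y \<longleftrightarrow> xs ! i \<in> well_founded_part D P C S" if "i < N" for i
    by (rule wfc(2)) (use D_sub that in \<open>auto simp: sat_rules\<close>)
  moreover have "0 \<notin> ?Y" using low by auto
  ultimately show ?thesis
    by (simp add: not_gr_com_def accepts_refute sat_incomplete sat_subset_second
        possibly_not_gr[OF AD CP PD] can_be_ungrounded_def)
qed

end

end


section \<open>Determining the number of arguments\<close>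

definition unary_fm :: "(trm \<Rightarrow> fm) \<Rightarrow> fm" where
  "unary_fm acc = Conj (Neg (acc (Var 4))) (All 5 (acc (Var 5)))"

text \<open>\<open>N\<close> is not given explicitly, so all values below the input length are
  tried; only the position of the first \<open>False\<close> passes \<open>unary_fm\<close>, and a
  single round runs \<open>c\<close>.\<close>

definition decide :: "(trm \<Rightarrow> fm) \<Rightarrow> com \<Rightarrow> com" where
  "decide acc c = For 4 (Var 3) (When (unary_fm acc) c)"

lemma fold_single:
  assumes "distinct vs" "n \<in> set vs"
  shows "fold (\<lambda>i Y. if i = n then h Y else Y) vs X = h X"
proof -
  have id: "fold (\<lambda>i Y. if i = n then h Y else Y) vs X = X" if "n \<notin> set vs" for vs X
    using that by (induction vs) auto
  show ?thesis using assms by (induction vs arbitrary: X) (auto simp: id)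
qed

context coded_instance
begin

sublocale str: coded_structure xs A D S C P z acc
  using AD CP PD D_sub S_sub set_xs dist sat_D sat_A sat_S sat_C sat_P
  by unfold_locales auto

definition \<rho>N :: "nat \<Rightarrow> nat" where
  "\<rho>N = (\<lambda>_. 0)(3 := length z, 4 := length xs)"

lemma \<rho>N_4: "\<rho>N 4 = length xs"
  by (simp add: \<rho>N_def)

lemma sat_unary:
  shows "sat z (\<rho>(4 := m)) X (unary_fm acc) \<longleftrightarrow> m = length xs"
proof
  have lx: "i < length x" if "i \<le> length xs" for i using that length_x by simp
  assume s: "sat z (\<rho>(4 := m)) X (unary_fm acc)"
  have "\<not> m < length xs"
  proof
    assume m: "m < length xs"
    then have "sat z (\<rho>(4 := m)) X (acc (Var 4)) \<longleftrightarrow> x ! m" using lx[of m] by (subst acc) auto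
    then show False using s x_unary(1)[OF m] by (simp add: unary_fm_def)
  qed
  moreover have "\<not> length xs < m"
  proof
    \<comment> \<open>Position \<open>m\<close> may lie outside the code, where \<open>acc\<close>
      is unspecified; the separator at \<open>length xs\<close> refutes \<open>m\<close>
      instead.\<close>
    assume m: "length xs < m"
    have "sat z (\<rho>(4 := m, 5 := length xs)) X (acc (Var 5)) \<longleftrightarrow> x ! length xs"
      using lx[of "length xs"] by (subst acc) auto
    then show False using s m x_unary(2) by (auto simp: unary_fm_def)
  qed
  ultimately show "m = length xs" by simp
next
  have lx: "i < length x" if "i \<le> length xs" for i using that length_x by simp
  assume m: "m = length xs"
  have "sat z (\<rho>(4 := m)) X (acc (Var 4)) \<longleftrightarrow> x ! m" using m lx[of m] by (subst acc) auto
  moreover have "sat z (\<rho>(4 := m, 5 := i)) X (acc (Var 5)) \<longleftrightarrow> x ! i" if "i < m" for i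
    using m that lx[of i] by (subst acc) auto
  ultimately show "sat z (\<rho>(4 := m)) X (unary_fm acc)"
    using m x_unary by (simp add: unary_fm_def)
qed

lemma accepts_decide:
  assumes "length xs < length z"
  shows "accepts (decide acc c) z \<longleftrightarrow> 0 \<in> exec z \<rho>N c {}"
proof -
  let ?\<rho> = "(\<lambda>_ :: nat. 0 :: nat)(3 := length z)"
  have "exec z ?\<rho> (decide acc c) {} =
      fold (\<lambda>i Y. if i = length xs then exec z \<rho>N c Y else Y) (rev [0..<length z]) {}"
    unfolding decide_def exec.simps sat_unary
    by (intro fold_cong ext) (auto simp: \<rho>N_def)
  also have "\<dots> = exec z \<rho>N c {}" by (rule fold_single) (use assms in auto)
  finally show ?thesis unfolding accepts_def by simp
qed

end

lemma valid_coded_instance: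
  assumes "valid_input j xs I S e"
    and "\<And>\<rho> X t. val \<rho> t < length (encode xs I S act e) \<Longrightarrow>
      sat z \<rho> X (acc t) \<longleftrightarrow> encode xs I S act e ! val \<rho> t"
  shows "coded_instance xs I S act e (encode xs I S act e) z acc"
  using assms unfolding valid_input_def by unfold_locales auto

lemma STRONG_RELEVANCE_promise:
  assumes "X \<in> K"
    and "\<And>xs I S act e. valid_input j xs I S e \<Longrightarrow> encode xs I S act e \<in> X \<longleftrightarrow> strongly_relevant j I S act e"
  shows "STRONG_RELEVANCE j \<in> promise K"
  unfolding promise_def STRONG_RELEVANCE_def using assms(2) by (auto intro!: bexI[OF _ assms(1)])

lemma STRONG_RELEVANCE_in_P:
  fixes j :: "'a status"
  assumes wfc: "wf_com 4 (decide Bit c)"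
    and c: "\<And>(xs :: 'a list) A D S C P z \<rho>. coded_structure xs A D S C P z Bit \<Longrightarrow> \<rho> 4 = length xs \<Longrightarrow>
      0 \<in> exec z \<rho> c {} \<longleftrightarrow> \<not> possibly A D C P j S"
  shows "STRONG_RELEVANCE j \<in> promise class_P"
proof -
  have "accepts (decide Bit c) (encode xs I S act e) \<longleftrightarrow> strongly_relevant j I S act e"
    if v: "valid_input j xs I S e" for xs I S act and e :: "'a element"
  proof -
    let ?x = "encode xs I S act e"
    interpret coded_instance xs I S act e ?x ?x Bit
      by (rule valid_coded_instance[OF v]) simp
    have "accepts (decide Bit c) ?x \<longleftrightarrow> \<not> possibly A D C P j S"
      using c[OF str.coded_structure_axioms, of \<rho>N] \<rho>N_4 length_x by (simp add: accepts_decide)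
    also have "\<dots> \<longleftrightarrow> strongly_relevant j I S act e"
      using strongly_relevant_iff[OF wf e refl] by simp
    finally show ?thesis .
  qed
  then show ?thesis by (intro STRONG_RELEVANCE_promise[OF accepts_in_P[OF wfc]]) simp
qed

lemmas instance_fm_defs = decide_def unary_fm_def refute_com_def
  admissible_fm_def stable_fm_def complete_fm_def inadmissible_fm_def unstable_fm_def incomplete_fm_def
  doomed_com_def well_founded_com_def saturate_def co_com_def gr_com_def not_gr_com_def
  subset_fm_def conflict_fm_def first_fm_def second_fm_def
  D_fm_def A_fm_def S_fm_def C_fm_def P_fm_def act_bit_def arg_bit_def att_bit_def pair_index_def

lemma tractable_statuses:
  assumes "j \<in> {ad :: 'a semantics, st, co, gr} \<times> {True, False}"
  shows "STRONG_RELEVANCE j \<in> promise class_P"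
proof -
  have "STRONG_RELEVANCE (ad :: 'a semantics, True) \<in> promise class_P"
    by (rule STRONG_RELEVANCE_in_P[where c = "refute_com (admissible_fm Bit)"])
      (simp add: instance_fm_defs, rule coded_structure.exec_ad)
  moreover have "STRONG_RELEVANCE (st :: 'a semantics, True) \<in> promise class_P"
    by (rule STRONG_RELEVANCE_in_P[where c = "refute_com (stable_fm Bit)"])
      (simp add: instance_fm_defs, rule coded_structure.exec_st)
  moreover have "STRONG_RELEVANCE (co :: 'a semantics, True) \<in> promise class_P"
    by (rule STRONG_RELEVANCE_in_P[where c = "co_com Bit"])
      (simp add: instance_fm_defs, rule coded_structure.exec_co)
  moreover have "STRONG_RELEVANCE (gr :: 'a semantics, True) \<in> promise class_P"
    by (rule STRONG_RELEVANCE_in_P[where c = "gr_com Bit"])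
      (simp add: instance_fm_defs, rule coded_structure.exec_gr)
  moreover have "STRONG_RELEVANCE (ad :: 'a semantics, False) \<in> promise class_P"
    by (rule STRONG_RELEVANCE_in_P[where c = "refute_com (inadmissible_fm Bit)"])
      (simp add: instance_fm_defs, rule coded_structure.exec_not_ad)
  moreover have "STRONG_RELEVANCE (st :: 'a semantics, False) \<in> promise class_P"
    by (rule STRONG_RELEVANCE_in_P[where c = "refute_com (unstable_fm Bit)"])
      (simp add: instance_fm_defs, rule coded_structure.exec_not_st)
  moreover have "STRONG_RELEVANCE (co :: 'a semantics, False) \<in> promise class_P"
    by (rule STRONG_RELEVANCE_in_P[where c = "refute_com (incomplete_fm Bit)"])
      (simp add: instance_fm_defs, rule coded_structure.exec_not_co)
  moreover have "STRONG_RELEVANCE (gr :: 'a semantics, False) \<in> promise class_P"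
    by (rule STRONG_RELEVANCE_in_P[where c = "not_gr_com Bit"])
      (simp add: instance_fm_defs, rule coded_structure.exec_not_gr)
  ultimately show ?thesis using assms by auto
qed


section \<open>Completions and candidate sets as certificates\<close>

section \<open>Preferred sets\<close>

text \<open>One kind of witness serves both failures: if \<open>S\<close> is not admissible, any
  \<open>T\<close> will do. The inclusion makes \<open>T\<close> codable by one bit per
  argument.\<close>

lemma not_pr_witness:
  assumes "S \<notin> pr F"
  shows "\<exists>T. (S \<notin> ad F \<or> T \<in> ad F \<and> S \<subset> T) \<and> T \<subseteq> arguments F"
proof (cases "S \<in> ad F")
  case True
  then obtain T where T: "T \<in> ad F" "S \<subset> T" using assms unfolding pr_iff by blast
  then have "T \<subseteq> arguments F" unfolding ad_iff by (elim conjE)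
  then show ?thesis using T by blast
qed auto

definition has_bit :: "bool list \<Rightarrow> nat \<Rightarrow> bool" where
  "has_bit u k \<longleftrightarrow> k < length u \<and> u ! k"

text \<open>In the following, \<open>ub\<close> gives access to a string that codes a choice of uncertain arguments and attacks.\<close>

definition U_fm :: "(trm \<Rightarrow> fm) \<Rightarrow> (trm \<Rightarrow> fm) \<Rightarrow> trm \<Rightarrow> fm" where
  "U_fm acc ub i = Conj (D_fm acc i) (Disj (A_fm acc i) (ub i))"

definition R_fm :: "(trm \<Rightarrow> fm) \<Rightarrow> (trm \<Rightarrow> fm) \<Rightarrow> trm \<Rightarrow> trm \<Rightarrow> fm" where
  "R_fm acc ub i j = Conj (Conj (P_fm acc i j) (Conj (U_fm acc ub i) (U_fm acc ub j)))
     (Disj (C_fm acc i j) (ub (Add (Var 4) (pair_index i j))))"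

definition ad_fm :: "(trm \<Rightarrow> fm) \<Rightarrow> (trm \<Rightarrow> fm) \<Rightarrow> (trm \<Rightarrow> fm) \<Rightarrow> fm" where
  "ad_fm acc ub t = Conj (Conj (subset_fm t (U_fm acc ub)) (Neg (conflict_fm t (R_fm acc ub))))
     (All 5 (All 6 (Imp (Conj (t (Var 5)) (R_fm acc ub (Var 6) (Var 5)))
       (Ex 7 (Conj (t (Var 7)) (R_fm acc ub (Var 7) (Var 6)))))))"

definition not_pr_fm :: "(trm \<Rightarrow> fm) \<Rightarrow> (trm \<Rightarrow> fm) \<Rightarrow> (trm \<Rightarrow> fm) \<Rightarrow> fm" where
  "not_pr_fm acc ub tb = Disj (Neg (ad_fm acc ub (S_fm acc)))
     (Conj (ad_fm acc ub tb)
       (Conj (subset_fm (S_fm acc) tb) (Neg (subset_fm tb (S_fm acc)))))"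

context coded_structure
begin

text \<open>Certain elements are forced, impossible ones excluded, and missing bits read as absent,
  so every string decodes to a completion.\<close>

definition chosen_af :: "bool list \<Rightarrow> 'a af" where
  "chosen_af u = (let U = {xs ! i | i. i < N \<and> xs ! i \<in> D \<and> (xs ! i \<in> A \<or> has_bit u i)}
     in \<lparr>arguments = U, attacks = {(xs ! i, xs ! j) | i j. i < N \<and> j < N \<and> (xs ! i, xs ! j) \<in> P \<and>
       xs ! i \<in> U \<and> xs ! j \<in> U \<and> ((xs ! i, xs ! j) \<in> C \<or> has_bit u (N + (i * N + j)))}\<rparr>)"

lemma nth_inj: "i < N \<Longrightarrow> j < N \<Longrightarrow> xs ! i = xs ! j \<longleftrightarrow> i = j"
  using dist by (simp add: nth_eq_iff_index_eq)

lemma chosen_arguments: "i < N \<Longrightarrow>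
    xs ! i \<in> arguments (chosen_af u) \<longleftrightarrow> xs ! i \<in> D \<and> (xs ! i \<in> A \<or> has_bit u i)"
  unfolding chosen_af_def Let_def by (auto simp: nth_inj)

lemma chosen_attacks: "i < N \<Longrightarrow> j < N \<Longrightarrow> (xs ! i, xs ! j) \<in> attacks (chosen_af u) \<longleftrightarrow>
    (xs ! i, xs ! j) \<in> P \<and> xs ! i \<in> arguments (chosen_af u) \<and> xs ! j \<in> arguments (chosen_af u) \<and>
    ((xs ! i, xs ! j) \<in> C \<or> has_bit u (N + (i * N + j)))"
  unfolding chosen_af_def Let_def by (auto simp: nth_inj)

lemma chosen_sub: "arguments (chosen_af u) \<subseteq> set xs"
    "attacks (chosen_af u) \<subseteq> arguments (chosen_af u) \<times> arguments (chosen_af u)"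
  unfolding chosen_af_def Let_def by auto

lemma index_ex: "a \<in> set xs \<Longrightarrow> \<exists>i<N. a = xs ! i"
  by (auto simp: in_set_conv_nth)

lemma chosen_between: "chosen_af u \<in> afs_between A D C P"
proof -
  have 1: "A \<subseteq> arguments (chosen_af u)"
  proof
    fix a assume a: "a \<in> A"
    then obtain i where "i < N" "a = xs ! i" using AD D_sub index_ex[of a] by blast
    then show "a \<in> arguments (chosen_af u)" using a AD chosen_arguments[of i u] by blast
  qed
  have 2: "arguments (chosen_af u) \<subseteq> D" unfolding chosen_af_def Let_def by auto
  have 3: "attacks (chosen_af u) \<subseteq> P" unfolding chosen_af_def Let_def by auto
  have "(a, b) \<in> attacks (chosen_af u)"
    if ab: "(a, b) \<in> C" "a \<in> arguments (chosen_af u)" "b \<in> arguments (chosen_af u)" for a b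
  proof -
    obtain i j where "i < N" "j < N" "a = xs ! i" "b = xs ! j"
      using ab chosen_sub(1)[of u] index_ex[of a] index_ex[of b] by blast
    then show ?thesis using ab CP chosen_attacks[of i j u] by blast
  qed
  then show ?thesis using 1 2 3 chosen_sub(2) unfolding afs_between_def by auto
qed

definition choice_code :: "'a af \<Rightarrow> bool list" where
  "choice_code F = map (\<lambda>a. a \<in> arguments F) xs @ map (\<lambda>r. r \<in> attacks F) (List.product xs xs)"

lemma length_choice_code: "length (choice_code F) = N + N * N"
  by (simp add: choice_code_def)

text \<open>The suffix \<open>v\<close> leaves room for a candidate set behind the completion in the
  same certificate.\<close>

lemma chosen_choice_code:
  assumes F: "F \<in> afs_between A D C P"
  shows "chosen_af (choice_code F @ v) = F"
proof -
  let ?u = "choice_code F @ v"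
  note F' = afs_betweenD[OF F]
  have b1: "has_bit ?u i \<longleftrightarrow> xs ! i \<in> arguments F" if "i < N" for i
    using that by (simp add: has_bit_def choice_code_def nth_append)
  have b2: "has_bit ?u (N + (i * N + j)) \<longleftrightarrow> (xs ! i, xs ! j) \<in> attacks F" if "i < N" "j < N" for i j
  proof -
    note nth_product_self[OF that]
    then show ?thesis using index_less[OF that] by (simp add: has_bit_def choice_code_def nth_append)
  qed
  have args: "arguments (chosen_af ?u) = arguments F"
  proof (intro equalityI subsetI)
    fix a assume a: "a \<in> arguments (chosen_af ?u)"
    then obtain i where i: "i < N" "a = xs ! i" using chosen_sub(1)[of ?u] index_ex[of a] by blast
    then show "a \<in> arguments F" using a chosen_arguments[of i ?u] b1[of i] F'(1) by blast
  next
    fix a assume a: "a \<in> arguments F"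
    then obtain i where i: "i < N" "a = xs ! i" using F'(2) D_sub index_ex[of a] by blast
    then show "a \<in> arguments (chosen_af ?u)" using a chosen_arguments[of i ?u] b1[of i] F'(2) by blast
  qed
  have "attacks (chosen_af ?u) = attacks F"
  proof (intro equalityI subrelI)
    fix a b assume ab: "(a, b) \<in> attacks (chosen_af ?u)"
    then obtain i j where ij: "i < N" "j < N" "a = xs ! i" "b = xs ! j"
      using chosen_sub[of ?u] index_ex[of a] index_ex[of b] by blast
    then have "a \<in> arguments F" "b \<in> arguments F" "(a, b) \<in> C \<or> (a, b) \<in> attacks F"
      using ab chosen_attacks[OF ij(1,2)] b2[OF ij(1,2)] args by auto
    then show "(a, b) \<in> attacks F" using F'(3) by blast
  next
    fix a b assume ab: "(a, b) \<in> attacks F"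
    then obtain i j where ij: "i < N" "j < N" "a = xs ! i" "b = xs ! j"
      using F'(2) F'(4)[OF ab] D_sub index_ex[of a] index_ex[of b] by blast
    then show "(a, b) \<in> attacks (chosen_af ?u)"
      using ab F'(4)[OF ab] chosen_attacks[OF ij(1,2)] b2[OF ij(1,2)] args by auto
  qed
  with args show ?thesis by (intro af.equality) auto
qed

text \<open>The exact length is prescribed because the position of an inner certificate depends on
  it.\<close>

lemma possibly_pr_iff:
  "possibly A D C P (pr, b) S \<longleftrightarrow>
     (\<exists>u. length u = N + N * N \<and> (S \<in> pr (chosen_af u) \<longleftrightarrow> b))"
proof
  assume "possibly A D C P (pr, b) S"
  then obtain F where F: "F \<in> afs_between A D C P" "S \<in> pr F \<longleftrightarrow> b"
    unfolding possibly_def has_status_def by (cases b) auto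
  then have "S \<in> pr (chosen_af (choice_code F)) \<longleftrightarrow> b" using chosen_choice_code[OF F(1), of "[]"] by simp
  then show "\<exists>u. length u = N + N * N \<and> (S \<in> pr (chosen_af u) \<longleftrightarrow> b)"
    using length_choice_code by blast
next
  assume "\<exists>u. length u = N + N * N \<and> (S \<in> pr (chosen_af u) \<longleftrightarrow> b)"
  then show "possibly A D C P (pr, b) S"
    using chosen_between unfolding possibly_def has_status_def by (cases b) auto
qed

context
  fixes ub :: "trm \<Rightarrow> fm" and u :: "bool list"
  assumes ub: "\<And>\<rho> X t. \<rho> 4 = N \<Longrightarrow> val \<rho> t < N + N * N \<Longrightarrow> sat z \<rho> X (ub t) \<longleftrightarrow> has_bit u (val \<rho> t)"
begin

lemma sat_U: "\<rho> 4 = N \<Longrightarrow> val \<rho> i < N \<Longrightarrow>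
    sat z \<rho> X (U_fm acc ub i) \<longleftrightarrow> xs ! val \<rho> i \<in> arguments (chosen_af u)"
  by (simp add: U_fm_def sat_D sat_A ub chosen_arguments)

lemma sat_R: "\<rho> 4 = N \<Longrightarrow> val \<rho> i < N \<Longrightarrow> val \<rho> j < N \<Longrightarrow>
    sat z \<rho> X (R_fm acc ub i j) \<longleftrightarrow> (xs ! val \<rho> i, xs ! val \<rho> j) \<in> attacks (chosen_af u)"
  using index_less[of "val \<rho> i" N "val \<rho> j"]
  by (simp add: R_fm_def sat_P sat_C sat_U ub chosen_attacks pair_index_def)

lemma sat_ad:
  assumes \<rho>: "\<rho> 4 = N" and T: "T \<subseteq> set xs"
    and t: "\<And>\<rho> X i. \<rho> 4 = N \<Longrightarrow> val \<rho> i < N \<Longrightarrow> sat z \<rho> X (t i) \<longleftrightarrow> xs ! val \<rho> i \<in> T"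
  shows "sat z \<rho> X (ad_fm acc ub t) \<longleftrightarrow> T \<in> ad (chosen_af u)"
proof -
  let ?F = "chosen_af u"
  have "sat z \<rho> X (ad_fm acc ub t) \<longleftrightarrow> (\<forall>i<N. xs ! i \<in> T \<longrightarrow> xs ! i \<in> arguments ?F) \<and>
    \<not> (\<exists>i<N. \<exists>j<N. (xs ! i \<in> T \<and> xs ! j \<in> T) \<and> (xs ! i, xs ! j) \<in> attacks ?F) \<and>
    (\<forall>i<N. \<forall>j<N. xs ! i \<in> T \<and> (xs ! j, xs ! i) \<in> attacks ?F \<longrightarrow>
      (\<exists>k<N. xs ! k \<in> T \<and> (xs ! k, xs ! j) \<in> attacks ?F))"
    using \<rho> by (simp add: ad_fm_def subset_fm_def conflict_fm_def t sat_U sat_R cong: conj_cong) blast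
  also have "\<dots> \<longleftrightarrow> (\<forall>a\<in>T. a \<in> arguments ?F) \<and> \<not> (\<exists>a\<in>T. \<exists>b\<in>T. (a, b) \<in> attacks ?F) \<and>
    (\<forall>a\<in>T. \<forall>b\<in>set xs. (b, a) \<in> attacks ?F \<longrightarrow> (\<exists>c\<in>T. (c, b) \<in> attacks ?F))"
    unfolding ball_nth[OF T] bex_nth[OF T] ball_nth[OF subset_refl] by auto
  also have "\<dots> \<longleftrightarrow> T \<in> ad ?F"
    unfolding ad_iff using chosen_sub[of u] by blast
  finally show ?thesis .
qed

lemma sat_not_pr:
  assumes \<rho>: "\<rho> 4 = N" and T: "T \<subseteq> set xs"
    and tb: "\<And>\<rho> X i. \<rho> 4 = N \<Longrightarrow> val \<rho> i < N \<Longrightarrow> sat z \<rho> X (tb i) \<longleftrightarrow> xs ! val \<rho> i \<in> T"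
  shows "sat z \<rho> X (not_pr_fm acc ub tb) \<longleftrightarrow>
    S \<notin> ad (chosen_af u) \<or> T \<in> ad (chosen_af u) \<and> S \<subset> T"
proof -
  have "sat z \<rho> X (subset_fm (S_fm acc) tb) \<longleftrightarrow> (\<forall>a\<in>S. a \<in> T)"
    unfolding ball_nth[OF S_sub] subset_fm_def using \<rho> by (simp add: sat_S tb cong: conj_cong) blast
  moreover have "sat z \<rho> X (subset_fm tb (S_fm acc)) \<longleftrightarrow> (\<forall>a\<in>T. a \<in> S)"
    unfolding ball_nth[OF T] subset_fm_def using \<rho> by (simp add: sat_S tb cong: conj_cong) blast
  moreover have "sat z \<rho> X (ad_fm acc ub (S_fm acc)) \<longleftrightarrow> S \<in> ad (chosen_af u)"
    using \<rho> S_sub by (rule sat_ad) (rule sat_S)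
  moreover have "sat z \<rho> X (ad_fm acc ub tb) \<longleftrightarrow> T \<in> ad (chosen_af u)"
    using \<rho> T by (rule sat_ad) (rule tb)
  ultimately show ?thesis unfolding not_pr_fm_def sat.simps by blast
qed

end

definition chosen_set :: "(nat \<Rightarrow> bool) \<Rightarrow> 'a set" where
  "chosen_set f = {xs ! i | i. i < N \<and> f i}"

lemma chosen_set_nth: "i < N \<Longrightarrow> xs ! i \<in> chosen_set f \<longleftrightarrow> f i"
  unfolding chosen_set_def by (auto simp: nth_inj)

lemma chosen_set_sub: "chosen_set f \<subseteq> set xs"
  unfolding chosen_set_def by auto

lemma chosen_set_eq: "T \<subseteq> set xs \<Longrightarrow> (\<And>i. i < N \<Longrightarrow> f i \<longleftrightarrow> xs ! i \<in> T) \<Longrightarrow> chosen_set f = T"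
  unfolding chosen_set_def by (auto simp: in_set_conv_nth subset_iff)

end


subsection \<open>Pairs of strings\<close>

lemma length_pair: "length (pair x u) = 2 * length x + 1 + length u"
  unfolding pair_def by (induction x) auto

lemma nth_pair_even: "i < length x \<Longrightarrow> pair x u ! (2 * i)"
  and nth_pair_odd: "i < length x \<Longrightarrow> pair x u ! (2 * i + 1) = x ! i"
proof (induction x arbitrary: i)
  case (Cons b x)
  { case 1 then show ?case using Cons.IH(1) by (cases i) (auto simp: pair_def) }
  { case 2 then show ?case using Cons.IH(2) by (cases i) (auto simp: pair_def) }
qed auto

lemma nth_pair_end: "\<not> pair x u ! (2 * length x)"
  unfolding pair_def by (induction x) auto

lemma nth_pair_snd: "pair x u ! (2 * length x + 1 + k) = u ! k"
  unfolding pair_def by (induction x) auto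

lemma has_bit_pair_end: "\<not> has_bit (pair x u) (2 * length x)"
  by (simp add: has_bit_def nth_pair_end)

lemma has_bit_pair_even: "i < length x \<Longrightarrow> has_bit (pair x u) (2 * i)"
  by (simp add: has_bit_def nth_pair_even length_pair)

lemma has_bit_pair_odd: "i < length x \<Longrightarrow> has_bit (pair x u) (2 * i + 1) \<longleftrightarrow> has_bit x i"
  using nth_pair_odd[of i x u] by (simp add: has_bit_def length_pair)

lemma has_bit_pair_snd: "has_bit (pair x u) (2 * length x + 1 + k) \<longleftrightarrow> has_bit u k"
  using nth_pair_snd[of x u k] by (simp add: has_bit_def length_pair)

lemma sat_Bit: "sat z \<rho> X (Bit t) \<longleftrightarrow> has_bit z (val \<rho> t)"
  by (simp add: has_bit_def)

text \<open>The length of the instance code, from which the position of a certificate is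
  computed.\<close>

definition length_trm :: trm where
  "length_trm = Add (Add (Var 4) (Cst 2)) (Mul (Cst 3) (Add (Var 4) (Mul (Var 4) (Var 4))))"


subsection \<open>A verifier for non-preferred sets\<close>

text \<open>The certificate is a completion followed by a candidate for a larger admissible set.\<close>

definition pair_bit :: "trm \<Rightarrow> fm" where
  "pair_bit t = Bit (Add (Mul (Cst 2) t) (Cst 1))"

definition pair_choice :: "trm \<Rightarrow> fm" where
  "pair_choice t = Bit (Add (Add (Mul (Cst 2) length_trm) (Cst 1)) t)"

definition pair_set :: "trm \<Rightarrow> fm" where
  "pair_set t = pair_choice (Add (Add (Var 4) (Mul (Var 4) (Var 4))) t)"

definition not_pr_com :: com where
  "not_pr_com = decide pair_bit (When (not_pr_fm pair_bit pair_choice pair_set) (Ins (Cst 0)))"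

lemma wf_not_pr_com: "wf_com 4 not_pr_com"
  by (simp add: not_pr_com_def not_pr_fm_def ad_fm_def R_fm_def U_fm_def pair_set_def pair_choice_def
      pair_bit_def length_trm_def instance_fm_defs)

text \<open>A certificate takes \<open>N + N * N\<close> bits for the completion and
  \<open>N\<close> for the set, at most the length of the code, so the identity serves as the length
  polynomial.\<close>

lemma not_pr_com_verifies:
  assumes valid: "valid_input j xs I S e" and x: "x = encode xs I S act e" and J: "J = changed I act e"
  shows "(\<exists>u. length u \<le> length x \<and> accepts not_pr_com (pair x u)) \<longleftrightarrow>
    possibly (cargs J) (cargs J \<union> uargs J) (catts J) (catts J \<union> uatts J) (pr, False) S"
proof -
  have inst: "coded_instance xs I S act e x (pair x u) pair_bit" for u
    unfolding x by (rule valid_coded_instance[OF valid])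
      (use has_bit_pair_odd in \<open>auto simp: pair_bit_def sat_Bit has_bit_def simp del: sat.simps\<close>)
  \<comment> \<open>The decoded framework and set do not depend on the tape string, so an
    interpretation at an empty certificate names them for every \<open>u\<close>.\<close>
  interpret base: coded_instance xs I S act e x "pair x []" pair_bit
    by (rule inst)
  let ?N = "length xs"
  let ?af = base.str.chosen_af
  let ?T = "\<lambda>u. base.str.chosen_set (\<lambda>i. has_bit u (?N + ?N * ?N + i))"
  have acc: "accepts not_pr_com (pair x u) \<longleftrightarrow> S \<notin> ad (?af u) \<or> ?T u \<in> ad (?af u) \<and> S \<subset> ?T u" for u
  proof -
    interpret u: coded_instance xs I S act e x "pair x u" pair_bit by (rule inst)
    have choice: "sat (pair x u) \<rho> X (pair_choice t) \<longleftrightarrow> has_bit u (val \<rho> t)"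
      if "\<rho> 4 = ?N" for \<rho> X t
      using has_bit_pair_snd[of x u "val \<rho> t"] that base.length_x
      by (simp add: pair_choice_def sat_Bit length_trm_def del: sat.simps)
    have set: "sat (pair x u) \<rho> X (pair_set t) \<longleftrightarrow> xs ! val \<rho> t \<in> ?T u"
      if "\<rho> 4 = ?N" "val \<rho> t < ?N" for \<rho> X t
      using that by (simp add: pair_set_def choice base.str.chosen_set_nth)
    have "accepts not_pr_com (pair x u) \<longleftrightarrow>
        sat (pair x u) u.\<rho>N {} (not_pr_fm pair_bit pair_choice pair_set)"
      using base.length_x by (simp add: not_pr_com_def u.accepts_decide length_pair)
    also have "\<dots> \<longleftrightarrow> S \<notin> ad (?af u) \<or> ?T u \<in> ad (?af u) \<and> S \<subset> ?T u"
      by (rule u.str.sat_not_pr) (rule choice set u.\<rho>N_4 base.str.chosen_set_sub; assumption)+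
    finally show ?thesis .
  qed
  show ?thesis unfolding J
  proof
    assume "\<exists>u. length u \<le> length x \<and> accepts not_pr_com (pair x u)"
    then obtain u where "S \<notin> pr (?af u)" unfolding acc pr_iff by blast
    then show "possibly base.A base.D base.C base.P (pr, False) S"
      using base.str.chosen_between unfolding possibly_def has_status_def by auto
  next
    assume "possibly base.A base.D base.C base.P (pr, False) S"
    then obtain F where F: "F \<in> afs_between base.A base.D base.C base.P" "S \<notin> pr F"
      unfolding possibly_def has_status_def by auto
    from not_pr_witness[OF F(2)] obtain T
      where "(S \<notin> ad F \<or> T \<in> ad F \<and> S \<subset> T) \<and> T \<subseteq> arguments F" by (rule exE)
    note T = conjunct1[OF this] conjunct2[OF this]
    let ?u = "base.str.choice_code F @ map (\<lambda>a. a \<in> T) xs"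
    have "T \<subseteq> set xs" using T(2) afs_betweenD(2)[OF F(1)] base.D_sub by blast
    then have "?T ?u = T"
      by (rule base.str.chosen_set_eq) (auto simp: has_bit_def base.str.length_choice_code nth_append)
    then have "accepts not_pr_com (pair x ?u)"
      unfolding acc base.str.chosen_choice_code[OF F(1)] using T(1) by simp
    moreover have "length ?u \<le> length x"
      by (simp add: base.str.length_choice_code base.length_x)
    ultimately show "\<exists>u. length u \<le> length x \<and> accepts not_pr_com (pair x u)" by blast
  qed
qed


subsection \<open>A verifier for preferred sets\<close>

text \<open>
  The outer certificate \<open>u\<close> is a completion and the inner one a candidate for a larger admissible set.
  The position of the latter depends on the length of \<open>u\<close>, so the program first checks that this
  length is as expected, and otherwise accepts.
\<close>

definition pair2_bit :: "trm \<Rightarrow> fm" where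
  "pair2_bit t = Bit (Add (Mul (Cst 2) (Add (Mul (Cst 2) t) (Cst 1))) (Cst 1))"

definition pair2_choice :: "trm \<Rightarrow> fm" where
  "pair2_choice t = Bit (Add (Mul (Cst 2) (Add (Add (Mul (Cst 2) length_trm) (Cst 1)) t)) (Cst 1))"

definition outer_length :: trm where
  "outer_length = Add (Add (Mul (Cst 2) length_trm) (Cst 1)) (Add (Var 4) (Mul (Var 4) (Var 4)))"

definition pair2_set :: "trm \<Rightarrow> fm" where
  "pair2_set t = Bit (Add (Add (Mul (Cst 2) outer_length) (Cst 1)) t)"

text \<open>In a pair the even positions carry \<open>True\<close> up to the separator, the first
  \<open>False\<close> among them. Finding it at twice \<open>outer_length\<close> fixes the length
  of the first component \<open>pair x u\<close>, hence that of \<open>u\<close>.\<close>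

definition length_fm :: fm where
  "length_fm = Conj (Neg (Bit (Mul (Cst 2) outer_length)))
     (Neg (Exi 5 outer_length (Neg (Bit (Mul (Cst 2) (Var 5))))))"

definition pr_com :: com where
  "pr_com = decide pair2_bit
     (When (Disj (Neg length_fm) (not_pr_fm pair2_bit pair2_choice pair2_set)) (Ins (Cst 0)))"

lemma wf_pr_com: "wf_com 4 pr_com"
  by (simp add: pr_com_def not_pr_fm_def ad_fm_def R_fm_def U_fm_def pair2_set_def pair2_choice_def
      pair2_bit_def length_trm_def outer_length_def length_fm_def instance_fm_defs)

text \<open>If \<open>u\<close> has the wrong length, every inner certificate is accepted, so such a
  \<open>u\<close> never counts. Otherwise some inner certificate is accepted iff \<open>S\<close>
  is not preferred in the completion chosen by \<open>u\<close>.\<close>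

lemma pr_com_verifies:
  assumes valid: "valid_input j xs I S e" and x: "x = encode xs I S act e" and J: "J = changed I act e"
  shows "(\<exists>u. length u \<le> length x \<and>
      \<not> (\<exists>v. length v \<le> length (pair x u) \<and> accepts pr_com (pair (pair x u) v))) \<longleftrightarrow>
    possibly (cargs J) (cargs J \<union> uargs J) (catts J) (catts J \<union> uatts J) (pr, True) S"
proof -
  have inst: "coded_instance xs I S act e x (pair (pair x u) v) pair2_bit" for u v
    unfolding x
  proof (rule valid_coded_instance[OF valid])
    fix \<rho> X t assume t: "val \<rho> t < length (encode xs I S act e)"
    then show "sat (pair (pair (encode xs I S act e) u) v) \<rho> X (pair2_bit t) \<longleftrightarrow>
        encode xs I S act e ! val \<rho> t"
      using has_bit_pair_odd[of "2 * val \<rho> t + 1" "pair (encode xs I S act e) u" v]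
        has_bit_pair_odd[OF t, of u]
      by (simp add: pair2_bit_def sat_Bit length_pair del: sat.simps) (simp add: has_bit_def)
  qed
  interpret base: coded_instance xs I S act e x "pair (pair x []) []" pair2_bit
    by (rule inst)
  let ?N = "length xs"
  let ?af = base.str.chosen_af
  let ?T = "\<lambda>v. base.str.chosen_set (has_bit v)"
  have acc: "accepts pr_com (pair (pair x u) v) \<longleftrightarrow>
      \<not> (length u = ?N + ?N * ?N \<and> \<not> (S \<notin> ad (?af u) \<or> ?T v \<in> ad (?af u) \<and> S \<subset> ?T v))" for u v
  proof -
    let ?w = "pair x u"
    let ?E = "2 * length x + 1 + (?N + ?N * ?N)"
    interpret u: coded_instance xs I S act e x "pair ?w v" pair2_bit by (rule inst)
    have outer: "val u.\<rho>N outer_length = ?E"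
      using u.\<rho>N_4 base.length_x by (simp add: outer_length_def length_trm_def)
    have "sat (pair ?w v) u.\<rho>N {} length_fm \<longleftrightarrow>
        \<not> has_bit (pair ?w v) (2 * ?E) \<and> (\<forall>i<?E. has_bit (pair ?w v) (2 * i))"
      unfolding length_fm_def sat.simps(3-5) sat_Bit val.simps outer by auto
    also have "\<dots> \<longleftrightarrow> length ?w = ?E"
      using has_bit_pair_end[of ?w v] has_bit_pair_even[of _ ?w v]
      by (metis linorder_neqE_nat)
    finally have len: "sat (pair ?w v) u.\<rho>N {} length_fm \<longleftrightarrow> length u = ?N + ?N * ?N"
      by (simp add: length_pair)
    have "sat (pair ?w v) u.\<rho>N {} (not_pr_fm pair2_bit pair2_choice pair2_set) \<longleftrightarrow>
        S \<notin> ad (?af u) \<or> ?T v \<in> ad (?af u) \<and> S \<subset> ?T v" if lu: "length u = ?N + ?N * ?N"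
    proof (rule u.str.sat_not_pr)
      show "u.\<rho>N 4 = ?N" by (rule u.\<rho>N_4)
      show "?T v \<subseteq> set xs" by (rule base.str.chosen_set_sub)
    next
      fix \<rho> X t assume t: "\<rho> 4 = ?N" "val \<rho> t < ?N + ?N * ?N"
      then have "2 * length x + 1 + val \<rho> t < length ?w" using lu by (simp add: length_pair)
      from has_bit_pair_odd[OF this, of v]
      show "sat (pair ?w v) \<rho> X (pair2_choice t) \<longleftrightarrow> has_bit u (val \<rho> t)"
        using has_bit_pair_snd[of x u "val \<rho> t"] t base.length_x
        by (simp add: pair2_choice_def sat_Bit length_trm_def del: sat.simps)
    next
      fix \<rho> X i assume i: "\<rho> 4 = ?N" "val \<rho> i < ?N"
      then show "sat (pair ?w v) \<rho> X (pair2_set i) \<longleftrightarrow> xs ! val \<rho> i \<in> ?T v"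
        using has_bit_pair_snd[of ?w v "val \<rho> i"] lu base.length_x
        by (simp add: pair2_set_def sat_Bit length_trm_def outer_length_def length_pair
            base.str.chosen_set_nth del: sat.simps)
    qed
    moreover have "accepts pr_com (pair ?w v) \<longleftrightarrow> \<not> sat (pair ?w v) u.\<rho>N {} length_fm \<or>
        sat (pair ?w v) u.\<rho>N {} (not_pr_fm pair2_bit pair2_choice pair2_set)"
      using base.length_x by (simp add: pr_com_def u.accepts_decide length_pair)
    ultimately show ?thesis using len by blast
  qed
  have inner: "(\<exists>v. length v \<le> length (pair x u) \<and> accepts pr_com (pair (pair x u) v)) \<longleftrightarrow>
      \<not> (length u = ?N + ?N * ?N \<and> S \<in> pr (?af u))" for u
  proof
    assume "\<exists>v. length v \<le> length (pair x u) \<and> accepts pr_com (pair (pair x u) v)"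
    then show "\<not> (length u = ?N + ?N * ?N \<and> S \<in> pr (?af u))" unfolding acc pr_iff by blast
  next
    assume "\<not> (length u = ?N + ?N * ?N \<and> S \<in> pr (?af u))"
    then obtain T where T: "length u = ?N + ?N * ?N \<Longrightarrow> S \<notin> ad (?af u) \<or> T \<in> ad (?af u) \<and> S \<subset> T"
      "T \<subseteq> arguments (?af u)"
      using not_pr_witness[of S "?af u"] by (cases "length u = ?N + ?N * ?N") auto
    have "T \<subseteq> set xs" using T(2) base.str.chosen_sub(1) by blast
    then have "?T (map (\<lambda>a. a \<in> T) xs) = T"
      by (rule base.str.chosen_set_eq) (auto simp: has_bit_def)
    then have "accepts pr_com (pair (pair x u) (map (\<lambda>a. a \<in> T) xs))"
      unfolding acc using T(1) by auto
    moreover have "length (map (\<lambda>a. a \<in> T) xs) \<le> length (pair x u)"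
      by (simp add: length_pair base.length_x)
    ultimately show "\<exists>v. length v \<le> length (pair x u) \<and> accepts pr_com (pair (pair x u) v)" by blast
  qed
  have "?N + ?N * ?N \<le> length x" by (simp add: base.length_x)
  then show ?thesis unfolding inner J base.str.possibly_pr_iff not_not eq_True by metis
qed

lemma pr_False_in_coNP: "STRONG_RELEVANCE (pr :: 'a semantics, False) \<in> promise class_coNP"
proof -
  let ?X = "{x. \<exists>u. length u \<le> length x \<and> accepts not_pr_com (pair x u)}"
  have "?X \<in> ex_poly class_P"
    unfolding ex_poly_def using accepts_in_P[OF wf_not_pr_com]
    by (auto intro!: bexI[of _ "{x. accepts not_pr_com x}"] exI[of _ "[:0, 1 :: nat:]"])
  then have "- ?X \<in> class_coNP" unfolding class_coNP_def class_NP_def by simp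
  moreover have "encode xs I S act e \<in> - ?X \<longleftrightarrow> strongly_relevant (pr, False) I S act e"
    if v: "valid_input (pr, False) xs I S e" for xs I S act and e :: "'a element"
  proof -
    have "wf_iaf I" "e \<in> uncertain_elements I" using v unfolding valid_input_def by auto
    from strongly_relevant_iff[OF this refl, where j = "(pr, False)"] show ?thesis
      using not_pr_com_verifies[OF v refl refl, of act] by simp
  qed
  ultimately show ?thesis by (rule STRONG_RELEVANCE_promise)
qed

text \<open>\<open>?Y\<close> is in NP: the inner certificate refutes that the outer one is good.
  Hence \<open>?X\<close> is in the second existential level, and strong relevance is its complement
  on valid codes.\<close>

lemma pr_True_in_Pi2: "STRONG_RELEVANCE (pr :: 'a semantics, True) \<in> promise class_Pi2"
proof -
  let ?Y = "{w. \<exists>v. length v \<le> length w \<and> accepts pr_com (pair w v)}"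
  let ?X = "{x. \<exists>u. length u \<le> length x \<and> pair x u \<in> - ?Y}"
  have "?Y \<in> ex_poly class_P"
    unfolding ex_poly_def using accepts_in_P[OF wf_pr_com]
    by (auto intro!: bexI[of _ "{x. accepts pr_com x}"] exI[of _ "[:0, 1 :: nat:]"])
  then have "- ?Y \<in> class_coNP" unfolding class_coNP_def class_NP_def by simp
  then have "?X \<in> ex_poly class_coNP"
    unfolding ex_poly_def by (auto intro!: bexI[of _ "- ?Y"] exI[of _ "[:0, 1 :: nat:]"])
  then have "- ?X \<in> class_Pi2" unfolding class_Pi2_def class_Sigma2_def by simp
  moreover have "encode xs I S act e \<in> - ?X \<longleftrightarrow> strongly_relevant (pr, True) I S act e"
    if v: "valid_input (pr, True) xs I S e" for xs I S act and e :: "'a element"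
  proof -
    have "wf_iaf I" "e \<in> uncertain_elements I" using v unfolding valid_input_def by auto
    from strongly_relevant_iff[OF this refl, where j = "(pr, True)"] show ?thesis
      using pr_com_verifies[OF v refl refl, of act] by simp
  qed
  ultimately show ?thesis by (rule STRONG_RELEVANCE_promise)
qed

theorem corollary4:
  shows "(\<forall>j \<in> {ad :: 'a semantics, st, co, gr} \<times> {True, False}.
            STRONG_RELEVANCE j \<in> promise class_P) \<and>
         STRONG_RELEVANCE (pr :: 'a semantics, True) \<in> promise class_Pi2 \<and>
         STRONG_RELEVANCE (pr :: 'a semantics, False) \<in> promise class_coNP"
  using tractable_statuses pr_True_in_Pi2 pr_False_in_coNP by blast

end
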